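(* Let $E$ be a Banach space over a valued field $\mathbb{K}$ and let $f\colon U\to E$ be a mapping on an open subset $U\subseteq E$ which is $C^k$ (respectively $SC^k$, respectively $LC^k$), where $k\in\mathbb{N}\cup\{\infty\}$. In the $C^k$-case, assume moreover that $k\ge 2$, or that $\mathbb{K}$ is locally compact and $E$ has finite dimension. If $f'(x)\in\mathrm{GL}(E)$ for some $x\in U$, then there exists an open neighborhood $V\subseteq U$ of $x$ such that $f(V)$ is open in $E$ and $f|_V\colon V\to f(V)$ is a $C^k$-diffeomorphism (respectively an $SC^k$-diffeomorphism, respectively an $LC^k$-diffeomorphism).
   Context: A valued field is a field $\mathbb{K}$ with a non-trivial absolute value $|\cdot|$ (inducing a non-discrete topology); completeness of $\mathbb{K}$ is not assumed. All topological vector spaces are Hausdorff. A Banach space over $\mathbb{K}$ is a normed $\mathbb{K}$-vector space that is complete in the metric of its norm. $\mathrm{GL}(E)$ is the group of invertible elements of the algebra $\mathcal{L}(E)$ of continuous $\mathbb{K}$-linear maps $E\to E$. A subset has dense interior if its interior is dense in it. $\mathbb{N}=\{1,2,\dots\}$, $\mathbb{N}_0=\mathbb{N}\cup\{0\}$. $C^k$-maps. Let $E,F$ be topological $\mathbb{K}$-vector spaces, $U\subseteq E$ with dense interior, $f\colon U\to F$. Put $U^{[1]}:=\{(x,y,t)\in U\times E\times\mathbb{K}\colon x+ty\in U\}$ (a subset of $E\times E\times \mathbb{K}$ with dense interior). $f$ is $C^0$ if continuous; $C^1$ if continuous and there is a (necessarily unique) continuous map $f^{[1]}\colon U^{[1]}\to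 F$ with $f^{[1]}(x,y,t)=\frac{1}{t}(f(x+ty)-f(x))$ whenever $t\neq 0$. For $k\ge 2$, $f$ is $C^k$ if it is $C^1$ and $f^{[1]}$ is $C^{k-1}$; $C^\infty$ means $C^k$ for all $k$. Put $f^{[0]}:=f$, $U^{[0]}:=U$, $f^{[k]}:=(f^{[1]})^{[k-1]}$, $U^{[k]}:=(U^{[1]})^{[k-1]}$. If $f$ is $C^1$, put $df(x,y):=f^{[1]}(x,y,0)$ and $f'(x):=df(x,\cdot)\colon E\to F$, a continuous linear map. A gauge on a topological $\mathbb{K}$-vector space $E$ is an upper semicontinuous map $\gamma=\|\cdot\|_\gamma\colon E\to[0,\infty[$ with $\gamma(tx)=|t|\gamma(x)$ for all $t\in\mathbb{K}$, $x\in E$. $LC^k$-maps. A map $f\colon U\to F$ on a subset $U\subseteq E$ is Lipschitz continuous if for every $x_0\in U$ and gauge $\gamma$ on $F$ there are a gauge $\eta$ on $E$ and $\delta>0$ with $\|f(y)-f(x)\|_\gamma\le\|y-x\|_\eta$ for all $x,y\in U$ with $\|x-x_0\|_\eta<\delta$, $\|y-x_0\|_\eta<\delta$. If $U$ has dense interior, $f$ is $LC^k$ ($k\in\mathbb{N}_0\cup\{\infty\}$) if $f$ is $C^k$ and $f^{[j]}\colon U^{[j]}\to F$ is Lipschitz continuous for all $j\in\mathbb{N}_0$ with $j\le k$. $SC^k$-maps. Let $U\subseteq E$ have dense interior. $f\colon U\to F$ is strictly differentiable if for each $x\in U$ there is a continuous linear map $f'(x)\colon E\to F$ such that for each gauge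 $\gamma$ on $F$ there is a gauge $\eta$ on $E$ such that for each $\varepsilon>0$ there is $\delta>0$ with $\|f(z)-f(y)-f'(x)(z-y)\|_\gamma\le\varepsilon\|z-y\|_\eta$ for all $y,z\in U$ with $\|z-x\|_\eta<\delta$, $\|y-x\|_\eta<\delta$. (Strictly differentiable maps are $C^1$, with the same $f'(x)$.) $f$ is $SC^0$ if continuous, $SC^1$ if strictly differentiable, and inductively $SC^{k+1}$ if it is $SC^k$ (hence $C^k$) and $f^{[k]}$ is strictly differentiable; $SC^\infty$ means $SC^k$ for all $k$. A $C^k$- (resp. $SC^k$-, $LC^k$-) diffeomorphism is a bijection between subsets with dense interior such that it and its inverse, viewed as maps into the ambient topological vector spaces, are $C^k$ (resp. $SC^k$, $LC^k$). *)

theory Defs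
  imports "HOL-Analysis.Analysis"
begin

section \<open>Valued fields and Banach spaces over them\<close>

text \<open>
  The library's \<open>norm\<close> is constrained to real vector spaces, so a norm on an abelian group is
  introduced as a separate class parameter.  Definiteness and the triangle inequality follow from
  the metric axioms, see the lemmas below.  Topology and uniformity are those of the metric.
\<close>

class normed_group = ab_group_add + metric_space +
  fixes gnorm :: "'a \<Rightarrow> real"
  assumes dist_gnorm: "dist x y = gnorm (x - y)"

lemma gnorm_eq_0_iff: "gnorm x = 0 \<longleftrightarrow> x = 0"
  for x :: "'a::normed_group"
  using dist_gnorm[of x 0] dist_eq_0_iff[of x 0] by simp

lemma gnorm_ge_0: "0 \<le> gnorm x"
  for x :: "'a::normed_group"
  using dist_gnorm[of x 0] zero_le_dist[of x 0] by simp

lemma gnorm_triangle: "gnorm (x + y) \<le> gnorm x + gnorm y"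
  for x y :: "'a::normed_group"
  using dist_triangle2[of x "- y" 0] dist_gnorm[of x "- y"] dist_gnorm[of x 0]
    dist_commute[of "- y" 0] dist_gnorm[of 0 "- y"] by simp

text \<open>For elements of the field, \<open>gnorm\<close> is the absolute value.\<close>

class valued_field = field + normed_group +
  assumes abs_value_mult: "gnorm (x * y) = gnorm x * gnorm y"
    and abs_value_nontrivial: "\<exists>x. x \<noteq> 0 \<and> gnorm x \<noteq> 1"

text \<open>Completeness of the metric of the norm is \<^class>\<open>complete_space\<close>.\<close>

locale banach_over = vector_space scl
  for scl :: "'k::valued_field \<Rightarrow> 'e::{normed_group,complete_space} \<Rightarrow> 'e" +
  assumes gnorm_scale: "gnorm (scl t x) = gnorm t * gnorm x"

section \<open>Topological vector spaces as explicit structures\<close>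

text \<open>
  The domains of the iterated difference quotients live in the spaces
  \<open>E\<close>, \<open>E \<times> E \<times> K\<close>, \<open>(E \<times> E \<times> K) \<times> (E \<times> E \<times> K) \<times> K\<close>, and so on.  To be able to
  iterate, topological vector spaces are explicit structures whose carrier is the underlying set
  of the topology.  The operations are only relevant on the carrier.
\<close>

record ('k, 'x) tvs =
  top_of :: "'x topology"
  add_of :: "'x \<Rightarrow> 'x \<Rightarrow> 'x"
  scale_of :: "'k \<Rightarrow> 'x \<Rightarrow> 'x"

abbreviation carrier_of :: "('k, 'x) tvs \<Rightarrow> 'x set"
  where "carrier_of X \<equiv> topspace (top_of X)"

definition diff_of :: "('k::valued_field, 'x) tvs \<Rightarrow> 'x \<Rightarrow> 'x \<Rightarrow> 'x"
  where "diff_of X x y = add_of X x (scale_of X (- 1) y)"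

definition normed_tvs ::
  "('k::valued_field \<Rightarrow> 'e::normed_group \<Rightarrow> 'e) \<Rightarrow> ('k, 'e) tvs"
  where "normed_tvs scl = \<lparr>top_of = euclidean, add_of = (+), scale_of = scl\<rparr>"

text \<open>The space \<open>E \<times> E \<times> K\<close>.\<close>

definition quot_space :: "('k::valued_field, 'x) tvs \<Rightarrow> ('k, 'x \<times> 'x \<times> 'k) tvs"
  where "quot_space X =
    \<lparr>top_of = prod_topology (top_of X) (prod_topology (top_of X) euclidean),
     add_of = (\<lambda>(x, y, t) (x', y', t'). (add_of X x x', add_of X y y', t + t')),
     scale_of = (\<lambda>s (x, y, t). (scale_of X s x, scale_of X s y, s * t))\<rparr>"

definition continuous_linear ::
  "('k::valued_field, 'x) tvs \<Rightarrow> ('k, 'y) tvs \<Rightarrow> ('x \<Rightarrow> 'y) \<Rightarrow> bool"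
  where "continuous_linear X Y A \<longleftrightarrow>
    continuous_map (top_of X) (top_of Y) A \<and>
    (\<forall>x\<in>carrier_of X. \<forall>y\<in>carrier_of X. A (add_of X x y) = add_of Y (A x) (A y)) \<and>
    (\<forall>t. \<forall>x\<in>carrier_of X. A (scale_of X t x) = scale_of Y t (A x))"

definition GL :: "('k::valued_field, 'x) tvs \<Rightarrow> ('x \<Rightarrow> 'x) set"
  where "GL X = {A. continuous_linear X X A \<and>
    (\<exists>B. continuous_linear X X B \<and> (\<forall>x\<in>carrier_of X. B (A x) = x \<and> A (B x) = x))}"

text \<open>Upper semicontinuity is openness of the strict sublevel sets.\<close>

definition gauge_on :: "('k::valued_field, 'x) tvs \<Rightarrow> ('x \<Rightarrow> real) \<Rightarrow> bool"
  where "gauge_on X \<gamma> \<longleftrightarrow>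
    (\<forall>x\<in>carrier_of X. 0 \<le> \<gamma> x) \<and>
    (\<forall>r. openin (top_of X) {x \<in> carrier_of X. \<gamma> x < r}) \<and>
    (\<forall>t. \<forall>x\<in>carrier_of X. \<gamma> (scale_of X t x) = gnorm t * \<gamma> x)"

definition dense_interior :: "('k, 'x) tvs \<Rightarrow> 'x set \<Rightarrow> bool"
  where "dense_interior X U \<longleftrightarrow>
    U \<subseteq> carrier_of X \<and> U \<subseteq> top_of X closure_of (top_of X interior_of U)"

section \<open>The three differentiability notions of order one\<close>

text \<open>
  In this and the next section, maps are defined on sets with dense interior; this standing
  assumption is not repeated in the definitions (it is part of the diffeomorphism predicates).
\<close>

definition continuous_to ::
  "('k, 'x) tvs \<Rightarrow> ('k, 'y) tvs \<Rightarrow> 'x set \<Rightarrow> ('x \<Rightarrow> 'y) \<Rightarrow> bool"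
  where "continuous_to X Y U f \<longleftrightarrow> continuous_map (subtopology (top_of X) U) (top_of Y) f"

definition quot_dom :: "('k::valued_field, 'x) tvs \<Rightarrow> 'x set \<Rightarrow> ('x \<times> 'x \<times> 'k) set"
  where "quot_dom X U =
    {(x, y, t). x \<in> U \<and> y \<in> carrier_of X \<and> add_of X x (scale_of X t y) \<in> U}"

definition extends_quot ::
  "('k::valued_field, 'x) tvs \<Rightarrow> ('k, 'y) tvs \<Rightarrow> 'x set \<Rightarrow> ('x \<Rightarrow> 'y) \<Rightarrow>
   ('x \<times> 'x \<times> 'k \<Rightarrow> 'y) \<Rightarrow> bool"
  where "extends_quot X Y U f g \<longleftrightarrow>
    continuous_to (quot_space X) Y (quot_dom X U) g \<and>
    (\<forall>x y t. (x, y, t) \<in> quot_dom X U \<longrightarrow> t \<noteq> 0 \<longrightarrow>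
      g (x, y, t) = scale_of Y (1 / t) (diff_of Y (f (add_of X x (scale_of X t y))) (f x)))"

definition C1_map ::
  "('k::valued_field, 'x) tvs \<Rightarrow> ('k, 'y) tvs \<Rightarrow> 'x set \<Rightarrow> ('x \<Rightarrow> 'y) \<Rightarrow> bool"
  where "C1_map X Y U f \<longleftrightarrow> continuous_to X Y U f \<and> (\<exists>g. extends_quot X Y U f g)"

text \<open>
  The map \<open>f\<^sup>[\<^sup>1\<^sup>]\<close>.  For a \<open>C\<^sup>1\<close>-map it is uniquely determined on \<open>quot_dom X U\<close>, which is the
  only place where its values are used.
\<close>

definition quot_map ::
  "('k::valued_field, 'x) tvs \<Rightarrow> ('k, 'y) tvs \<Rightarrow> 'x set \<Rightarrow> ('x \<Rightarrow> 'y) \<Rightarrow> 'x \<times> 'x \<times> 'k \<Rightarrow> 'y"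
  where "quot_map X Y U f = (SOME g. extends_quot X Y U f g)"

definition derivative ::
  "('k::valued_field, 'x) tvs \<Rightarrow> ('k, 'y) tvs \<Rightarrow> 'x set \<Rightarrow> ('x \<Rightarrow> 'y) \<Rightarrow> 'x \<Rightarrow> 'x \<Rightarrow> 'y"
  where "derivative X Y U f x = (\<lambda>y. quot_map X Y U f (x, y, 0))"

definition lipschitz_cont ::
  "('k::valued_field, 'x) tvs \<Rightarrow> ('k, 'y) tvs \<Rightarrow> 'x set \<Rightarrow> ('x \<Rightarrow> 'y) \<Rightarrow> bool"
  where "lipschitz_cont X Y U f \<longleftrightarrow>
    (\<forall>x0\<in>U. \<forall>\<gamma>. gauge_on Y \<gamma> \<longrightarrow>
      (\<exists>\<eta> \<delta>. gauge_on X \<eta> \<and> \<delta> > 0 \<and>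
        (\<forall>x\<in>U. \<forall>y\<in>U. \<eta> (diff_of X x x0) < \<delta> \<longrightarrow> \<eta> (diff_of X y x0) < \<delta> \<longrightarrow>
          \<gamma> (diff_of Y (f y) (f x)) \<le> \<eta> (diff_of X y x))))"

definition strictly_diff ::
  "('k::valued_field, 'x) tvs \<Rightarrow> ('k, 'y) tvs \<Rightarrow> 'x set \<Rightarrow> ('x \<Rightarrow> 'y) \<Rightarrow> bool"
  where "strictly_diff X Y U f \<longleftrightarrow>
    (\<forall>x\<in>U. \<exists>A. continuous_linear X Y A \<and>
      (\<forall>\<gamma>. gauge_on Y \<gamma> \<longrightarrow>
        (\<exists>\<eta>. gauge_on X \<eta> \<and>
          (\<forall>\<epsilon>>0. \<exists>\<delta>>0. \<forall>y\<in>U. \<forall>z\<in>U.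
            \<eta> (diff_of X z x) < \<delta> \<longrightarrow> \<eta> (diff_of X y x) < \<delta> \<longrightarrow>
            \<gamma> (diff_of Y (diff_of Y (f z) (f y)) (A (diff_of X z y)))
              \<le> \<epsilon> * \<eta> (diff_of X z y)))))"

section \<open>Iteration\<close>

text \<open>
  HOL has no types depending on the order \<open>n\<close> of iteration.  The points of all the iterated
  spaces over \<open>E\<close> are therefore collected in one type: \<open>Base x\<close> stands for the point \<open>x\<close> of
  \<open>E\<close>, and \<open>Node (p, q, t)\<close> for the triple \<open>(p, q, t)\<close> of two points of the preceding space and a
  scalar.  A space, set or map is moved into this type along the injection \<open>Base\<close> or \<open>Node\<close>.
\<close>

datatype ('x, 'k) iter_point =
    Base (base_of: 'x)
  | Node (node_of: "('x, 'k) iter_point \<times> ('x, 'k) iter_point \<times> 'k")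

text \<open>The isomorphic copy of a space along an injection \<open>i\<close> with left inverse \<open>d\<close>.\<close>

definition copy_tvs :: "('x \<Rightarrow> 'y) \<Rightarrow> ('y \<Rightarrow> 'x) \<Rightarrow> ('k, 'x) tvs \<Rightarrow> ('k, 'y) tvs"
  where "copy_tvs i d X =
    \<lparr>top_of = pullback_topology (range i) d (top_of X),
     add_of = (\<lambda>a b. i (add_of X (d a) (d b))),
     scale_of = (\<lambda>t a. i (scale_of X t (d a)))\<rparr>"

definition base_space :: "('k::valued_field, 'x) tvs \<Rightarrow> ('k, ('x, 'k) iter_point) tvs"
  where "base_space X = copy_tvs Base base_of X"

definition base_dom :: "'x set \<Rightarrow> ('x, 'k) iter_point set"
  where "base_dom U = Base ` U"

definition base_map :: "('x \<Rightarrow> 'y) \<Rightarrow> ('x, 'k) iter_point \<Rightarrow> 'y"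
  where "base_map f = f \<circ> base_of"

definition next_space ::
  "('k::valued_field, ('x, 'k) iter_point) tvs \<Rightarrow> ('k, ('x, 'k) iter_point) tvs"
  where "next_space S = copy_tvs Node node_of (quot_space S)"

definition next_dom ::
  "('k::valued_field, ('x, 'k) iter_point) tvs \<Rightarrow> ('x, 'k) iter_point set \<Rightarrow>
   ('x, 'k) iter_point set"
  where "next_dom S W = Node ` quot_dom S W"

definition next_map ::
  "('k::valued_field, ('x, 'k) iter_point) tvs \<Rightarrow> ('k, 'y) tvs \<Rightarrow> ('x, 'k) iter_point set \<Rightarrow>
   (('x, 'k) iter_point \<Rightarrow> 'y) \<Rightarrow> ('x, 'k) iter_point \<Rightarrow> 'y"
  where "next_map S Y W g = quot_map S Y W g \<circ> node_of"

fun iter_space ::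
  "nat \<Rightarrow> ('k::valued_field, ('x, 'k) iter_point) tvs \<Rightarrow> ('k, ('x, 'k) iter_point) tvs"
  where
    "iter_space 0 S = S"
  | "iter_space (Suc k) S = iter_space k (next_space S)"

fun iter_dom ::
  "nat \<Rightarrow> ('k::valued_field, ('x, 'k) iter_point) tvs \<Rightarrow> ('x, 'k) iter_point set \<Rightarrow>
   ('x, 'k) iter_point set"
  where
    "iter_dom 0 S W = W"
  | "iter_dom (Suc k) S W = iter_dom k (next_space S) (next_dom S W)"

fun iter_map ::
  "nat \<Rightarrow> ('k::valued_field, ('x, 'k) iter_point) tvs \<Rightarrow> ('k, 'y) tvs \<Rightarrow>
   ('x, 'k) iter_point set \<Rightarrow> (('x, 'k) iter_point \<Rightarrow> 'y) \<Rightarrow> ('x, 'k) iter_point \<Rightarrow> 'y"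
  where
    "iter_map 0 S Y W g = g"
  | "iter_map (Suc k) S Y W g = iter_map k (next_space S) Y (next_dom S W) (next_map S Y W g)"

fun iter_Ck ::
  "nat \<Rightarrow> ('k::valued_field, ('x, 'k) iter_point) tvs \<Rightarrow> ('k, 'y) tvs \<Rightarrow>
   ('x, 'k) iter_point set \<Rightarrow> (('x, 'k) iter_point \<Rightarrow> 'y) \<Rightarrow> bool"
  where
    "iter_Ck 0 S Y W g \<longleftrightarrow> continuous_to S Y W g"
  | "iter_Ck (Suc 0) S Y W g \<longleftrightarrow> C1_map S Y W g"
  | "iter_Ck (Suc (Suc k)) S Y W g \<longleftrightarrow> C1_map S Y W g \<and>
       iter_Ck (Suc k) (next_space S) Y (next_dom S W) (next_map S Y W g)"

fun iter_SCk ::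
  "nat \<Rightarrow> ('k::valued_field, ('x, 'k) iter_point) tvs \<Rightarrow> ('k, 'y) tvs \<Rightarrow>
   ('x, 'k) iter_point set \<Rightarrow> (('x, 'k) iter_point \<Rightarrow> 'y) \<Rightarrow> bool"
  where
    "iter_SCk 0 S Y W g \<longleftrightarrow> continuous_to S Y W g"
  | "iter_SCk (Suc 0) S Y W g \<longleftrightarrow> strictly_diff S Y W g"
  | "iter_SCk (Suc (Suc k)) S Y W g \<longleftrightarrow> iter_SCk (Suc k) S Y W g \<and>
       strictly_diff (iter_space (Suc k) S) Y (iter_dom (Suc k) S W) (iter_map (Suc k) S Y W g)"

text \<open>
  The classes \<open>C\<^sup>k\<close>, \<open>SC\<^sup>k\<close>, \<open>LC\<^sup>k\<close> for \<open>k\<close> a natural number or infinity; for \<open>k = \<infinity>\<close> the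
  condition is imposed for all finite orders.
\<close>

definition Ck_map ::
  "enat \<Rightarrow> ('k::valued_field, 'x) tvs \<Rightarrow> ('k, 'y) tvs \<Rightarrow> 'x set \<Rightarrow> ('x \<Rightarrow> 'y) \<Rightarrow> bool"
  where "Ck_map k X Y U f \<longleftrightarrow>
    (case k of
       enat n \<Rightarrow> iter_Ck n (base_space X) Y (base_dom U) (base_map f)
     | \<infinity> \<Rightarrow> (\<forall>n. iter_Ck n (base_space X) Y (base_dom U) (base_map f)))"

definition SCk_map ::
  "enat \<Rightarrow> ('k::valued_field, 'x) tvs \<Rightarrow> ('k, 'y) tvs \<Rightarrow> 'x set \<Rightarrow> ('x \<Rightarrow> 'y) \<Rightarrow> bool"
  where "SCk_map k X Y U f \<longleftrightarrow>
    (case k of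
       enat n \<Rightarrow> iter_SCk n (base_space X) Y (base_dom U) (base_map f)
     | \<infinity> \<Rightarrow> (\<forall>n. iter_SCk n (base_space X) Y (base_dom U) (base_map f)))"

definition LCk_map ::
  "enat \<Rightarrow> ('k::valued_field, 'x) tvs \<Rightarrow> ('k, 'y) tvs \<Rightarrow> 'x set \<Rightarrow> ('x \<Rightarrow> 'y) \<Rightarrow> bool"
  where "LCk_map k X Y U f \<longleftrightarrow> Ck_map k X Y U f \<and>
    (\<forall>j::nat. enat j \<le> k \<longrightarrow>
      lipschitz_cont (iter_space j (base_space X)) Y
        (iter_dom j (base_space X) (base_dom U))
        (iter_map j (base_space X) Y (base_dom U) (base_map f)))"

section \<open>Diffeomorphisms\<close>

definition Ck_diffeo ::
  "enat \<Rightarrow> ('k::valued_field, 'x) tvs \<Rightarrow> ('k, 'y) tvs \<Rightarrow> 'x set \<Rightarrow> 'y set \<Rightarrow> ('x \<Rightarrow> 'y) \<Rightarrow> bool"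
  where "Ck_diffeo k X Y V W f \<longleftrightarrow>
    dense_interior X V \<and> dense_interior Y W \<and> bij_betw f V W \<and>
    Ck_map k X Y V f \<and> Ck_map k Y X W (inv_into V f)"

definition SCk_diffeo ::
  "enat \<Rightarrow> ('k::valued_field, 'x) tvs \<Rightarrow> ('k, 'y) tvs \<Rightarrow> 'x set \<Rightarrow> 'y set \<Rightarrow> ('x \<Rightarrow> 'y) \<Rightarrow> bool"
  where "SCk_diffeo k X Y V W f \<longleftrightarrow>
    dense_interior X V \<and> dense_interior Y W \<and> bij_betw f V W \<and>
    SCk_map k X Y V f \<and> SCk_map k Y X W (inv_into V f)"

definition LCk_diffeo ::
  "enat \<Rightarrow> ('k::valued_field, 'x) tvs \<Rightarrow> ('k, 'y) tvs \<Rightarrow> 'x set \<Rightarrow> 'y set \<Rightarrow> ('x \<Rightarrow> 'y) \<Rightarrow> bool"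
  where "LCk_diffeo k X Y V W f \<longleftrightarrow>
    dense_interior X V \<and> dense_interior Y W \<and> bij_betw f V W \<and>
    LCk_map k X Y V f \<and> LCk_map k Y X W (inv_into V f)"

end

theory Submission
  imports Defs
begin

text \<open>
  Existence of the inverse and its regularity are separate matters.

  For the existence, strict differentiability at \<open>x\<close> is what counts: near \<open>x\<close> the map \<open>f\<close> differs
  from the invertible linear map \<open>f'(x)\<close> by a map with a small Lipschitz constant.  The equation
  \<open>f(y) = v\<close> can then be solved by a contraction, so \<open>f\<close> is injective with open image on a
  neighbourhood \<open>V\<close>; and the derivatives at the other points of \<open>V\<close>, which are close to \<open>f'(x)\<close>,
  are invertible by the same argument (\<open>close_to_linear_open\<close>, \<open>local_inverse\<close>).  Strict
  differentiability is the hypothesis in the \<open>SC\<^sup>k\<close> case.  In the other cases it is derived from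
  \<open>f(y + t h) - f(y) = t f\<^sup>[\<^sup>1\<^sup>](y, h, t)\<close>: it amounts to continuity of \<open>f\<^sup>[\<^sup>1\<^sup>]\<close> at \<open>t = 0\<close>, uniformly
  in enough directions \<open>h\<close>.  A local Lipschitz condition on \<open>f\<^sup>[\<^sup>1\<^sup>]\<close> gives this for all small \<open>h\<close>
  (\<open>Lip_quotient_imp_Strict\<close>), and such a condition holds for \<open>LC\<^sup>1\<close>-maps by definition and for
  \<open>C\<^sup>2\<close>-maps because every \<open>C\<^sup>1\<close>-map is locally Lipschitz (\<open>C1_imp_Lip\<close>).  In finite dimension over
  a locally compact field, a compact set of directions suffices
  (\<open>compact_absorbing_imp_Strict\<close>).

  The inverse \<open>g\<close> is then strictly differentiable, hence \<open>C\<^sup>1\<close>.  Its regularity of higher order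
  follows by induction.  The prolongation \<open>F(x, y, t) = (f(x), f\<^sup>[\<^sup>1\<^sup>](x, y, t), t)\<close> is one order less
  smooth than \<open>f\<close>, and its inverse is the prolongation of \<open>g\<close>, since
  \<open>f\<^sup>[\<^sup>1\<^sup>](g(x), g\<^sup>[\<^sup>1\<^sup>](x, y, t), t) = y\<close>.  The induction hypothesis for \<open>F\<close> yields the regularity of
  the prolongation of \<open>g\<close>, in particular of \<open>g\<^sup>[\<^sup>1\<^sup>]\<close> (\<open>iter_prop_inverse\<close>).  To apply it one has to
  know that the inverse of \<open>F\<close> is \<open>C\<^sup>1\<close>, that is, that \<open>g\<close> is \<open>C\<^sup>2\<close> if \<open>f\<close> is.  This is the heart of
  the matter: the difference quotients of \<open>g\<^sup>[\<^sup>1\<^sup>]\<close> are expressed by \<open>f\<close>, \<open>f\<^sup>[\<^sup>2\<^sup>]\<close>, \<open>g\<close> and \<open>g\<^sup>[\<^sup>1\<^sup>]\<close>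
  in a way that makes sense when the denominator vanishes (\<open>second_quotient_formula\<close>,
  \<open>C1_quotient_inverse\<close>).  The same computation bounds the increments of \<open>g\<^sup>[\<^sup>1\<^sup>]\<close> in the \<open>LC\<^sup>k\<close>
  case (\<open>Lip_quotient_inverse\<close>), and in the \<open>SC\<^sup>k\<close> case the inverse of a strictly differentiable map
  is strictly differentiable (\<open>Strict_inverse\<close>).  The induction is carried out once for all three
  classes, which differ only in a condition \<open>P\<close> on the quotient maps of lower order and a
  condition \<open>R\<close> on the last one.

  The induction passes from \<open>E\<close> to \<open>E \<times> E \<times> K\<close> and on.  So that it can be stated, all these spaces
  are realised as closed subspaces of one normed space (\<open>triple_space\<close>), in which a quotient map
  is again a map between subsets of the same space.  Norms replace gauges there, and a separate
  part identifies the notions on both sides (\<open>iter_transfer\<close>).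
\<close>

section \<open>Normed groups and valued fields\<close>

lemma gnorm_zero [simp]: "gnorm (0::'a::normed_group) = 0"
  by (simp add: gnorm_eq_0_iff)

lemma gnorm_pos_iff [simp]: "0 < gnorm x \<longleftrightarrow> x \<noteq> 0" for x :: "'a::normed_group"
  using gnorm_ge_0[of x] gnorm_eq_0_iff[of x] by linarith

lemma gnorm_uminus [simp]: "gnorm (- x) = gnorm x" for x :: "'a::normed_group"
  using dist_gnorm[of 0 x] dist_gnorm[of x 0] by (simp add: dist_commute)

lemma gnorm_diff_commute: "gnorm (x - y) = gnorm (y - x)" for x y :: "'a::normed_group"
  using dist_commute[of x y] by (simp add: dist_gnorm)

lemma gnorm_diff_le: "gnorm (x - y) \<le> gnorm x + gnorm y" for x y :: "'a::normed_group"
  using gnorm_triangle[of x "- y"] by simp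

lemma gnorm_diff_triangle: "gnorm (x - z) \<le> gnorm (x - y) + gnorm (y - z)"
  for x y z :: "'a::normed_group"
  using gnorm_triangle[of "x - y" "y - z"] by simp

lemma tendsto_iff_gnorm:
  "(f \<longlongrightarrow> l) F \<longleftrightarrow> ((\<lambda>x. gnorm (f x - l)) \<longlongrightarrow> 0) F" for l :: "'a::normed_group"
  by (simp add: tendsto_dist_iff[of f] dist_gnorm)

lemma tendsto_gnorm_squeeze:
  fixes l :: "'a::normed_group"
  assumes "(h \<longlongrightarrow> 0) F" "\<forall>\<^sub>F x in F. gnorm (f x - l) \<le> h x"
  shows "(f \<longlongrightarrow> l) F"
  unfolding tendsto_iff_gnorm
  by (rule tendsto_sandwich[where f = "\<lambda>_. 0" and h = h]) (use assms in \<open>auto simp: gnorm_ge_0\<close>)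

instance normed_group \<subseteq> topological_ab_group_add
proof
  fix a b :: 'a
  let ?F = "nhds a \<times>\<^sub>F nhds b"
  have fst: "(fst \<longlongrightarrow> a) ?F" and snd: "(snd \<longlongrightarrow> b) ?F"
    by (auto intro: filterlim_fst filterlim_snd)
  have "((\<lambda>x. gnorm (fst x - a) + gnorm (snd x - b)) \<longlongrightarrow> 0 + 0) ?F"
    using fst snd unfolding tendsto_iff_gnorm by (rule tendsto_add)
  then show "LIM x ?F. fst x + snd x :> nhds (a + b)"
    using gnorm_triangle[of "fst x - a" "snd x - b" for x]
    by (intro tendsto_gnorm_squeeze[where h = "\<lambda>x. gnorm (fst x - a) + gnorm (snd x - b)"])
      (auto simp: algebra_simps)
next
  fix a :: 'a
  have "((\<lambda>x. gnorm (x - a)) \<longlongrightarrow> 0) (nhds a)"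
    unfolding tendsto_iff_gnorm[symmetric] by (rule filterlim_ident)
  then show "(uminus \<longlongrightarrow> - a) (nhds a)"
    unfolding tendsto_iff_gnorm[of uminus "- a"]
    by (simp add: gnorm_diff_commute)
qed

lemma tendsto_gnorm [tendsto_intros]:
  "(f \<longlongrightarrow> l) F \<Longrightarrow> ((\<lambda>x. gnorm (f x)) \<longlongrightarrow> gnorm l) F" for l :: "'a::normed_group"
  using tendsto_dist[of f l F "\<lambda>_. 0" 0] by (simp add: dist_gnorm)

text \<open>Completeness has to be dropped from the notion of a Banach space: the space
  \<open>E \<times> E \<times> K\<close> has the possibly incomplete field \<open>K\<close> as a factor.\<close>

locale normed_space = vector_space scl
  for scl :: "'k::valued_field \<Rightarrow> 'w::normed_group \<Rightarrow> 'w" +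
  assumes gnorm_scale: "gnorm (scl t x) = gnorm t * gnorm x"
begin

lemma tendsto_scale [tendsto_intros]:
  assumes "(f \<longlongrightarrow> a) F" "(g \<longlongrightarrow> b) F"
  shows "((\<lambda>x. scl (f x) (g x)) \<longlongrightarrow> scl a b) F"
proof -
  have "((\<lambda>x. gnorm (f x - a) * gnorm (g x - b) + gnorm (f x - a) * gnorm b
      + gnorm a * gnorm (g x - b)) \<longlongrightarrow> 0 * 0 + 0 * gnorm b + gnorm a * 0) F"
    using assms unfolding tendsto_iff_gnorm by (intro tendsto_intros)
  then show ?thesis
    unfolding mult_zero_left mult_zero_right add_0
  proof (rule tendsto_gnorm_squeeze)
    have "gnorm (scl (f x) (g x) - scl a b) \<le> gnorm (f x - a) * gnorm (g x - b)
      + gnorm (f x - a) * gnorm b + gnorm a * gnorm (g x - b)" for x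
    proof -
      have "scl (f x) (g x) - scl a b
        = scl (f x - a) (g x - b) + scl (f x - a) b + scl a (g x - b)"
        by (simp add: algebra_simps)
      then show ?thesis
        using gnorm_triangle[of "scl (f x - a) (g x - b) + scl (f x - a) b" "scl a (g x - b)"]
          gnorm_triangle[of "scl (f x - a) (g x - b)" "scl (f x - a) b"]
        by (simp add: gnorm_scale)
    qed
    then show "\<forall>\<^sub>F x in F. gnorm (scl (f x) (g x) - scl a b) \<le> gnorm (f x - a) * gnorm (g x - b)
      + gnorm (f x - a) * gnorm b + gnorm a * gnorm (g x - b)"
      by (intro always_eventually) simp
  qed
qed

end

lemma normed_space_field: "normed_space ((*) :: 'k::valued_field \<Rightarrow> 'k \<Rightarrow> 'k)"
  by unfold_locales (auto simp: algebra_simps abs_value_mult)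

lemma tendsto_mult_valued [tendsto_intros]:
  fixes f g :: "'a \<Rightarrow> 'k::valued_field"
  assumes "(f \<longlongrightarrow> a) F" "(g \<longlongrightarrow> b) F"
  shows "((\<lambda>x. f x * g x) \<longlongrightarrow> a * b) F"
  using normed_space.tendsto_scale[OF normed_space_field] assms by blast

lemma gnorm_one [simp]: "gnorm (1::'k::valued_field) = 1"
proof -
  have "gnorm (1::'k) * gnorm (1::'k) = gnorm (1::'k)" by (simp flip: abs_value_mult)
  moreover have "gnorm (1::'k) \<noteq> 0" by (simp add: gnorm_eq_0_iff)
  ultimately show ?thesis by simp
qed

lemma gnorm_inverse: "gnorm (1 / t) = 1 / gnorm t" for t :: "'k::valued_field"
proof (cases "t = 0")
  case False
  then have "gnorm (1 / t) * gnorm t = 1" by (simp flip: abs_value_mult)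
  moreover have "gnorm t \<noteq> 0" using False by (simp add: gnorm_eq_0_iff)
  ultimately show ?thesis by (simp add: field_simps)
qed simp

lemma gnorm_divide: "gnorm (x / t) = gnorm x / gnorm t" for x t :: "'k::valued_field"
  using abs_value_mult[of x "1 / t"] gnorm_inverse[of t] by simp

lemma gnorm_power: "gnorm (t ^ n) = gnorm t ^ n" for t :: "'k::valued_field"
  by (induction n) (auto simp: abs_value_mult)

lemma small_scalar_exists: "\<exists>t::'k::valued_field. t \<noteq> 0 \<and> gnorm t < 1"
proof -
  obtain x :: 'k where x: "x \<noteq> 0" "gnorm x \<noteq> 1" using abs_value_nontrivial by blast
  then have "gnorm x > 0" by simp
  show ?thesis
  proof (cases "gnorm x < 1")
    case False
    then show ?thesis using x by (intro exI[of _ "1 / x"]) (auto simp: gnorm_inverse)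
  qed (use x in auto)
qed

definition pivot :: "'k::valued_field"
  where "pivot = (SOME t. t \<noteq> 0 \<and> gnorm t < 1)"

lemma pivot_nz [simp]: "pivot \<noteq> (0::'k::valued_field)"
  and gnorm_pivot: "gnorm (pivot::'k) < 1" "0 < gnorm (pivot::'k)"
  using someI_ex[OF small_scalar_exists[where 'k='k]] unfolding pivot_def by auto

text \<open>The absolute value is not assumed to be dense or discrete; up to the fixed factor
  \<open>gnorm pivot\<close>, though, every positive real number is the absolute value of a scalar.\<close>

lemma scalar_of_size:
  assumes "0 < (r::real)"
  shows "\<exists>t::'k::valued_field. t \<noteq> 0 \<and> gnorm t < r \<and> gnorm (pivot::'k) * r \<le> gnorm t"
proof -
  let ?p = "gnorm (pivot::'k)"
  have p: "0 < ?p" "?p < 1" using gnorm_pivot by auto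
  obtain m where m: "inverse r < (1 / ?p) ^ m"
    using real_arch_pow[of "1 / ?p" "inverse r"] p by auto
  have small: "?p ^ m < r"
    using m assms p by (simp add: field_simps)
  \<comment> \<open>start below \<open>r\<close> and divide by the pivot as long as the value stays below \<open>r\<close>\<close>
  obtain n where n: "\<not> ?p ^ m * (1 / ?p) ^ n < r" and n': "\<And>i. i < n \<Longrightarrow> ?p ^ m * (1 / ?p) ^ i < r"
  proof -
    have "\<exists>n. \<not> ?p ^ m * (1 / ?p) ^ n < r"
    proof -
      obtain n where "r / ?p ^ m < (1 / ?p) ^ n"
        using real_arch_pow[of "1 / ?p" "r / ?p ^ m"] p by auto
      then show ?thesis using p by (intro exI[of _ n]) (simp add: field_simps)
    qed
    then show ?thesis using that ex_least_nat_le[of "\<lambda>n. \<not> ?p ^ m * (1 / ?p) ^ n < r"]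
      by (metis (lifting) exists_least_iff)
  qed
  have "n \<noteq> 0" using n small by (intro notI) simp
  then obtain i where i: "n = Suc i" by (cases n) auto
  define t :: 'k where "t = pivot ^ m * (1 / pivot) ^ i"
  have gt: "gnorm t = ?p ^ m * (1 / ?p) ^ i"
    by (simp add: t_def abs_value_mult gnorm_power gnorm_inverse)
  have "gnorm t < r" using n'[of i] i by (simp add: gt)
  moreover have "?p * r \<le> gnorm t"
    using n p unfolding i gt by (simp add: field_simps)
  moreover have "t \<noteq> 0" by (simp add: t_def)
  ultimately show ?thesis by blast
qed

text \<open>Zero is an accumulation point of the field, so limits \<open>t \<rightarrow> 0\<close>, \<open>t \<noteq> 0\<close> are unique.\<close>

lemma at_zero_neq_bot [simp]: "at (0::'k::valued_field) \<noteq> bot"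
proof -
  have "\<exists>y. y \<in> UNIV \<and> y \<noteq> (0::'k) \<and> dist y 0 < e" if "e > 0" for e
    using scalar_of_size[of e, where 'k='k] that by (auto simp: dist_gnorm)
  then have "(0::'k) islimpt UNIV" by (auto simp: islimpt_approachable)
  then show ?thesis by (simp add: trivial_limit_within)
qed

lemma tendsto_inverse_valued:
  fixes f :: "'a \<Rightarrow> 'k::valued_field"
  assumes f: "(f \<longlongrightarrow> a) F" and a: "a \<noteq> 0"
  shows "((\<lambda>x. 1 / f x) \<longlongrightarrow> 1 / a) F"
proof -
  have ga: "gnorm a > 0" using a by simp
  have "((\<lambda>x. gnorm (f x)) \<longlongrightarrow> gnorm a) F" using f by (rule tendsto_gnorm)
  then have ev: "\<forall>\<^sub>F x in F. gnorm a / 2 < gnorm (f x)"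
    using ga by (intro order_tendstoD(1)) auto
  have "((\<lambda>x. gnorm (f x - a) * (2 / (gnorm a * gnorm a))) \<longlongrightarrow> 0 * (2 / (gnorm a * gnorm a))) F"
    using f unfolding tendsto_iff_gnorm by (intro tendsto_intros)
  then show ?thesis
    unfolding mult_zero_left
  proof (rule tendsto_gnorm_squeeze, goal_cases)
    case 1
    show ?case
      using ev
    proof eventually_elim
      case (elim x)
      then have "gnorm (f x) > 0" using ga by linarith
      then have fx: "f x \<noteq> 0" by simp
      have "1 / p \<le> 2 / q" if "q / 2 < p" "0 < q" for p q :: real
        using that by (simp add: field_simps)
      then have inv: "1 / gnorm (f x) \<le> 2 / gnorm a" using elim ga .
      have "1 / f x - 1 / a = (a - f x) * (1 / f x) * (1 / a)" using fx a by (simp add: field_simps)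
      then have "gnorm (1 / f x - 1 / a) = gnorm (f x - a) * (1 / gnorm (f x)) * (1 / gnorm a)"
        by (simp add: abs_value_mult gnorm_inverse gnorm_diff_commute del: times_divide_eq_right times_divide_eq_left)
      also have "\<dots> \<le> gnorm (f x - a) * (2 / gnorm a) * (1 / gnorm a)"
        using inv gnorm_ge_0 by (intro mult_right_mono mult_left_mono) (auto simp: gnorm_ge_0)
      also have "\<dots> = gnorm (f x - a) * (2 / (gnorm a * gnorm a))" by simp
      finally show ?case .
    qed
  qed
qed

context normed_space
begin

text \<open>Every vector is a scalar multiple of a vector of prescribed small size, where the scalar
  is bounded by a multiple of the norm.  It replaces the normalisation \<open>x / \<parallel>x\<parallel>\<close>.\<close>

lemma rescale:
  assumes r: "0 < (r::real)"
  shows "\<exists>t. \<exists>h. x = scl t h \<and> gnorm h < r \<and> gnorm t * (gnorm (pivot::'k) * r) \<le> gnorm x \<and> (x \<noteq> 0 \<longrightarrow> t \<noteq> 0)"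
proof (cases "x = 0")
  case True
  then show ?thesis using r by (intro exI[of _ 0]) auto
next
  case False
  then have "gnorm x > 0" by simp
  then obtain s :: 'k where s: "s \<noteq> 0" "gnorm s < r / gnorm x" "gnorm (pivot::'k) * (r / gnorm x) \<le> gnorm s"
    using scalar_of_size[of "r / gnorm x"] r by auto
  have gs: "gnorm s > 0" using s by simp
  have "x = scl (1 / s) (scl s x)" using s by simp
  moreover have "gnorm (scl s x) < r" using s \<open>gnorm x > 0\<close> by (simp add: gnorm_scale field_simps)
  moreover have "gnorm (1 / s) * (gnorm (pivot::'k) * r) \<le> gnorm x"
    using s \<open>gnorm x > 0\<close> gs by (simp add: gnorm_inverse field_simps)
  ultimately show ?thesis using s by (metis divide_eq_0_iff zero_neq_one)
qed

end

lemma (in banach_over) normed_space: "normed_space scl"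
  by unfold_locales (rule gnorm_scale)

section \<open>Difference quotients on subspaces of a fixed normed space\<close>

lemma eventually_openin:
  assumes "openin (top_of_set M) U" "(g \<longlongrightarrow> l) F" "l \<in> U" "\<forall>\<^sub>F x in F. g x \<in> M"
  shows "\<forall>\<^sub>F x in F. g x \<in> U"
proof -
  obtain T where T: "open T" "U = M \<inter> T" using assms(1) by (auto simp: openin_open)
  then have "\<forall>\<^sub>F x in F. g x \<in> T" using assms by (auto dest: topological_tendstoD)
  with assms(4) show ?thesis by eventually_elim (use T in auto)
qed

text \<open>A normed space \<open>W\<close> with an embedding \<open>pt\<close> of \<open>W \<times> W \<times> K\<close> into itself and a left
  inverse \<open>(px, py, ps)\<close> of it.  If \<open>M\<close> is a subspace of \<open>W\<close>, a copy of \<open>M \<times> M \<times> K\<close> is again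
  one, so that maps and their quotient maps of all orders are maps between subsets of \<open>W\<close>.\<close>

locale triple_space = normed_space scl for scl :: "'k::valued_field \<Rightarrow> 'w::normed_group \<Rightarrow> 'w" +
  fixes pt :: "'w \<Rightarrow> 'w \<Rightarrow> 'k \<Rightarrow> 'w" and px py :: "'w \<Rightarrow> 'w" and ps :: "'w \<Rightarrow> 'k"
  assumes px_pt [simp]: "px (pt x y t) = x"
    and py_pt [simp]: "py (pt x y t) = y"
    and ps_pt [simp]: "ps (pt x y t) = t"
    and px_add [simp]: "px (v + w) = px v + px w"
    and py_add [simp]: "py (v + w) = py v + py w"
    and ps_add [simp]: "ps (v + w) = ps v + ps w"
    and px_scale [simp]: "px (scl t v) = scl t (px v)"
    and py_scale [simp]: "py (scl t v) = scl t (py v)"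
    and ps_scale [simp]: "ps (scl t v) = t * ps v"
    and pt_add: "pt x y t + pt x' y' t' = pt (x + x') (y + y') (t + t')"
    and pt_scale: "scl s (pt x y t) = pt (scl s x) (scl s y) (s * t)"
    and gnorm_px: "gnorm (px v) \<le> gnorm v"
    and gnorm_py: "gnorm (py v) \<le> gnorm v"
    and gnorm_ps: "gnorm (ps v) \<le> gnorm v"
    and gnorm_pt: "gnorm (pt x y t) \<le> gnorm x + gnorm y + gnorm t"
begin

subsection \<open>Spaces and domains\<close>

lemma scale_minus_one [simp]: "scl (- 1) v = - v"
  using scale_minus_left[of 1 v] by simp

lemma px_uminus [simp]: "px (- v) = - px v" and py_uminus [simp]: "py (- v) = - py v"
  and ps_uminus [simp]: "ps (- v) = - ps v"
  using px_scale[of "- 1" v] py_scale[of "- 1" v] ps_scale[of "- 1" v] by auto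

lemma px_diff [simp]: "px (v - w) = px v - px w" and py_diff [simp]: "py (v - w) = py v - py w"
  and ps_diff [simp]: "ps (v - w) = ps v - ps w"
  using px_add[of v "- w"] py_add[of v "- w"] ps_add[of v "- w"] by auto

lemma pt_diff: "pt x y t - pt x' y' t' = pt (x - x') (y - y') (t - t')"
proof -
  have "- pt x' y' t' = pt (- x') (- y') (- t')" using pt_scale[of "- 1" x' y' t'] by simp
  then show ?thesis using pt_add[of x y t "- x'" "- y'" "- t'"] by (metis diff_conv_add_uminus)
qed

lemma pt_inject [simp]: "pt x y t = pt x' y' t' \<longleftrightarrow> x = x' \<and> y = y' \<and> t = t'"
  by (metis px_pt py_pt ps_pt)

lemma tendsto_px [tendsto_intros]: "(f \<longlongrightarrow> v) F \<Longrightarrow> ((\<lambda>a. px (f a)) \<longlongrightarrow> px v) F"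
  by (rule tendsto_gnorm_squeeze[where h = "\<lambda>a. gnorm (f a - v)"])
    (use gnorm_px[of "f a - v" for a] in \<open>simp_all add: tendsto_iff_gnorm[of f]\<close>)

lemma tendsto_py [tendsto_intros]: "(f \<longlongrightarrow> v) F \<Longrightarrow> ((\<lambda>a. py (f a)) \<longlongrightarrow> py v) F"
  by (rule tendsto_gnorm_squeeze[where h = "\<lambda>a. gnorm (f a - v)"])
    (use gnorm_py[of "f a - v" for a] in \<open>simp_all add: tendsto_iff_gnorm[of f]\<close>)

lemma tendsto_ps [tendsto_intros]: "(f \<longlongrightarrow> v) F \<Longrightarrow> ((\<lambda>a. ps (f a)) \<longlongrightarrow> ps v) F"
  by (rule tendsto_gnorm_squeeze[where h = "\<lambda>a. gnorm (f a - v)"])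
    (use gnorm_ps[of "f a - v" for a] in \<open>simp_all add: tendsto_iff_gnorm[of f]\<close>)

lemma tendsto_pt [tendsto_intros]:
  assumes "(f \<longlongrightarrow> x) F" "(g \<longlongrightarrow> y) F" "(h \<longlongrightarrow> t) F"
  shows "((\<lambda>a. pt (f a) (g a) (h a)) \<longlongrightarrow> pt x y t) F"
proof (rule tendsto_gnorm_squeeze)
  show "((\<lambda>a. gnorm (f a - x) + gnorm (g a - y) + gnorm (h a - t)) \<longlongrightarrow> 0) F"
    using assms by (intro tendsto_add_zero) (simp_all flip: tendsto_iff_gnorm)
qed (simp add: pt_diff gnorm_pt)

text \<open>Closed subspaces, as limits of difference quotients must stay in the subspace in which
  the map takes its values.\<close>

definition closed_subspace :: "'w set \<Rightarrow> bool"
  where "closed_subspace M \<longleftrightarrow> subspace M \<and> closed M"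

text \<open>The equation singles out the triples, because \<open>pt\<close> need not be onto.\<close>

definition next_sp :: "'w set \<Rightarrow> 'w set"
  where "next_sp M = {v. px v \<in> M \<and> py v \<in> M \<and> pt (px v) (py v) (ps v) = v}"

definition qdom :: "'w set \<Rightarrow> 'w set \<Rightarrow> 'w set"
  where "qdom M U = {v \<in> next_sp M. px v \<in> U \<and> px v + scl (ps v) (py v) \<in> U}"

definition open_domain :: "'w set \<Rightarrow> 'w set \<Rightarrow> bool"
  where "open_domain M U \<longleftrightarrow> closed_subspace M \<and> openin (top_of_set M) U"

lemma subspace_ops [intro]:
  assumes "closed_subspace M"
  shows "0 \<in> M" "x \<in> M \<Longrightarrow> y \<in> M \<Longrightarrow> x + y \<in> M" "x \<in> M \<Longrightarrow> y \<in> M \<Longrightarrow> x - y \<in> M"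
    "x \<in> M \<Longrightarrow> scl t x \<in> M"
  using assms by (auto simp: closed_subspace_def intro: subspace_0 subspace_add subspace_diff subspace_scale)

lemma open_domain_space: "open_domain M U \<Longrightarrow> closed_subspace M"
  by (simp add: open_domain_def)

lemma open_domain_subset: "open_domain M U \<Longrightarrow> x \<in> U \<Longrightarrow> x \<in> M"
  by (auto simp: open_domain_def dest: openin_imp_subset)

lemma pt_in_next_sp [simp]: "pt x y t \<in> next_sp M \<longleftrightarrow> x \<in> M \<and> y \<in> M"
  by (simp add: next_sp_def)

lemma next_sp_cases:
  assumes "v \<in> next_sp M"
  obtains x y t where "v = pt x y t" "x \<in> M" "y \<in> M"
  using assms by (metis (mono_tags, lifting) mem_Collect_eq next_sp_def)

lemma pt_in_qdom:
  assumes "open_domain M U"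
  shows "pt x y t \<in> qdom M U \<longleftrightarrow> x \<in> U \<and> y \<in> M \<and> x + scl t y \<in> U"
  using open_domain_subset[OF assms] by (auto simp: qdom_def)

lemma qdom_cases:
  assumes "v \<in> qdom M U"
  obtains x y t where "v = pt x y t" "x \<in> U" "y \<in> M" "x + scl t y \<in> U"
  using assms by (auto simp: qdom_def elim!: next_sp_cases)

lemma continuous_on_parts:
  "continuous_on S px" "continuous_on S py" "continuous_on S ps"
  by (auto simp: continuous_on_def intro!: tendsto_intros tendsto_ident_at)

lemma closed_subspace_next:
  assumes "closed_subspace M"
  shows "closed_subspace (next_sp M)"
  unfolding closed_subspace_def
proof
  show "subspace (next_sp M)"
  proof (rule subspaceI)
    have "pt 0 0 0 = 0" using pt_scale[of 0 0 0 0] by simp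
    then show "0 \<in> next_sp M"
      using assms pt_in_next_sp[of 0 0 0 M] by (auto simp del: pt_in_next_sp)
    show "v + w \<in> next_sp M" if "v \<in> next_sp M" "w \<in> next_sp M" for v w
      using that assms by (auto elim!: next_sp_cases simp: pt_add)
    show "scl t v \<in> next_sp M" if "v \<in> next_sp M" for v t
      using that assms by (auto elim!: next_sp_cases simp: pt_scale)
  qed
  have M: "closed M" using assms by (simp add: closed_subspace_def)
  have "next_sp M = px -` M \<inter> (py -` M \<inter> {v. pt (px v) (py v) (ps v) = v})"
    by (auto simp: next_sp_def)
  moreover have "closed (px -` M)" "closed (py -` M)"
    using M continuous_on_parts[of UNIV] by (auto intro: continuous_closed_vimage simp: continuous_on_eq_continuous_at)
  moreover have "closed {v. pt (px v) (py v) (ps v) = v}"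
    by (rule closed_Collect_eq) (auto simp: continuous_on_def intro!: tendsto_intros tendsto_ident_at)
  ultimately show "closed (next_sp M)" by auto
qed

lemma open_domain_next:
  assumes "open_domain M U"
  shows "open_domain (next_sp M) (qdom M U)"
proof -
  obtain T where T: "open T" "U = M \<inter> T" using assms by (auto simp: open_domain_def openin_open)
  have M: "closed_subspace M" using assms by (rule open_domain_space)
  have "open (px -` T \<inter> (\<lambda>v. px v + scl (ps v) (py v)) -` T)"
    using T(1)
    by (intro open_Int open_vimage)
       (auto simp: continuous_on_def intro!: tendsto_intros tendsto_ident_at)
  moreover have "qdom M U = next_sp M \<inter> (px -` T \<inter> (\<lambda>v. px v + scl (ps v) (py v)) -` T)"
    using T M by (auto simp: qdom_def next_sp_def)
  ultimately show ?thesis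
    using closed_subspace_next[OF M] by (auto simp: open_domain_def openin_open)
qed

lemma qdom_mono: "U \<subseteq> V \<Longrightarrow> qdom M U \<subseteq> qdom M V"
  by (auto simp: qdom_def)

subsection \<open>The quotient map\<close>

text \<open>The quotient map is defined as a total function that depends on the map alone.  In place of
  an extension at \<open>t = 0\<close> it takes the limit of the difference quotients, an arbitrary value if
  there is none.\<close>

definition dq :: "('w \<Rightarrow> 'w) \<Rightarrow> 'w \<Rightarrow> 'w \<Rightarrow> 'k \<Rightarrow> 'w"
  where "dq f x y s = scl (1 / s) (f (x + scl s y) - f x)"

definition qm :: "('w \<Rightarrow> 'w) \<Rightarrow> 'w \<Rightarrow> 'w"
  where "qm f v = (if ps v = 0 then Lim (at 0) (dq f (px v) (py v)) else dq f (px v) (py v) (ps v))"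

text \<open>Continuity of \<open>qm f\<close> at a point \<open>(x, y, 0)\<close> forces its value there to be the limit of the
  difference quotients, see \<open>C1_tendsto_dq\<close> below; so the existence of the limit is part of this
  condition.\<close>

definition C1 :: "'w set \<Rightarrow> 'w set \<Rightarrow> ('w \<Rightarrow> 'w) \<Rightarrow> bool"
  where "C1 M U f \<longleftrightarrow> continuous_on U f \<and> continuous_on (qdom M U) (qm f)"

lemma qm_pt: "t \<noteq> 0 \<Longrightarrow> qm f (pt x y t) = dq f x y t"
  by (simp add: qm_def)

lemma dq_eq: "s \<noteq> 0 \<Longrightarrow> scl s (dq f x y s) = f (x + scl s y) - f x"
  by (simp add: dq_def)

lemma eventually_pt_in_qdom:
  assumes "open_domain M U" "x \<in> U" "y \<in> M"
  shows "\<forall>\<^sub>F s in at 0. pt x y s \<in> qdom M U"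
proof -
  have "((\<lambda>s. x + scl s y) \<longlongrightarrow> x + scl 0 y) (at 0)"
    by (intro tendsto_intros tendsto_ident_at)
  then have "\<forall>\<^sub>F s in at 0. x + scl s y \<in> U"
    using assms open_domain_space[OF assms(1)] open_domain_subset[OF assms(1)]
    by (intro eventually_openin[of M U _ x] always_eventually allI subspace_ops)
      (auto simp: open_domain_def)
  then show ?thesis
    by eventually_elim (use assms in \<open>auto simp: pt_in_qdom\<close>)
qed

lemma tendsto_qdom:
  assumes "open_domain M U" "x \<in> U" "y \<in> M" "continuous_on (qdom M U) h"
  shows "((\<lambda>s. h (pt x y s)) \<longlongrightarrow> h (pt x y 0)) (at 0)"
proof (rule continuous_on_tendsto_compose[OF assms(4)])
  show "((\<lambda>s. pt x y s) \<longlongrightarrow> pt x y 0) (at 0)"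
    by (intro tendsto_intros tendsto_ident_at)
qed (use assms eventually_pt_in_qdom[OF assms(1-3)] in \<open>auto simp: pt_in_qdom\<close>)

lemma C1_tendsto_dq:
  assumes "open_domain M U" "C1 M U f" "x \<in> U" "y \<in> M"
  shows "(dq f x y \<longlongrightarrow> qm f (pt x y 0)) (at 0)"
proof -
  have "((\<lambda>s. qm f (pt x y s)) \<longlongrightarrow> qm f (pt x y 0)) (at 0)"
    using assms by (intro tendsto_qdom) (auto simp: C1_def)
  moreover have "\<forall>\<^sub>F s in at 0. qm f (pt x y s) = dq f x y s"
    using eventually_neq_at_within[of 0 0 UNIV] by eventually_elim (simp add: qm_pt)
  ultimately show ?thesis by (rule Lim_transform_eventually)
qed

lemma qm_zeroI: "(dq f x y \<longlongrightarrow> l) (at 0) \<Longrightarrow> qm f (pt x y 0) = l"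
  by (simp add: qm_def tendsto_Lim)

text \<open>Since the points with \<open>t \<noteq> 0\<close> are dense in \<open>qdom M U\<close>, the difference quotients have at
  most one continuous extension.  This identifies the quotient map in all computations below.\<close>

lemma qm_eqI:
  assumes "open_domain M U" "continuous_on (qdom M U) h"
    and h: "\<And>x y t. pt x y t \<in> qdom M U \<Longrightarrow> t \<noteq> 0 \<Longrightarrow> h (pt x y t) = dq f x y t"
    and v: "v \<in> qdom M U"
  shows "qm f v = h v"
proof -
  obtain x y t where v_eq: "v = pt x y t" and xy: "x \<in> U" "y \<in> M"
    using v by (auto elim: qdom_cases)
  show ?thesis
  proof (cases "t = 0")
    case False
    then show ?thesis using v h by (simp add: v_eq qm_pt)
  next
    case True
    have "((\<lambda>s. h (pt x y s)) \<longlongrightarrow> h (pt x y 0)) (at 0)"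
      using assms xy by (intro tendsto_qdom) auto
    moreover have "\<forall>\<^sub>F s in at 0. h (pt x y s) = dq f x y s"
      using eventually_pt_in_qdom[OF assms(1) xy] eventually_neq_at_within[of 0 0 UNIV]
      by eventually_elim (use h in simp)
    ultimately have "(dq f x y \<longlongrightarrow> h (pt x y 0)) (at 0)" by (rule Lim_transform_eventually)
    then show ?thesis using True by (simp add: v_eq qm_zeroI)
  qed
qed

lemma C1_I:
  assumes "open_domain M U" "continuous_on U f" "continuous_on (qdom M U) h"
    and "\<And>x y t. pt x y t \<in> qdom M U \<Longrightarrow> t \<noteq> 0 \<Longrightarrow> h (pt x y t) = dq f x y t"
  shows "C1 M U f"
  unfolding C1_def using assms qm_eqI[OF assms(1,3,4)]
  by (auto simp: continuous_on_cong[of "qdom M U" "qdom M U" "qm f" h])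

text \<open>Where \<open>t \<noteq> 0\<close> the quotient map is continuous because \<open>f\<close> is.\<close>

lemma C1_I_at_zero:
  assumes "open_domain M U" "continuous_on U f"
    and zero: "\<And>x y. x \<in> U \<Longrightarrow> y \<in> M \<Longrightarrow>
      (qm f \<longlongrightarrow> qm f (pt x y 0)) (at (pt x y 0) within qdom M U)"
  shows "C1 M U f"
  unfolding C1_def continuous_on_def[of "qdom M U"]
proof (intro conjI ballI)
  fix v assume v: "v \<in> qdom M U"
  let ?F = "at v within qdom M U"
  obtain x y t where v_eq: "v = pt x y t" and xy: "x \<in> U" "y \<in> M" "x + scl t y \<in> U"
    using v by (auto elim: qdom_cases)
  show "(qm f \<longlongrightarrow> qm f v) ?F"
  proof (cases "t = 0")
    case True
    then show ?thesis using zero xy by (simp add: v_eq)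
  next
    case False
    have ev: "\<forall>\<^sub>F u in ?F. u \<in> qdom M U" by (simp add: eventually_at_filter)
    have id: "((\<lambda>u. u) \<longlongrightarrow> v) ?F" by (rule tendsto_ident_at)
    have "((\<lambda>u. f (px u)) \<longlongrightarrow> f (px v)) ?F"
      using xy by (intro continuous_on_tendsto_compose[OF assms(2)] tendsto_px id
          eventually_mono[OF ev]) (auto simp: v_eq qdom_def)
    moreover have "((\<lambda>u. f (px u + scl (ps u) (py u))) \<longlongrightarrow> f (px v + scl (ps v) (py v))) ?F"
      using xy by (intro continuous_on_tendsto_compose[OF assms(2)] tendsto_intros id
          eventually_mono[OF ev]) (auto simp: v_eq qdom_def)
    moreover have "((\<lambda>u. 1 / ps u) \<longlongrightarrow> 1 / ps v) ?F"
      using False by (intro tendsto_inverse_valued tendsto_ps id) (simp add: v_eq)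
    ultimately have "((\<lambda>u. dq f (px u) (py u) (ps u)) \<longlongrightarrow> dq f (px v) (py v) (ps v)) ?F"
      unfolding dq_def by (intro tendsto_intros)
    moreover have "\<forall>\<^sub>F u in ?F. dq f (px u) (py u) (ps u) = qm f u"
    proof -
      have "\<forall>\<^sub>F u in ?F. ps u \<noteq> 0"
        using False by (intro tendsto_imp_eventually_ne[OF tendsto_ps[OF id]]) (simp add: v_eq)
      then show ?thesis by eventually_elim (simp add: qm_def)
    qed
    ultimately show ?thesis
      using False by (auto simp: v_eq qm_pt intro: Lim_transform_eventually)
  qed
qed (fact assms)

lemma C1_subdomain: "C1 M U f \<Longrightarrow> V \<subseteq> U \<Longrightarrow> C1 M V f"
  by (auto simp: C1_def intro: continuous_on_subset qdom_mono[THEN subsetD])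

lemma dq_cong: "f x = g x \<Longrightarrow> f (x + scl s y) = g (x + scl s y) \<Longrightarrow> dq f x y s = dq g x y s"
  by (simp add: dq_def)

lemma qm_cong:
  assumes "open_domain M U" and eq: "\<And>x. x \<in> U \<Longrightarrow> f x = g x" and v: "v \<in> qdom M U"
  shows "qm f v = qm g v"
proof -
  obtain x y t where v_eq: "v = pt x y t" and xy: "x \<in> U" "y \<in> M" "x + scl t y \<in> U"
    using v by (auto elim: qdom_cases)
  show ?thesis
  proof (cases "t = 0")
    case True
    have "\<forall>\<^sub>F s in at 0. dq f x y s = dq g x y s"
      using eventually_pt_in_qdom[OF assms(1) xy(1,2)]
      by eventually_elim (use eq in \<open>auto simp: pt_in_qdom[OF assms(1)] intro: dq_cong\<close>)
    then have "(dq f x y \<longlongrightarrow> l) (at 0) \<longleftrightarrow> (dq g x y \<longlongrightarrow> l) (at 0)" for l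
      by (rule tendsto_cong)
    then show ?thesis using True by (simp add: v_eq qm_def t2_space_class.Lim_def)
  next
    case False
    then show ?thesis using eq xy by (auto simp: v_eq qm_pt intro: dq_cong)
  qed
qed

lemma qm_in:
  assumes "open_domain M U" "C1 M U f" "closed_subspace N" "\<And>x. x \<in> U \<Longrightarrow> f x \<in> N" "v \<in> qdom M U"
  shows "qm f v \<in> N"
proof -
  obtain x y t where v_eq: "v = pt x y t" and xy: "x \<in> U" "y \<in> M" "x + scl t y \<in> U"
    using assms(5) by (auto elim: qdom_cases)
  have dq: "dq f x y s \<in> N" if "x + scl s y \<in> U" for s
    unfolding dq_def using assms(3,4) xy that by (intro subspace_ops)
  show ?thesis
  proof (cases "t = 0")
    case True
    have "\<forall>\<^sub>F s in at 0. dq f x y s \<in> N"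
      using eventually_pt_in_qdom[OF assms(1) xy(1,2)]
      by eventually_elim (use dq in \<open>auto simp: pt_in_qdom[OF assms(1)]\<close>)
    moreover have "closed N" using assms(3) by (simp add: closed_subspace_def)
    ultimately have "qm f (pt x y 0) \<in> N"
      using C1_tendsto_dq[OF assms(1,2) xy(1,2)] by (intro Lim_in_closed_set) auto
    then show ?thesis using True by (simp add: v_eq)
  next
    case False
    then show ?thesis using dq xy by (simp add: v_eq qm_pt)
  qed
qed

text \<open>The definition of the quotient map with the denominator cleared, which makes it valid for
  \<open>t = 0\<close> too.\<close>

lemma qm_scale:
  assumes "open_domain M U" "pt x y t \<in> qdom M U"
  shows "f (x + scl t y) = f x + scl t (qm f (pt x y t))"
  by (cases "t = 0") (auto simp: qm_pt dq_eq)

text \<open>Substitute \<open>u s\<close> for the parameter of the difference quotient.\<close>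

lemma qm_linear_scale:
  assumes "open_domain M U" "C1 M U f" "x \<in> U" "y \<in> M"
  shows "qm f (pt x (scl s y) 0) = scl s (qm f (pt x y 0))"
proof (cases "s = 0")
  case True
  have "dq f x 0 = (\<lambda>_. 0)" by (auto simp: dq_def fun_eq_iff)
  then show ?thesis using True by (auto intro!: qm_zeroI)
next
  case False
  have "((\<lambda>u. dq f x y (u * s)) \<longlongrightarrow> qm f (pt x y 0)) (at 0)"
  proof (rule filterlim_compose[OF C1_tendsto_dq[OF assms]], rule filterlim_atI)
    have "((\<lambda>u. u * s) \<longlongrightarrow> 0 * s) (at 0)" by (intro tendsto_intros tendsto_ident_at)
    then show "((\<lambda>u. u * s) \<longlongrightarrow> 0) (at 0)" by simp
    show "\<forall>\<^sub>F u in at 0. u * s \<noteq> 0"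
      using eventually_neq_at_within[of 0 0 UNIV] by eventually_elim (use False in simp)
  qed
  then have "((\<lambda>u. scl s (dq f x y (u * s))) \<longlongrightarrow> scl s (qm f (pt x y 0))) (at 0)"
    by (intro tendsto_intros)
  moreover have "scl s (dq f x y (u * s)) = dq f x (scl s y) u" for u
    using False by (simp add: dq_def)
  ultimately show ?thesis by (intro qm_zeroI) simp
qed

text \<open>The difference quotient in the direction \<open>y + z\<close> is the one in the direction \<open>y\<close> plus the
  one in the direction \<open>z\<close> at the moved point \<open>x + s y\<close>; the latter converges because \<open>qm f\<close> is
  continuous in all its arguments.\<close>

lemma qm_linear_add:
  assumes "open_domain M U" "C1 M U f" "x \<in> U" "y \<in> M" "z \<in> M"
  shows "qm f (pt x (y + z) 0) = qm f (pt x y 0) + qm f (pt x z 0)"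
proof (rule qm_zeroI)
  note M = open_domain_space[OF assms(1)]
  have "((\<lambda>s. qm f (pt (x + scl s y) z s)) \<longlongrightarrow> qm f (pt (x + scl 0 y) z 0)) (at 0)"
  proof (rule continuous_on_tendsto_compose[of "qdom M U" "qm f"])
    show "continuous_on (qdom M U) (qm f)" using assms by (simp add: C1_def)
    show "((\<lambda>s. pt (x + scl s y) z s) \<longlongrightarrow> pt (x + scl 0 y) z 0) (at 0)"
      by (intro tendsto_intros tendsto_ident_at)
    show "pt (x + scl 0 y) z 0 \<in> qdom M U" using assms by (simp add: pt_in_qdom)
    show "\<forall>\<^sub>F s in at 0. pt (x + scl s y) z s \<in> qdom M U"
      using eventually_pt_in_qdom[OF assms(1,3,4)]
        eventually_pt_in_qdom[OF assms(1,3) subspace_ops(2)[OF M assms(4,5)]]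
      by eventually_elim
        (use assms in \<open>auto simp: pt_in_qdom algebra_simps\<close>)
  qed
  then have "((\<lambda>s. dq f x y s + qm f (pt (x + scl s y) z s)) \<longlongrightarrow>
      qm f (pt x y 0) + qm f (pt x z 0)) (at 0)"
    using C1_tendsto_dq[OF assms(1-4)] by (intro tendsto_intros) auto
  moreover have "\<forall>\<^sub>F s in at 0. dq f x y s + qm f (pt (x + scl s y) z s) = dq f x (y + z) s"
    using eventually_neq_at_within[of 0 0 UNIV]
    by eventually_elim (simp add: qm_pt dq_def algebra_simps flip: scale_right_distrib scale_right_diff_distrib)
  ultimately show "(dq f x (y + z) \<longlongrightarrow> qm f (pt x y 0) + qm f (pt x z 0)) (at 0)"
    by (rule Lim_transform_eventually)
qed

lemma qm_linear_zero:
  assumes "open_domain M U" "C1 M U f" "x \<in> U"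
  shows "qm f (pt x 0 0) = 0"
  using qm_linear_scale[OF assms, of 0 0] open_domain_space[OF assms(1)] by auto

text \<open>In its second argument \<open>f\<^sup>[\<^sup>1\<^sup>]\<close> is itself a difference: the increment from \<open>z\<close> to
  \<open>z + s h\<close> is \<open>s\<close> times the value of \<open>f\<^sup>[\<^sup>1\<^sup>]\<close> at the moved base point.  It turns statements on
  \<open>f\<^sup>[\<^sup>2\<^sup>]\<close> in the direction \<open>h\<close> into statements on \<open>f\<^sup>[\<^sup>1\<^sup>]\<close>.\<close>

lemma qm_increment:
  assumes "open_domain M U" "C1 M U f" "b \<in> U" "z \<in> M" "h \<in> M"
    and "b + scl t z \<in> U" "b + scl t (z + scl s h) \<in> U"
  shows "qm f (pt b (z + scl s h) t) = qm f (pt b z t) + scl s (qm f (pt (b + scl t z) h (s * t)))"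
proof (cases "t = 0")
  case True
  then show ?thesis
    using qm_linear_add[OF assms(1-4), of "scl s h"] qm_linear_scale[OF assms(1-3,5)]
      open_domain_space[OF assms(1)] assms(5) by auto
next
  case t: False
  show ?thesis
  proof (cases "s = 0")
    case False
    then show ?thesis
      using t by (simp add: qm_pt dq_def algebra_simps)
  qed simp
qed

subsection \<open>Lipschitz and strictly differentiable maps\<close>

text \<open>The notions for normed spaces.  A gauge on a normed space is bounded by a multiple of the
  norm, and the norm is a gauge, so the norm may replace the quantification over gauges; this is
  carried out when these notions are compared with those for topological vector spaces.\<close>

definition lin_on :: "'w set \<Rightarrow> ('w \<Rightarrow> 'w) \<Rightarrow> bool"
  where "lin_on M A \<longleftrightarrow> (\<forall>x\<in>M. \<forall>y\<in>M. A (x + y) = A x + A y) \<and>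
    (\<forall>t. \<forall>x\<in>M. A (scl t x) = scl t (A x)) \<and> (\<exists>C. \<forall>x\<in>M. gnorm (A x) \<le> C * gnorm x)"

definition Lip :: "'w set \<Rightarrow> 'w set \<Rightarrow> ('w \<Rightarrow> 'w) \<Rightarrow> bool"
  where "Lip M U f \<longleftrightarrow> (\<forall>x0\<in>U. \<exists>L. \<exists>\<delta>>0. \<forall>x\<in>U. \<forall>y\<in>U.
    gnorm (x - x0) < \<delta> \<longrightarrow> gnorm (y - x0) < \<delta> \<longrightarrow> gnorm (f y - f x) \<le> L * gnorm (y - x))"

definition approximates :: "'w set \<Rightarrow> ('w \<Rightarrow> 'w) \<Rightarrow> 'w \<Rightarrow> ('w \<Rightarrow> 'w) \<Rightarrow> bool"
  where "approximates U A x f \<longleftrightarrow> (\<forall>\<epsilon>>0. \<exists>\<delta>>0. \<forall>y\<in>U. \<forall>z\<in>U.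
    gnorm (z - x) < \<delta> \<longrightarrow> gnorm (y - x) < \<delta> \<longrightarrow>
    gnorm (f z - f y - A (z - y)) \<le> \<epsilon> * gnorm (z - y))"

definition Strict :: "'w set \<Rightarrow> 'w set \<Rightarrow> ('w \<Rightarrow> 'w) \<Rightarrow> bool"
  where "Strict M U f \<longleftrightarrow> (\<forall>x\<in>U. \<exists>A. lin_on M A \<and> approximates U A x f)"

lemma lin_on_bound:
  assumes "lin_on M A"
  obtains C where "C > 0" "\<And>x. x \<in> M \<Longrightarrow> gnorm (A x) \<le> C * gnorm x"
proof -
  obtain C where C: "\<And>x. x \<in> M \<Longrightarrow> gnorm (A x) \<le> C * gnorm x"
    using assms unfolding lin_on_def by blast
  have "gnorm (A x) \<le> max C 1 * gnorm x" if "x \<in> M" for x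
    using C[OF that] gnorm_ge_0[of x] by (meson max.cobounded1 mult_right_mono order_trans)
  then show ?thesis by (intro that[of "max C 1"]) auto
qed

lemma Strict_subdomain: "Strict M U f \<Longrightarrow> V \<subseteq> U \<Longrightarrow> Strict M V f"
  unfolding Strict_def approximates_def by (meson subsetD)

lemma Lip_subdomain: "Lip M U f \<Longrightarrow> V \<subseteq> U \<Longrightarrow> Lip M V f"
  unfolding Lip_def by (meson subsetD)

lemma Lip_imp_continuous:
  assumes "Lip M U f"
  shows "continuous_on U f"
  unfolding continuous_on_def
proof (rule ballI)
  fix x assume x: "x \<in> U"
  obtain L \<delta> where d: "\<delta> > 0" "\<And>y. y \<in> U \<Longrightarrow> gnorm (y - x) < \<delta> \<Longrightarrow> gnorm (f y - f x) \<le> L * gnorm (y - x)"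
    using assms x unfolding Lip_def by (metis cancel_comm_monoid_add_class.diff_cancel gnorm_zero)
  have lim: "((\<lambda>y. gnorm (y - x)) \<longlongrightarrow> 0) (at x within U)"
    unfolding tendsto_iff_gnorm[symmetric] by (rule tendsto_ident_at)
  have "((\<lambda>y. L * gnorm (y - x)) \<longlongrightarrow> L * 0) (at x within U)"
    by (intro tendsto_intros lim)
  then show "(f \<longlongrightarrow> f x) (at x within U)"
    unfolding mult_zero_right
  proof (rule tendsto_gnorm_squeeze)
    have "\<forall>\<^sub>F y in at x within U. gnorm (y - x) < \<delta>"
      using order_tendstoD(2)[OF lim d(1)] .
    moreover have "\<forall>\<^sub>F y in at x within U. y \<in> U" by (simp add: eventually_at_filter)
    ultimately show "\<forall>\<^sub>F y in at x within U. gnorm (f y - f x) \<le> L * gnorm (y - x)"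
      by eventually_elim (use d in auto)
  qed
qed

lemma Strict_imp_Lip:
  assumes "Strict M U f" "closed_subspace M" "U \<subseteq> M"
  shows "Lip M U f"
  unfolding Lip_def
proof (rule ballI)
  fix x assume x: "x \<in> U"
  then obtain A where A: "lin_on M A" "approximates U A x f"
    using assms by (auto simp: Strict_def)
  obtain C where C: "C > 0" "\<And>x. x \<in> M \<Longrightarrow> gnorm (A x) \<le> C * gnorm x" using lin_on_bound[OF A(1)] by blast
  obtain \<delta> where d: "\<delta> > 0" "\<And>y z. y \<in> U \<Longrightarrow> z \<in> U \<Longrightarrow> gnorm (z - x) < \<delta> \<Longrightarrow> gnorm (y - x) < \<delta> \<Longrightarrow>
    gnorm (f z - f y - A (z - y)) \<le> 1 * gnorm (z - y)"
    using A(2) unfolding approximates_def by (metis zero_less_one)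
  have "gnorm (f z - f y) \<le> (C + 1) * gnorm (z - y)"
    if "y \<in> U" "z \<in> U" "gnorm (y - x) < \<delta>" "gnorm (z - x) < \<delta>" for y z
  proof -
    have "z - y \<in> M" using that assms by auto
    then show ?thesis
      using d(2)[OF that(1,2,4,3)] C(2)[of "z - y"]
        gnorm_triangle[of "f z - f y - A (z - y)" "A (z - y)"]
      by (simp add: distrib_right)
  qed
  then show "\<exists>L. \<exists>\<delta>>0. \<forall>y\<in>U. \<forall>z\<in>U. gnorm (y - x) < \<delta> \<longrightarrow> gnorm (z - x) < \<delta> \<longrightarrow>
      gnorm (f z - f y) \<le> L * gnorm (z - y)" using d(1) by blast
qed

subsection \<open>Relations between the three notions\<close>

text \<open>Strict differentiability in terms of difference quotients: dividing by \<open>s\<close> turns the error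
  bound into one that is uniform over the base points near \<open>x\<close> and over \<open>s\<close>.\<close>

lemma approximates_dq:
  assumes M: "closed_subspace M" "lin_on M A" and A: "approximates U A x f" and e: "\<epsilon> > 0"
  shows "\<exists>\<delta>>0. \<forall>x' y s. x' \<in> U \<longrightarrow> y \<in> M \<longrightarrow> s \<noteq> 0 \<longrightarrow> x' + scl s y \<in> U \<longrightarrow> gnorm (x' - x) < \<delta> \<longrightarrow>
    gnorm (x' + scl s y - x) < \<delta> \<longrightarrow> gnorm (dq f x' y s - A y) \<le> \<epsilon> * gnorm y"
proof -
  obtain \<delta> where d: "\<delta> > 0" "\<And>y z. y \<in> U \<Longrightarrow> z \<in> U \<Longrightarrow> gnorm (z - x) < \<delta> \<Longrightarrow> gnorm (y - x) < \<delta> \<Longrightarrow>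
      gnorm (f z - f y - A (z - y)) \<le> \<epsilon> * gnorm (z - y)"
    using A e unfolding approximates_def by meson
  have "gnorm (dq f x' y s - A y) \<le> \<epsilon> * gnorm y"
    if "x' \<in> U" "y \<in> M" "s \<noteq> 0" "x' + scl s y \<in> U" "gnorm (x' - x) < \<delta>" "gnorm (x' + scl s y - x) < \<delta>"
    for x' y s
  proof -
    have "A (scl s y) = scl s (A y)" using M(2) that by (simp add: lin_on_def)
    then have "f (x' + scl s y) - f x' - A (x' + scl s y - x') = scl s (dq f x' y s - A y)"
      using that by (simp add: dq_eq scale_right_diff_distrib)
    then have "gnorm s * gnorm (dq f x' y s - A y) \<le> \<epsilon> * (gnorm s * gnorm y)"
      using d(2)[OF that(1,4,6,5)] by (simp add: gnorm_scale)
    then have "gnorm s * gnorm (dq f x' y s - A y) \<le> gnorm s * (\<epsilon> * gnorm y)" by (simp add: mult_ac)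
    moreover have "gnorm s > 0" using that by simp
    ultimately show ?thesis by (simp only: mult_le_cancel_left_pos)
  qed
  then show ?thesis using d(1) by blast
qed

lemma approximates_tendsto_dq:
  assumes "open_domain M U" "lin_on M A" "approximates U A x f" "x \<in> U" "y \<in> M"
  shows "(dq f x y \<longlongrightarrow> A y) (at 0)"
proof (rule tendstoI)
  fix e :: real assume e: "e > 0"
  define \<epsilon> where "\<epsilon> = e / (gnorm y + 1)"
  have y1: "gnorm y + 1 > 0" using gnorm_ge_0[of y] by linarith
  then have "\<epsilon> > 0" using e by (simp add: \<epsilon>_def)
  then obtain \<delta> where d: "\<delta> > 0" "\<And>x' y s. x' \<in> U \<Longrightarrow> y \<in> M \<Longrightarrow> s \<noteq> 0 \<Longrightarrow> x' + scl s y \<in> U \<Longrightarrow>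
      gnorm (x' - x) < \<delta> \<Longrightarrow> gnorm (x' + scl s y - x) < \<delta> \<Longrightarrow> gnorm (dq f x' y s - A y) \<le> \<epsilon> * gnorm y"
    using approximates_dq[OF open_domain_space[OF assms(1)] assms(2,3), of \<epsilon>] by metis
  have "((\<lambda>s. gnorm (x + scl s y - x)) \<longlongrightarrow> gnorm (x + scl 0 y - x)) (at 0)"
    by (intro tendsto_intros tendsto_ident_at)
  then have "\<forall>\<^sub>F s in at 0. gnorm (x + scl s y - x) < \<delta>"
    using d(1) by (intro order_tendstoD(2)) auto
  then show "\<forall>\<^sub>F s in at 0. dist (dq f x y s) (A y) < e"
    using eventually_pt_in_qdom[OF assms(1,4,5)] eventually_neq_at_within[of 0 0 UNIV]
  proof eventually_elim
    case (elim s)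
    then have "gnorm (dq f x y s - A y) \<le> \<epsilon> * gnorm y"
      using d(1) assms by (intro d(2)) (auto simp: pt_in_qdom)
    also have "\<dots> < e" using e y1 by (simp add: \<epsilon>_def field_simps)
    finally show ?case by (simp add: dist_gnorm)
  qed
qed

text \<open>The uniform bound controls \<open>qm f\<close> near \<open>(x, y, 0)\<close> at the points with \<open>t \<noteq> 0\<close>, and in the
  limit also at those with \<open>t = 0\<close>.\<close>

lemma Strict_imp_C1:
  assumes dom: "open_domain M U" and f: "Strict M U f"
  shows "C1 M U f"
proof (rule C1_I_at_zero[OF dom])
  note M = open_domain_space[OF dom]
  show "continuous_on U f"
    using Strict_imp_Lip[OF f M] open_domain_subset[OF dom] by (intro Lip_imp_continuous) blast
  fix x y assume x: "x \<in> U" and y: "y \<in> M"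
  obtain A where A: "lin_on M A" "approximates U A x f" using f x by (auto simp: Strict_def)
  obtain C where C: "C > 0" "\<And>x. x \<in> M \<Longrightarrow> gnorm (A x) \<le> C * gnorm x" using lin_on_bound[OF A(1)] by blast
  have qm0: "qm f (pt x y 0) = A y" by (intro qm_zeroI approximates_tendsto_dq[OF dom A x y])
  let ?F = "at (pt x y 0) within qdom M U"
  have id: "((\<lambda>v. v) \<longlongrightarrow> pt x y 0) ?F" by (rule tendsto_ident_at)
  show "(qm f \<longlongrightarrow> qm f (pt x y 0)) ?F"
  proof (rule tendstoI)
    fix e :: real assume e: "e > 0"
    \<comment> \<open>\<open>\<epsilon>\<close> times \<open>gnorm y'\<close> has to stay below \<open>e / 2\<close> for all \<open>y'\<close> with \<open>gnorm y' < gnorm y + 1\<close>\<close>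
    define \<epsilon> where "\<epsilon> = e / (2 * (gnorm y + 1))"
    have y1: "gnorm y + 1 > 0" using gnorm_ge_0[of y] by linarith
    then have e0: "\<epsilon> > 0" using e by (simp add: \<epsilon>_def)
    then obtain \<delta> where d: "\<delta> > 0" "\<And>x' y s. x' \<in> U \<Longrightarrow> y \<in> M \<Longrightarrow> s \<noteq> 0 \<Longrightarrow> x' + scl s y \<in> U \<Longrightarrow>
        gnorm (x' - x) < \<delta> \<Longrightarrow> gnorm (x' + scl s y - x) < \<delta> \<Longrightarrow> gnorm (dq f x' y s - A y) \<le> \<epsilon> * gnorm y"
      using approximates_dq[OF M A, of \<epsilon>] by metis
    have near: "gnorm (qm f (pt x' y' t) - A y') \<le> \<epsilon> * gnorm y'"
      if "pt x' y' t \<in> qdom M U" "gnorm (x' - x) < \<delta>" "gnorm (x' + scl t y' - x) < \<delta>" for x' y' t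
    proof (cases "t = 0")
      case False
      then show ?thesis using that d(2) dom by (auto simp: qm_pt pt_in_qdom)
    next
      case True
      have x': "x' \<in> U" and y': "y' \<in> M" using that dom by (auto simp: pt_in_qdom)
      obtain A' where A': "lin_on M A'" "approximates U A' x' f" using f x' by (auto simp: Strict_def)
      have lim: "(dq f x' y' \<longlongrightarrow> A' y') (at 0)" by (rule approximates_tendsto_dq[OF dom A' x' y'])
      then have "((\<lambda>s. gnorm (dq f x' y' s - A y')) \<longlongrightarrow> gnorm (A' y' - A y')) (at 0)"
        by (intro tendsto_intros)
      moreover have "\<forall>\<^sub>F s in at 0. gnorm (dq f x' y' s - A y') \<le> \<epsilon> * gnorm y'"
      proof -
        have "((\<lambda>s. gnorm (x' + scl s y' - x)) \<longlongrightarrow> gnorm (x' + scl 0 y' - x)) (at 0)"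
          by (intro tendsto_intros tendsto_ident_at)
        then have "\<forall>\<^sub>F s in at 0. gnorm (x' + scl s y' - x) < \<delta>"
          using that by (intro order_tendstoD(2)) auto
        then show ?thesis
          using eventually_pt_in_qdom[OF dom x' y'] eventually_neq_at_within[of 0 0 UNIV]
          by eventually_elim (use that d(2) dom in \<open>auto simp: pt_in_qdom\<close>)
      qed
      ultimately have "gnorm (A' y' - A y') \<le> \<epsilon> * gnorm y'" by (intro tendsto_upperbound) auto
      then show ?thesis using qm_zeroI[OF lim] True by simp
    qed
    have "((\<lambda>v. gnorm (px v - x)) \<longlongrightarrow> gnorm (px (pt x y 0) - x)) ?F" by (intro tendsto_intros id)
    then have "\<forall>\<^sub>F v in ?F. gnorm (px v - x) < \<delta>" using d(1) by (intro order_tendstoD(2)) auto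
    moreover have "((\<lambda>v. gnorm (px v + scl (ps v) (py v) - x)) \<longlongrightarrow>
        gnorm (px (pt x y 0) + scl (ps (pt x y 0)) (py (pt x y 0)) - x)) ?F"
      by (intro tendsto_intros id)
    then have "\<forall>\<^sub>F v in ?F. gnorm (px v + scl (ps v) (py v) - x) < \<delta>"
      using d(1) by (intro order_tendstoD(2)) auto
    moreover have "((\<lambda>v. gnorm (py v)) \<longlongrightarrow> gnorm (py (pt x y 0))) ?F" by (intro tendsto_intros id)
    then have "\<forall>\<^sub>F v in ?F. gnorm (py v) < gnorm y + 1" by (intro order_tendstoD(2)) auto
    moreover have "((\<lambda>v. C * gnorm (py v - y)) \<longlongrightarrow> C * gnorm (py (pt x y 0) - y)) ?F"
      by (intro tendsto_intros id)
    then have "\<forall>\<^sub>F v in ?F. C * gnorm (py v - y) < e / 2" using e by (intro order_tendstoD(2)) auto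
    moreover have "\<forall>\<^sub>F v in ?F. v \<in> qdom M U" by (simp add: eventually_at_filter)
    ultimately show "\<forall>\<^sub>F v in ?F. dist (qm f v) (qm f (pt x y 0)) < e"
    proof eventually_elim
      case (elim v)
      obtain x' y' t where v: "v = pt x' y' t" and y': "y' \<in> M" using elim(5) by (auto elim: qdom_cases)
      have "gnorm (qm f v - A y') \<le> \<epsilon> * gnorm y'" using near elim by (simp add: v)
      also have "\<dots> \<le> \<epsilon> * (gnorm y + 1)" using elim(3) e0 by (intro mult_left_mono) (auto simp: v)
      also have "\<dots> = e / 2" using y1 by (simp add: \<epsilon>_def field_simps)
      finally have "gnorm (qm f v - A y') \<le> e / 2" .
      moreover have diff: "y' - y \<in> M" using M y y' by blast
      have "A y' = A (y' - y) + A y"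
      proof -
        have "A (y' - y + y) = A (y' - y) + A y" using A(1) y diff unfolding lin_on_def by blast
        then show ?thesis by simp
      qed
      then have "gnorm (A y' - A y) < e / 2"
        using C(2)[OF diff] elim(4) by (simp add: v)
      ultimately have "gnorm (qm f v - A y) < e"
        using gnorm_diff_triangle[of "qm f v" "A y" "A y'"] by linarith
      then show ?case by (simp add: dist_gnorm qm0)
    qed
  qed
qed

lemma C1_near:
  assumes "C1 M U f" "v0 \<in> qdom M U" "e > 0"
  obtains \<delta> where "\<delta> > 0" "\<And>v. v \<in> qdom M U \<Longrightarrow> gnorm (v - v0) < \<delta> \<Longrightarrow> gnorm (qm f v - qm f v0) < e"
proof -
  have "\<exists>d>0. \<forall>v\<in>qdom M U. dist v v0 < d \<longrightarrow> dist (qm f v) (qm f v0) < e"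
    using assms by (auto simp: C1_def continuous_on_iff)
  then show ?thesis using that unfolding dist_gnorm by blast
qed

text \<open>Every vector of \<open>M\<close> is \<open>t h\<close> with \<open>h\<close> in the set \<open>B\<close> and \<open>t\<close> bounded by a multiple of the
  norm.  Estimates of \<open>f(z) - f(y) = t f\<^sup>[\<^sup>1\<^sup>](y, h, t)\<close> are thus reduced to uniform estimates over
  \<open>h \<in> B\<close>.\<close>

definition absorbs :: "'w set \<Rightarrow> 'w set \<Rightarrow> real \<Rightarrow> bool"
  where "absorbs M B \<kappa> \<longleftrightarrow> \<kappa> > 0 \<and> B \<subseteq> M \<and>
    (\<forall>v\<in>M. v \<noteq> 0 \<longrightarrow> (\<exists>t h. h \<in> B \<and> v = scl t h \<and> t \<noteq> 0 \<and> gnorm t * \<kappa> \<le> gnorm v))"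

lemma absorbs_ball:
  assumes "closed_subspace M" "r > 0"
  shows "absorbs M {h \<in> M. gnorm h < r} (gnorm (pivot::'k) * r)"
  unfolding absorbs_def
proof (intro conjI ballI impI)
  show "0 < gnorm (pivot::'k) * r" using assms(2) gnorm_pivot by simp
  fix v assume v: "v \<in> M" "v \<noteq> 0"
  obtain t h where th: "v = scl t h" "gnorm h < r" "gnorm t * (gnorm (pivot::'k) * r) \<le> gnorm v" "t \<noteq> 0"
    using rescale[OF assms(2), of v] v by auto
  have "h = scl (1 / t) v" using th by simp
  then have "h \<in> M" using assms v by (metis subspace_ops(4))
  then show "\<exists>t h. h \<in> {h \<in> M. gnorm h < r} \<and> v = scl t h \<and> t \<noteq> 0 \<and>
      gnorm t * (gnorm (pivot::'k) * r) \<le> gnorm v"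
    using th by blast
qed auto

text \<open>By continuity at \<open>(x, 0, 0)\<close>, where it vanishes, \<open>f\<^sup>[\<^sup>1\<^sup>]\<close> is bounded by one near this point.
  Writing \<open>z - y = t h\<close> with small \<open>h\<close> and \<open>t\<close> of the size of \<open>z - y\<close> gives a Lipschitz
  estimate.  This takes the place of the mean value theorem.\<close>

lemma C1_imp_Lip:
  assumes dom: "open_domain M U" and f: "C1 M U f"
  shows "Lip M U f"
  unfolding Lip_def
proof (rule ballI)
  fix x assume x: "x \<in> U"
  note M = open_domain_space[OF dom]
  have v0: "pt x 0 0 \<in> qdom M U" using x M dom by (auto simp: pt_in_qdom)
  obtain \<delta> where d: "\<delta> > 0" "\<And>v. v \<in> qdom M U \<Longrightarrow> gnorm (v - pt x 0 0) < \<delta> \<Longrightarrow>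
      gnorm (qm f v - qm f (pt x 0 0)) < 1"
    using C1_near[OF f v0, of 1] by auto
  define B where "B = {h \<in> M. gnorm h < \<delta> / 3}"
  define \<kappa> where "\<kappa> = gnorm (pivot::'k) * (\<delta> / 3)"
  have B: "absorbs M B \<kappa>" unfolding B_def \<kappa>_def using d(1) by (intro absorbs_ball M) auto
  have k: "\<kappa> > 0" using B by (simp add: absorbs_def)
  \<comment> \<open>the second bound makes \<open>t\<close> smaller than \<open>\<delta> / 3\<close>, so that the triple \<open>(y - x, h, t)\<close> has norm below \<open>\<delta>\<close>\<close>
  define \<delta>' where "\<delta>' = min (\<delta> / 3) (\<kappa> * \<delta> / 6)"
  have d': "\<delta>' > 0" using d(1) k by (simp add: \<delta>'_def)
  have "gnorm (f z - f y) \<le> 1 / \<kappa> * gnorm (z - y)"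
    if y: "y \<in> U" and z: "z \<in> U" and yd: "gnorm (y - x) < \<delta>'" and zd: "gnorm (z - x) < \<delta>'" for y z
  proof (cases "z = y")
    case False
    have "z - y \<in> M" using y z M open_domain_subset[OF dom] by blast
    moreover have "z - y \<noteq> 0" using False by simp
    ultimately obtain t h where th: "h \<in> B" "z - y = scl t h" "t \<noteq> 0" "gnorm t * \<kappa> \<le> gnorm (z - y)"
      using B unfolding absorbs_def by blast
    have z_eq: "z = y + scl t h" using th(2) by (simp add: algebra_simps)
    have "gnorm (z - y) < 2 * \<delta>'"
      using gnorm_diff_triangle[of z y x] yd zd by (simp add: gnorm_diff_commute[of x y])
    then have "gnorm t * \<kappa> < \<kappa> * \<delta> / 3" using th(4) by (simp add: \<delta>'_def)
    then have t: "gnorm t < \<delta> / 3" using k by (simp add: field_simps)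
    have v: "pt y h t \<in> qdom M U" using y z th dom by (auto simp: pt_in_qdom z_eq B_def)
    have "gnorm (pt y h t - pt x 0 0) < \<delta>"
      using gnorm_pt[of "y - x" h t] t th(1) yd by (simp add: pt_diff B_def \<delta>'_def)
    then have "gnorm (qm f (pt y h t)) \<le> 1"
      using d(2)[OF v] qm_linear_zero[OF dom f x] by simp
    moreover have "f z - f y = scl t (qm f (pt y h t))"
      using qm_scale[OF dom v, of f] by (simp add: z_eq)
    ultimately have "gnorm (f z - f y) \<le> gnorm t"
      using gnorm_ge_0[of t] by (simp add: gnorm_scale mult_left_le)
    also have "\<dots> \<le> 1 / \<kappa> * gnorm (z - y)" using th(4) k by (simp add: field_simps)
    finally show ?thesis .
  qed simp
  then show "\<exists>L. \<exists>\<delta>>0. \<forall>y\<in>U. \<forall>z\<in>U. gnorm (y - x) < \<delta> \<longrightarrow> gnorm (z - x) < \<delta> \<longrightarrow>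
      gnorm (f z - f y) \<le> L * gnorm (z - y)"
    using d' by blast
qed

text \<open>A linear map that is bounded on a ball is bounded.\<close>

lemma C1_derivative_lin_on:
  assumes dom: "open_domain M U" and f: "C1 M U f" and x: "x \<in> U"
  shows "lin_on M (\<lambda>h. qm f (pt x h 0))"
proof -
  note M = open_domain_space[OF dom]
  have v0: "pt x 0 0 \<in> qdom M U" using x M dom by (auto simp: pt_in_qdom)
  obtain \<delta> where d: "\<delta> > 0" "\<And>v. v \<in> qdom M U \<Longrightarrow> gnorm (v - pt x 0 0) < \<delta> \<Longrightarrow>
      gnorm (qm f v - qm f (pt x 0 0)) < 1"
    using C1_near[OF f v0, of 1] by auto
  define \<kappa> where "\<kappa> = gnorm (pivot::'k) * \<delta>"
  have B: "absorbs M {h \<in> M. gnorm h < \<delta>} \<kappa>" unfolding \<kappa>_def using d(1) by (intro absorbs_ball M)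
  have k: "\<kappa> > 0" using B by (simp add: absorbs_def)
  have "gnorm (qm f (pt x v 0)) \<le> 1 / \<kappa> * gnorm v" if v: "v \<in> M" for v
  proof (cases "v = 0")
    case False
    then obtain t h where th: "h \<in> M" "gnorm h < \<delta>" "v = scl t h" "t \<noteq> 0" "gnorm t * \<kappa> \<le> gnorm v"
      using B v by (auto simp: absorbs_def)
    have "gnorm (pt x h 0 - pt x 0 0) < \<delta>"
      using gnorm_pt[of 0 h 0] th(2) by (simp add: pt_diff)
    then have "gnorm (qm f (pt x h 0)) \<le> 1"
      using d(2)[of "pt x h 0"] qm_linear_zero[OF dom f x] x th dom by (simp add: pt_in_qdom)
    then have "gnorm (qm f (pt x v 0)) \<le> gnorm t"
      using gnorm_ge_0[of t] qm_linear_scale[OF dom f x th(1)] by (simp add: th(3) gnorm_scale mult_left_le)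
    also have "\<dots> \<le> 1 / \<kappa> * gnorm v" using th(5) k by (simp add: field_simps)
    finally show ?thesis .
  qed (simp add: qm_linear_zero[OF dom f x])
  then show ?thesis
    using qm_linear_add[OF dom f x] qm_linear_scale[OF dom f x] unfolding lin_on_def by blast
qed

text \<open>With \<open>z - y = t h\<close>, the error \<open>f(z) - f(y) - f'(x)(z - y)\<close> is \<open>t\<close> times
  \<open>f\<^sup>[\<^sup>1\<^sup>](y, h, t) - f\<^sup>[\<^sup>1\<^sup>](x, h, 0)\<close>.  Strict differentiability is therefore continuity of
  \<open>f\<^sup>[\<^sup>1\<^sup>]\<close> that is uniform in the direction \<open>h\<close>.\<close>

lemma approximatesI_uniform:
  assumes dom: "open_domain M U" and f: "C1 M U f" and x: "x \<in> U" and B: "absorbs M B \<kappa>"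
    and unif: "\<And>\<epsilon>. \<epsilon> > 0 \<Longrightarrow> \<exists>\<delta>>0. \<forall>y h t. pt y h t \<in> qdom M U \<longrightarrow> h \<in> B \<longrightarrow> gnorm (y - x) < \<delta> \<longrightarrow>
      gnorm t < \<delta> \<longrightarrow> gnorm (qm f (pt y h t) - qm f (pt x h 0)) \<le> \<epsilon>"
  shows "approximates U (\<lambda>h. qm f (pt x h 0)) x f"
  unfolding approximates_def
proof (intro allI impI)
  fix \<epsilon> :: real assume e: "\<epsilon> > 0"
  note M = open_domain_space[OF dom]
  have k: "\<kappa> > 0" using B by (simp add: absorbs_def)
  obtain \<delta> where d: "\<delta> > 0" "\<And>y h t. pt y h t \<in> qdom M U \<Longrightarrow> h \<in> B \<Longrightarrow> gnorm (y - x) < \<delta> \<Longrightarrow>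
      gnorm t < \<delta> \<Longrightarrow> gnorm (qm f (pt y h t) - qm f (pt x h 0)) \<le> \<epsilon> * \<kappa>"
    using unif[of "\<epsilon> * \<kappa>"] e k by (metis mult_pos_pos)
  define \<delta>' where "\<delta>' = min \<delta> (\<delta> * \<kappa> / 2)"
  have d': "\<delta>' > 0" using d(1) k by (simp add: \<delta>'_def)
  have "gnorm (f z - f y - qm f (pt x (z - y) 0)) \<le> \<epsilon> * gnorm (z - y)"
    if y: "y \<in> U" and z: "z \<in> U" and zd: "gnorm (z - x) < \<delta>'" and yd: "gnorm (y - x) < \<delta>'" for y z
  proof (cases "z = y")
    case False
    have "z - y \<in> M" using y z M open_domain_subset[OF dom] by blast
    moreover have "z - y \<noteq> 0" using False by simp
    ultimately obtain t h where th: "h \<in> B" "z - y = scl t h" "t \<noteq> 0" "gnorm t * \<kappa> \<le> gnorm (z - y)"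
      using B unfolding absorbs_def by blast
    have z_eq: "z = y + scl t h" using th(2) by (simp add: algebra_simps)
    have h: "h \<in> M" using th B by (auto simp: absorbs_def)
    have "gnorm (z - y) < 2 * \<delta>'"
      using gnorm_diff_triangle[of z y x] yd zd by (simp add: gnorm_diff_commute[of x y])
    then have "gnorm t * \<kappa> < \<delta> * \<kappa>" using th(4) by (simp add: \<delta>'_def)
    then have t: "gnorm t < \<delta>" using k by simp
    have v: "pt y h t \<in> qdom M U" using y z h dom by (auto simp: pt_in_qdom z_eq)
    have "gnorm (qm f (pt y h t) - qm f (pt x h 0)) \<le> \<epsilon> * \<kappa>"
      using d(2)[OF v th(1)] t yd by (simp add: \<delta>'_def)
    moreover have "f z - f y - qm f (pt x (z - y) 0) = scl t (qm f (pt y h t) - qm f (pt x h 0))"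
      using qm_scale[OF dom v, of f] qm_linear_scale[OF dom f x h]
      by (simp add: th(2)) (simp add: z_eq scale_right_diff_distrib)
    ultimately have "gnorm (f z - f y - qm f (pt x (z - y) 0)) \<le> gnorm t * (\<epsilon> * \<kappa>)"
      using gnorm_ge_0[of t] by (simp add: gnorm_scale mult_left_mono)
    also have "\<dots> = \<epsilon> * (gnorm t * \<kappa>)" by simp
    also have "\<dots> \<le> \<epsilon> * gnorm (z - y)" using th(4) e by (intro mult_left_mono) auto
    finally show ?thesis .
  qed (simp add: qm_linear_zero[OF dom f x])
  then show "\<exists>\<delta>>0. \<forall>y\<in>U. \<forall>z\<in>U. gnorm (z - x) < \<delta> \<longrightarrow> gnorm (y - x) < \<delta> \<longrightarrow>
      gnorm (f z - f y - qm f (pt x (z - y) 0)) \<le> \<epsilon> * gnorm (z - y)"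
    using d' by blast
qed

text \<open>Here the directions \<open>h\<close> run through a small ball; the Lipschitz estimate near \<open>(x, 0, 0)\<close>
  compares two points with the same \<open>h\<close> and is thus uniform in \<open>h\<close>.  In particular it applies if
  \<open>f\<close> is twice continuously differentiable.\<close>

lemma Lip_quotient_imp_Strict:
  assumes dom: "open_domain M U" and f: "C1 M U f" and q: "Lip (next_sp M) (qdom M U) (qm f)"
  shows "Strict M U f"
  unfolding Strict_def
proof (rule ballI)
  fix x assume x: "x \<in> U"
  note M = open_domain_space[OF dom]
  have v0: "pt x 0 0 \<in> qdom M U" using x M dom by (auto simp: pt_in_qdom)
  obtain L \<delta> where d: "\<delta> > 0" "\<And>u v. u \<in> qdom M U \<Longrightarrow> v \<in> qdom M U \<Longrightarrow> gnorm (u - pt x 0 0) < \<delta> \<Longrightarrow>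
      gnorm (v - pt x 0 0) < \<delta> \<Longrightarrow> gnorm (qm f v - qm f u) \<le> L * gnorm (v - u)"
    using q v0 unfolding Lip_def by blast
  define B where "B = {h \<in> M. gnorm h < \<delta> / 3}"
  have B: "absorbs M B (gnorm (pivot::'k) * (\<delta> / 3))"
    unfolding B_def using d(1) by (intro absorbs_ball M) auto
  have "approximates U (\<lambda>h. qm f (pt x h 0)) x f"
  proof (rule approximatesI_uniform[OF dom f x B])
    fix \<epsilon> :: real assume e: "\<epsilon> > 0"
    define L' where "L' = max L 1"
    define \<delta>' where "\<delta>' = min (\<delta> / 3) (\<epsilon> / (2 * L'))"
    have L': "L' > 0" "L \<le> L'" by (auto simp: L'_def)
    have d': "\<delta>' > 0" using d(1) e L' by (simp add: \<delta>'_def)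
    have "gnorm (qm f (pt y h t) - qm f (pt x h 0)) \<le> \<epsilon>"
      if v: "pt y h t \<in> qdom M U" and h: "h \<in> B" and y: "gnorm (y - x) < \<delta>'" and t: "gnorm t < \<delta>'" for y h t
    proof -
      have "gnorm (pt y h t - pt x 0 0) < \<delta>"
        using gnorm_pt[of "y - x" h t] t h y by (simp add: pt_diff B_def \<delta>'_def)
      moreover have "gnorm (pt x h 0 - pt x 0 0) < \<delta>"
        using gnorm_pt[of 0 h 0] h gnorm_ge_0[of h] by (simp add: pt_diff B_def)
      moreover have "pt x h 0 \<in> qdom M U" using x h dom by (auto simp: pt_in_qdom B_def)
      ultimately have "gnorm (qm f (pt y h t) - qm f (pt x h 0)) \<le> L * gnorm (pt y h t - pt x h 0)"
        using v by (intro d(2))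
      also have "\<dots> \<le> L' * gnorm (pt y h t - pt x h 0)" using L' gnorm_ge_0 by (intro mult_right_mono) auto
      also have "\<dots> \<le> L' * (gnorm (y - x) + gnorm t)"
        using L' gnorm_pt[of "y - x" 0 t] by (intro mult_left_mono) (auto simp: pt_diff)
      also have "\<dots> \<le> L' * (\<epsilon> / (2 * L') + \<epsilon> / (2 * L'))"
        using L' y t by (intro mult_left_mono add_mono) (auto simp: \<delta>'_def)
      also have "\<dots> = \<epsilon>" using L' by (simp add: field_simps)
      finally show ?thesis .
    qed
    then show "\<exists>\<delta>>0. \<forall>y h t. pt y h t \<in> qdom M U \<longrightarrow> h \<in> B \<longrightarrow> gnorm (y - x) < \<delta> \<longrightarrow>
      gnorm t < \<delta> \<longrightarrow> gnorm (qm f (pt y h t) - qm f (pt x h 0)) \<le> \<epsilon>" using d' by blast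
  qed
  then show "\<exists>A. lin_on M A \<and> approximates U A x f" using C1_derivative_lin_on[OF dom f x] by blast
qed

text \<open>In finite dimension over a locally compact field, the directions can be restricted to a
  compact set, where continuity is uniform.\<close>

lemma compact_absorbing_imp_Strict:
  assumes dom: "open_domain M U" and f: "C1 M U f" and B: "absorbs M B \<kappa>" and "compact B"
  shows "Strict M U f"
  unfolding Strict_def
proof (rule ballI)
  fix x assume x: "x \<in> U"
  have "approximates U (\<lambda>h. qm f (pt x h 0)) x f"
  proof (rule approximatesI_uniform[OF dom f x B])
    fix \<epsilon> :: real assume e: "\<epsilon> > 0"
    have "\<exists>\<delta>>0. \<forall>y h t. pt y h t \<in> qdom M U \<longrightarrow> gnorm (h - h0) < \<delta> \<longrightarrow> gnorm (y - x) < \<delta> \<longrightarrow>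
        gnorm t < \<delta> \<longrightarrow> gnorm (qm f (pt y h t) - qm f (pt x h0 0)) < \<epsilon> / 2" if "h0 \<in> B" for h0
    proof -
      have "pt x h0 0 \<in> qdom M U" using x that B dom by (auto simp: pt_in_qdom absorbs_def)
      then obtain \<delta> where d: "\<delta> > 0" "\<And>v. v \<in> qdom M U \<Longrightarrow> gnorm (v - pt x h0 0) < \<delta> \<Longrightarrow>
          gnorm (qm f v - qm f (pt x h0 0)) < \<epsilon> / 2"
        using C1_near[OF f, of "pt x h0 0" "\<epsilon> / 2"] e by auto
      have "gnorm (pt y h t - pt x h0 0) < \<delta>"
        if "gnorm (h - h0) < \<delta> / 3" "gnorm (y - x) < \<delta> / 3" "gnorm t < \<delta> / 3" for y h t
        using gnorm_pt[of "y - x" "h - h0" t] that by (simp add: pt_diff)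
      then show ?thesis using d by (intro exI[of _ "\<delta> / 3"]) auto
    qed
    then obtain d where d: "\<And>h0. h0 \<in> B \<Longrightarrow> d h0 > 0" "\<And>h0 y h t. h0 \<in> B \<Longrightarrow> pt y h t \<in> qdom M U \<Longrightarrow>
        gnorm (h - h0) < d h0 \<Longrightarrow> gnorm (y - x) < d h0 \<Longrightarrow> gnorm t < d h0 \<Longrightarrow>
        gnorm (qm f (pt y h t) - qm f (pt x h0 0)) < \<epsilon> / 2"
      by metis
    obtain D where D: "D \<subseteq> B" "finite D" "B \<subseteq> (\<Union>h0\<in>D. ball h0 (d h0))"
      by (rule compactE_image[OF \<open>compact B\<close>, of B "\<lambda>h0. ball h0 (d h0)"]) (use d(1) in auto)
    define \<delta> where "\<delta> = Min (insert 1 (d ` D))"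
    have "\<delta> > 0" unfolding \<delta>_def using D d(1) by (subst Min_gr_iff) auto
    moreover have "gnorm (qm f (pt y h t) - qm f (pt x h 0)) \<le> \<epsilon>"
      if v: "pt y h t \<in> qdom M U" "h \<in> B" "gnorm (y - x) < \<delta>" "gnorm t < \<delta>" for y h t
    proof -
      obtain h0 where h0: "h0 \<in> D" "gnorm (h - h0) < d h0"
        using D(3) v(2) by (force simp: dist_gnorm gnorm_diff_commute)
      have "\<delta> \<le> d h0" unfolding \<delta>_def using D h0 by (intro Min_le) auto
      then have "gnorm (qm f (pt y h t) - qm f (pt x h0 0)) < \<epsilon> / 2"
        using v h0 D by (intro d(2)) auto
      moreover have "gnorm (qm f (pt x h 0) - qm f (pt x h0 0)) < \<epsilon> / 2"
        using h0 D d(1)[of h0] x v B dom by (intro d(2)) (auto simp: pt_in_qdom absorbs_def)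
      ultimately show ?thesis
        using gnorm_diff_triangle[of "qm f (pt y h t)" "qm f (pt x h 0)" "qm f (pt x h0 0)"]
          gnorm_diff_commute[of "qm f (pt x h 0)" "qm f (pt x h0 0)"] by linarith
    qed
    ultimately show "\<exists>\<delta>>0. \<forall>y h t. pt y h t \<in> qdom M U \<longrightarrow> h \<in> B \<longrightarrow> gnorm (y - x) < \<delta> \<longrightarrow>
      gnorm t < \<delta> \<longrightarrow> gnorm (qm f (pt y h t) - qm f (pt x h 0)) \<le> \<epsilon>" by blast
  qed
  then show "\<exists>A. lin_on M A \<and> approximates U A x f" using C1_derivative_lin_on[OF dom f x] by blast
qed

subsection \<open>Composition with bounded linear maps, sums\<close>

definition blin :: "('w \<Rightarrow> 'w) \<Rightarrow> bool"
  where "blin L \<longleftrightarrow> lin_on UNIV L"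

lemma blin_simps:
  assumes "blin L"
  shows "L (x + y) = L x + L y" "L (scl t x) = scl t (L x)" "L (x - y) = L x - L y"
proof -
  show *: "L (x + y) = L x + L y" "L (scl t x) = scl t (L x)" for x y t
    using assms by (auto simp: blin_def lin_on_def)
  show "L (x - y) = L x - L y" using *(1)[of "x - y" y] by simp
qed

lemma blin_bound:
  assumes "blin L"
  obtains C where "C > 0" "\<And>x. gnorm (L x) \<le> C * gnorm x"
  using lin_on_bound[of UNIV L] assms by (auto simp: blin_def)

lemma blin_tendsto:
  assumes "blin L" "(f \<longlongrightarrow> l) F"
  shows "((\<lambda>x. L (f x)) \<longlongrightarrow> L l) F"
proof -
  obtain C where C: "C > 0" "\<And>x. gnorm (L x) \<le> C * gnorm x" using blin_bound[OF assms(1)] by blast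
  have "((\<lambda>x. C * gnorm (f x - l)) \<longlongrightarrow> C * 0) F"
    using assms(2) unfolding tendsto_iff_gnorm by (intro tendsto_intros)
  then show ?thesis
    unfolding mult_zero_right
    by (rule tendsto_gnorm_squeeze) (use C in \<open>simp flip: blin_simps(3)[OF assms(1)]\<close>)
qed

lemma blin_continuous_on: "blin L \<Longrightarrow> continuous_on S f \<Longrightarrow> continuous_on S (\<lambda>x. L (f x))"
  unfolding continuous_on_def using blin_tendsto by blast

lemma blinI:
  assumes "\<And>x y. L (x + y) = L x + L y" "\<And>t x. L (scl t x) = scl t (L x)"
    and "\<And>x. gnorm (L x) \<le> C * gnorm x"
  shows "blin L"
  using assms by (auto simp: blin_def lin_on_def)

lemma blin_px: "blin px" and blin_py: "blin py"
  by (rule blinI[where C = 1]; simp add: gnorm_px gnorm_py)+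

lemma blin_pt_first: "blin (\<lambda>v. pt v 0 0)" and blin_pt_second: "blin (\<lambda>v. pt 0 v 0)"
  and blin_pt_third: "blin (\<lambda>v. pt 0 0 (ps v))"
proof -
  show "blin (\<lambda>v. pt v 0 0)" "blin (\<lambda>v. pt 0 v 0)"
    by (rule blinI[where C = 1]; use gnorm_pt[of _ 0 0] gnorm_pt[of 0 _ 0] in \<open>simp add: pt_add pt_scale\<close>)+
  have "gnorm (pt 0 0 (ps v)) \<le> gnorm v" for v
    using gnorm_pt[of 0 0 "ps v"] gnorm_ps[of v] by simp
  then show "blin (\<lambda>v. pt 0 0 (ps v))" by (intro blinI[where C = 1]) (simp_all add: pt_add pt_scale)
qed

lemma lin_on_blin: "blin L \<Longrightarrow> lin_on M L"
  by (auto simp: blin_def lin_on_def)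

text \<open>The map \<open>L \<times> L \<times> id\<close> on triples.\<close>

definition lift :: "('w \<Rightarrow> 'w) \<Rightarrow> 'w \<Rightarrow> 'w"
  where "lift L v = pt (L (px v)) (L (py v)) (ps v)"

lemma lift_pt [simp]: "lift L (pt x y t) = pt (L x) (L y) t"
  by (simp add: lift_def)

lemma blin_lift:
  assumes "blin L"
  shows "blin (lift L)"
proof -
  obtain C where C: "C > 0" "\<And>x. gnorm (L x) \<le> C * gnorm x" using blin_bound[OF assms] by blast
  have "gnorm (lift L v) \<le> (2 * C + 1) * gnorm v" for v
  proof -
    have "gnorm (lift L v) \<le> C * gnorm (px v) + C * gnorm (py v) + gnorm (ps v)"
      using gnorm_pt[of "L (px v)" "L (py v)" "ps v"] C(2)[of "px v"] C(2)[of "py v"] by (simp add: lift_def)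
    also have "\<dots> \<le> C * gnorm v + C * gnorm v + gnorm v"
      using gnorm_px gnorm_py gnorm_ps C(1) by (intro add_mono mult_left_mono) auto
    finally show ?thesis by (simp add: algebra_simps)
  qed
  then show ?thesis
    by (intro blinI[where C = "2 * C + 1"]) (simp_all add: lift_def blin_simps[OF assms] pt_add pt_scale)
qed

text \<open>The difference quotients of \<open>f \<circ> L\<close> at \<open>v\<close> and those of \<open>f\<close> at \<open>lift L v\<close> are the same
  function of the parameter, so the equation holds whether or not they converge.\<close>

lemma qm_comp_right:
  assumes "blin L"
  shows "qm (\<lambda>x. f (L x)) v = qm f (lift L v)"
  by (simp add: qm_def dq_def[abs_def] lift_def blin_simps[OF assms])

lemma qm_comp_left:
  assumes "open_domain M U" "C1 M U f" "blin L" "v \<in> qdom M U"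
  shows "qm (\<lambda>x. L (f x)) v = L (qm f v)"
  using assms by (intro qm_eqI[where M = M and U = U and h = "\<lambda>v. L (qm f v)"] blin_continuous_on[OF assms(3)])
    (auto simp: C1_def qm_pt dq_def blin_simps[OF assms(3)])

lemma qm_add:
  assumes "open_domain M U" "C1 M U f" "C1 M U g" "v \<in> qdom M U"
  shows "qm (\<lambda>x. f x + g x) v = qm f v + qm g v"
  using assms by (intro qm_eqI[where M = M and U = U and h = "\<lambda>v. qm f v + qm g v"] continuous_on_add)
    (auto simp: C1_def qm_pt dq_def algebra_simps)

lemma qm_linear:
  assumes "blin L"
  shows "qm L v = L (py v)"
proof -
  have dq: "dq L x y s = L y" if "s \<noteq> 0" for x y s
    using that by (simp add: dq_def blin_simps[OF assms])
  have "(dq L x y \<longlongrightarrow> L y) (at 0)" for x y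
    by (rule Lim_transform_eventually[OF tendsto_const])
      (use dq in \<open>auto simp: eventually_at_filter\<close>)
  then have "Lim (at 0) (dq L x y) = L y" for x y by (simp add: tendsto_Lim)
  then show ?thesis using dq by (simp add: qm_def)
qed

lemma open_domain_preimage:
  assumes "open_domain M U" "closed_subspace N" "blin L" "L ` N \<subseteq> M"
  shows "open_domain N {v \<in> N. L v \<in> U}"
proof -
  obtain T where T: "open T" "U = M \<inter> T" using assms by (auto simp: open_domain_def openin_open)
  have "open (L -` T)"
    using T(1) blin_continuous_on[OF assms(3) continuous_on_id] by (intro open_vimage) auto
  moreover have "{v \<in> N. L v \<in> U} = N \<inter> L -` T" using T assms by auto
  ultimately show ?thesis using assms by (auto simp: open_domain_def openin_open)
qed

lemma lift_next_sp: "L ` N \<subseteq> M \<Longrightarrow> lift L ` next_sp N \<subseteq> next_sp M"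
  by (auto simp: lift_def next_sp_def)

lemma qdom_preimage:
  assumes "closed_subspace N" "blin L" "L ` N \<subseteq> M"
  shows "qdom N {v \<in> N. L v \<in> U} = {v \<in> next_sp N. lift L v \<in> qdom M U}"
proof -
  have "pt x y t \<in> qdom N {v \<in> N. L v \<in> U} \<longleftrightarrow> pt x y t \<in> {v \<in> next_sp N. lift L v \<in> qdom M U}" for x y t
    using assms by (auto simp: qdom_def blin_simps[OF assms(2)])
  moreover have "qdom N {v \<in> N. L v \<in> U} \<subseteq> next_sp N" by (auto simp: qdom_def)
  ultimately show ?thesis by (auto elim!: next_sp_cases)
qed

text \<open>A property of maps is called stable if it survives the operations by which the maps of the
  proof are built from a given one.\<close>

definition stable :: "('w set \<Rightarrow> 'w set \<Rightarrow> ('w \<Rightarrow> 'w) \<Rightarrow> bool) \<Rightarrow> bool"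
  where "stable T \<longleftrightarrow>
    (\<forall>M U f. open_domain M U \<longrightarrow> T M U f \<longrightarrow>
      (\<forall>V. openin (top_of_set M) V \<longrightarrow> V \<subseteq> U \<longrightarrow> T M V f) \<and>
      (\<forall>g. (\<forall>x\<in>U. f x = g x) \<longrightarrow> T M U g) \<and>
      (\<forall>L. blin L \<longrightarrow> T M U (L \<circ> f)) \<and>
      (\<forall>L N. blin L \<longrightarrow> closed_subspace N \<longrightarrow> L ` N \<subseteq> M \<longrightarrow> T N {v \<in> N. L v \<in> U} (f \<circ> L)) \<and>
      (\<forall>g. T M U g \<longrightarrow> T M U (\<lambda>x. f x + g x))) \<and>
    (\<forall>M U L. open_domain M U \<longrightarrow> blin L \<longrightarrow> T M U L)"

lemma stableI:
  assumes "\<And>M U V f. open_domain M U \<Longrightarrow> T M U f \<Longrightarrow> openin (top_of_set M) V \<Longrightarrow> V \<subseteq> U \<Longrightarrow> T M V f"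
    and "\<And>M U f g. open_domain M U \<Longrightarrow> T M U f \<Longrightarrow> (\<And>x. x \<in> U \<Longrightarrow> f x = g x) \<Longrightarrow> T M U g"
    and "\<And>M U f L. open_domain M U \<Longrightarrow> T M U f \<Longrightarrow> blin L \<Longrightarrow> T M U (\<lambda>x. L (f x))"
    and "\<And>M U f L N. open_domain M U \<Longrightarrow> T M U f \<Longrightarrow> blin L \<Longrightarrow> closed_subspace N \<Longrightarrow> L ` N \<subseteq> M \<Longrightarrow>
      T N {v \<in> N. L v \<in> U} (\<lambda>x. f (L x))"
    and "\<And>M U f g. open_domain M U \<Longrightarrow> T M U f \<Longrightarrow> T M U g \<Longrightarrow> T M U (\<lambda>x. f x + g x)"
    and "\<And>M U L. open_domain M U \<Longrightarrow> blin L \<Longrightarrow> T M U L"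
  shows "stable T"
proof -
  have "T M U (L \<circ> f)" if "open_domain M U" "T M U f" "blin L" for M U f L
    using assms(3)[OF that] by (simp add: comp_def)
  moreover have "T N {v \<in> N. L v \<in> U} (f \<circ> L)"
    if "open_domain M U" "T M U f" "blin L" "closed_subspace N" "L ` N \<subseteq> M" for M U f L N
    using assms(4)[OF that] by (simp add: comp_def)
  ultimately show ?thesis
    unfolding stable_def
  proof (intro conjI allI impI, goal_cases)
    case (1 M U f V)
    then show ?case by (intro assms(1)[of M U f V])
  next
    case (2 M U f g)
    then show ?case by (intro assms(2)[of M U f g]) auto
  next
    case (5 M U f g)
    then show ?case by (intro assms(5))
  next
    case (6 M U L)
    then show ?case by (intro assms(6))
  qed simp_all
qed

lemma
  assumes "stable T" "open_domain M U"
  shows stable_subdomain: "T M U f \<Longrightarrow> openin (top_of_set M) V \<Longrightarrow> V \<subseteq> U \<Longrightarrow> T M V f"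
    and stable_cong: "T M U f \<Longrightarrow> (\<And>x. x \<in> U \<Longrightarrow> f x = g x) \<Longrightarrow> T M U g"
    and stable_left: "T M U f \<Longrightarrow> blin L \<Longrightarrow> T M U (\<lambda>x. L (f x))"
    and stable_right: "T M U f \<Longrightarrow> blin L \<Longrightarrow> closed_subspace N \<Longrightarrow> L ` N \<subseteq> M \<Longrightarrow>
      T N {v \<in> N. L v \<in> U} (\<lambda>x. f (L x))"
    and stable_add: "T M U f \<Longrightarrow> T M U g \<Longrightarrow> T M U (\<lambda>x. f x + g x)"
    and stable_linear: "blin L \<Longrightarrow> T M U L"
proof -
  note s = assms(1)[unfolded stable_def, THEN conjunct1, rule_format, OF assms(2)]
  show "T M V f" if "T M U f" "openin (top_of_set M) V" "V \<subseteq> U"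
    using s[OF that(1), THEN conjunct1] that by simp
  show "T M U g" if "T M U f" "\<And>x. x \<in> U \<Longrightarrow> f x = g x"
    using s[OF that(1), THEN conjunct2, THEN conjunct1] that by simp
  show "T M U (\<lambda>x. L (f x))" if "T M U f" "blin L"
    using s[OF that(1), THEN conjunct2, THEN conjunct2, THEN conjunct1, THEN spec[of _ L]] that
    by (simp add: comp_def)
  show "T N {v \<in> N. L v \<in> U} (\<lambda>x. f (L x))"
    if "T M U f" "blin L" "closed_subspace N" "L ` N \<subseteq> M"
    using s[OF that(1), THEN conjunct2, THEN conjunct2, THEN conjunct2, THEN conjunct1,
        THEN spec[of _ L], THEN spec[of _ N]] that
    by (simp add: comp_def)
  show "T M U (\<lambda>x. f x + g x)" if "T M U f" "T M U g"
    using s[OF that(1), THEN conjunct2, THEN conjunct2, THEN conjunct2, THEN conjunct2,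
        THEN spec[of _ g]] that(2) by (rule mp)
  show "T M U L" if "blin L"
    using assms(1)[unfolded stable_def, THEN conjunct2] assms(2) that by simp
qed

lemma stable_conj:
  assumes T: "stable T" and T': "stable T'"
  shows "stable (\<lambda>M U f. T M U f \<and> T' M U f)"
proof (rule stableI)
  fix M U f g assume *: "open_domain M U" "T M U f \<and> T' M U f" "\<And>x. x \<in> U \<Longrightarrow> f x = g x"
  show "T M U g \<and> T' M U g"
    using stable_cong[OF T *(1) conjunct1[OF *(2)] *(3)] stable_cong[OF T' *(1) conjunct2[OF *(2)] *(3)] by simp
next
  fix M U f L assume *: "open_domain M U" "T M U f \<and> T' M U f" "blin L"
  show "T M U (\<lambda>x. L (f x)) \<and> T' M U (\<lambda>x. L (f x))"
    using stable_left[OF T *(1) _ *(3), of f] stable_left[OF T' *(1) _ *(3), of f] *(2) by simp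
next
  fix M U f L N
  assume *: "open_domain M U" "T M U f \<and> T' M U f" "blin L" "closed_subspace N" "L ` N \<subseteq> M"
  show "T N {v \<in> N. L v \<in> U} (\<lambda>x. f (L x)) \<and> T' N {v \<in> N. L v \<in> U} (\<lambda>x. f (L x))"
    using stable_right[OF T *(1) _ *(3-5), of f] stable_right[OF T' *(1) _ *(3-5), of f] *(2) by simp
next
  fix M U f g assume *: "open_domain M U" "T M U f \<and> T' M U f" "T M U g \<and> T' M U g"
  show "T M U (\<lambda>x. f x + g x) \<and> T' M U (\<lambda>x. f x + g x)"
    using stable_add[OF T *(1), of f g] stable_add[OF T' *(1), of f g] *(2,3) by simp
qed (simp_all add: stable_subdomain[OF T] stable_subdomain[OF T'] stable_linear[OF T] stable_linear[OF T'])

lemma stable_True: "stable (\<lambda>M U f. True)"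
  by (rule stableI) simp_all

lemma stable_continuous: "stable (\<lambda>M U. continuous_on U)"
proof (rule stableI)
  fix M U V :: "'w set" and f :: "'w \<Rightarrow> 'w" assume "continuous_on U f" "V \<subseteq> U"
  then show "continuous_on V f" by (rule continuous_on_subset)
next
  fix M U :: "'w set" and f g :: "'w \<Rightarrow> 'w" assume "continuous_on U f" "\<And>x. x \<in> U \<Longrightarrow> f x = g x"
  then show "continuous_on U g" by (simp cong: continuous_on_cong)
next
  fix M U N :: "'w set" and f L :: "'w \<Rightarrow> 'w" assume *: "continuous_on U f" "blin L"
  show "continuous_on {v \<in> N. L v \<in> U} (\<lambda>x. f (L x))"
    using *(1) by (rule continuous_on_compose2) (use blin_continuous_on[OF *(2) continuous_on_id] in auto)
next
  fix M U :: "'w set" and L :: "'w \<Rightarrow> 'w" assume "blin L" then show "continuous_on U L"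
    using blin_continuous_on[of L U "\<lambda>x. x", OF _ continuous_on_id] by simp
next
  fix M U :: "'w set" and f L :: "'w \<Rightarrow> 'w" assume "continuous_on U f" "blin L"
  then show "continuous_on U (\<lambda>x. L (f x))" by (intro blin_continuous_on[of L U f])
qed (rule continuous_on_add)

lemma stable_C1: "stable C1"
proof (rule stableI)
  fix M U f g assume *: "open_domain M U" "C1 M U f" "\<And>x. x \<in> U \<Longrightarrow> f x = g x"
  then show "C1 M U g"
    using qm_cong[OF *(1), of f g] unfolding C1_def by (auto cong: continuous_on_cong)
next
  fix M U f L assume *: "open_domain M U" "C1 M U f" "blin L"
  then show "C1 M U (\<lambda>x. L (f x))"
    using qm_comp_left[OF *] blin_continuous_on[OF *(3), of U f]
      blin_continuous_on[OF *(3), of "qdom M U" "qm f"] unfolding C1_def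
    by (simp cong: continuous_on_cong)
next
  fix M U f L N assume *: "open_domain M U" "C1 M U f" "blin L" "closed_subspace N" "L ` N \<subseteq> M"
  show "C1 N {v \<in> N. L v \<in> U} (\<lambda>x. f (L x))"
    unfolding C1_def qm_comp_right[OF *(3)] qdom_preimage[OF *(4,3,5)]
  proof
    show "continuous_on {v \<in> N. L v \<in> U} (\<lambda>x. f (L x))"
      using stable_right[OF stable_continuous *(1) _ *(3-5), of f] * by (simp add: C1_def)
    have "open_domain (next_sp M) (qdom M U)" using * by (simp add: open_domain_next)
    then show "continuous_on {v \<in> next_sp N. lift L v \<in> qdom M U} (\<lambda>x. qm f (lift L x))"
      using stable_right[OF stable_continuous, of "next_sp M" "qdom M U" "qm f" "lift L" "next_sp N"] *
      by (simp add: C1_def blin_lift closed_subspace_next lift_next_sp)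
  qed
next
  fix M U f g assume *: "open_domain M U" "C1 M U f" "C1 M U g"
  then show "C1 M U (\<lambda>x. f x + g x)"
    using qm_add[OF *] unfolding C1_def
    by (simp add: continuous_on_add cong: continuous_on_cong)
next
  fix M U L assume "blin L" then show "C1 M U L"
    using blin_continuous_on[of L U "\<lambda>x. x"] blin_continuous_on[of L "qdom M U" py] continuous_on_parts(2)
    by (simp add: C1_def qm_linear continuous_on_id cong: continuous_on_cong)
qed (rule C1_subdomain)

lemma stable_Lip: "stable Lip"
proof (rule stableI)
  fix M U f g assume *: "open_domain M U" "Lip M U f" "\<And>x. x \<in> U \<Longrightarrow> f x = g x"
  then show "Lip M U g" unfolding Lip_def by simp
next
  fix M U f L assume *: "open_domain M U" "Lip M U f" "blin L"
  obtain C where C: "C > 0" "\<And>x. gnorm (L x) \<le> C * gnorm x" using blin_bound[OF *(3)] by blast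
  show "Lip M U (\<lambda>x. L (f x))"
    unfolding Lip_def
  proof
    fix x0 assume "x0 \<in> U"
    then obtain K \<delta> where d: "\<delta> > 0" "\<And>x y. x \<in> U \<Longrightarrow> y \<in> U \<Longrightarrow> gnorm (x - x0) < \<delta> \<Longrightarrow>
        gnorm (y - x0) < \<delta> \<Longrightarrow> gnorm (f y - f x) \<le> K * gnorm (y - x)"
      using *(2) unfolding Lip_def by meson
    have "gnorm (L (f y) - L (f x)) \<le> C * K * gnorm (y - x)"
      if "x \<in> U" "y \<in> U" "gnorm (x - x0) < \<delta>" "gnorm (y - x0) < \<delta>" for x y
    proof -
      have "gnorm (L (f y) - L (f x)) \<le> C * gnorm (f y - f x)"
        using C(2)[of "f y - f x"] by (simp add: blin_simps(3)[OF *(3)])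
      also have "\<dots> \<le> C * (K * gnorm (y - x))" using C(1) d(2)[OF that] by (intro mult_left_mono) auto
      finally show ?thesis by simp
    qed
    then show "\<exists>K. \<exists>\<delta>>0. \<forall>x\<in>U. \<forall>y\<in>U. gnorm (x - x0) < \<delta> \<longrightarrow> gnorm (y - x0) < \<delta> \<longrightarrow>
        gnorm (L (f y) - L (f x)) \<le> K * gnorm (y - x)" using d(1) by blast
  qed
next
  fix M U f L N assume *: "open_domain M U" "Lip M U f" "blin L" "closed_subspace N" "L ` N \<subseteq> M"
  obtain C where C: "C > 0" "\<And>x. gnorm (L x) \<le> C * gnorm x" using blin_bound[OF *(3)] by blast
  show "Lip N {v \<in> N. L v \<in> U} (\<lambda>x. f (L x))"
    unfolding Lip_def
  proof
    fix x0 assume "x0 \<in> {v \<in> N. L v \<in> U}"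
    then obtain K \<delta> where d: "\<delta> > 0" "\<And>x y. x \<in> U \<Longrightarrow> y \<in> U \<Longrightarrow> gnorm (x - L x0) < \<delta> \<Longrightarrow>
        gnorm (y - L x0) < \<delta> \<Longrightarrow> gnorm (f y - f x) \<le> K * gnorm (y - x)"
      using *(2) unfolding Lip_def by blast
    have near: "gnorm (L x - L x0) < \<delta>" if "gnorm (x - x0) < \<delta> / C" for x
    proof -
      have "gnorm (L x - L x0) \<le> C * gnorm (x - x0)"
        using C(2)[of "x - x0"] by (simp add: blin_simps(3)[OF *(3)])
      also have "\<dots> < \<delta>" using that C(1) by (simp add: field_simps)
      finally show ?thesis .
    qed
    have "gnorm (f (L y) - f (L x)) \<le> max K 0 * C * gnorm (y - x)"
      if "L x \<in> U" "L y \<in> U" "gnorm (x - x0) < \<delta> / C" "gnorm (y - x0) < \<delta> / C" for x y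
    proof -
      have "gnorm (f (L y) - f (L x)) \<le> K * gnorm (L y - L x)" using that near d(2) by blast
      also have "\<dots> \<le> max K 0 * gnorm (L y - L x)" using gnorm_ge_0 by (intro mult_right_mono) auto
      also have "\<dots> \<le> max K 0 * (C * gnorm (y - x))"
        using C(2)[of "y - x"] by (intro mult_left_mono) (auto simp: blin_simps(3)[OF *(3)])
      finally show ?thesis by simp
    qed
    then show "\<exists>K. \<exists>\<delta>>0. \<forall>x\<in>{v \<in> N. L v \<in> U}. \<forall>y\<in>{v \<in> N. L v \<in> U}. gnorm (x - x0) < \<delta> \<longrightarrow>
        gnorm (y - x0) < \<delta> \<longrightarrow> gnorm (f (L y) - f (L x)) \<le> K * gnorm (y - x)"
      using d(1) C(1) by (intro exI[of _ "max K 0 * C"] exI[of _ "\<delta> / C"]) auto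
  qed
next
  fix M U f g assume *: "open_domain M U" "Lip M U f" "Lip M U g"
  show "Lip M U (\<lambda>x. f x + g x)"
    unfolding Lip_def
  proof
    fix x0 assume x0: "x0 \<in> U"
    obtain K \<delta> where d: "\<delta> > 0" "\<And>x y. x \<in> U \<Longrightarrow> y \<in> U \<Longrightarrow> gnorm (x - x0) < \<delta> \<Longrightarrow>
        gnorm (y - x0) < \<delta> \<Longrightarrow> gnorm (f y - f x) \<le> K * gnorm (y - x)"
      using *(2) x0 unfolding Lip_def by meson
    obtain K' \<delta>' where d': "\<delta>' > 0" "\<And>x y. x \<in> U \<Longrightarrow> y \<in> U \<Longrightarrow> gnorm (x - x0) < \<delta>' \<Longrightarrow>
        gnorm (y - x0) < \<delta>' \<Longrightarrow> gnorm (g y - g x) \<le> K' * gnorm (y - x)"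
      using *(3) x0 unfolding Lip_def by meson
    have "gnorm (f y + g y - (f x + g x)) \<le> (K + K') * gnorm (y - x)"
      if "x \<in> U" "y \<in> U" "gnorm (x - x0) < min \<delta> \<delta>'" "gnorm (y - x0) < min \<delta> \<delta>'" for x y
      using d(2)[of x y] d'(2)[of x y] that gnorm_triangle[of "f y - f x" "g y - g x"]
      by (simp add: algebra_simps)
    then show "\<exists>K. \<exists>\<delta>>0. \<forall>x\<in>U. \<forall>y\<in>U. gnorm (x - x0) < \<delta> \<longrightarrow> gnorm (y - x0) < \<delta> \<longrightarrow>
        gnorm (f y + g y - (f x + g x)) \<le> K * gnorm (y - x)"
      using d(1) d'(1) by (intro exI[of _ "K + K'"] exI[of _ "min \<delta> \<delta>'"]) auto
  qed
next
  fix M U L assume L: "blin L"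
  obtain C where C: "C > 0" "\<And>x. gnorm (L x) \<le> C * gnorm x" using blin_bound[OF L] by blast
  then have "gnorm (L y - L x) \<le> C * gnorm (y - x)" for x y by (simp flip: blin_simps(3)[OF L])
  then show "Lip M U L" unfolding Lip_def by (meson zero_less_one)
qed (rule Lip_subdomain)

lemma approximatesE:
  assumes "approximates U A x f" "\<epsilon> > 0"
  obtains \<delta> where "\<delta> > 0" "\<And>y z. y \<in> U \<Longrightarrow> z \<in> U \<Longrightarrow> gnorm (z - x) < \<delta> \<Longrightarrow> gnorm (y - x) < \<delta> \<Longrightarrow>
      gnorm (f z - f y - A (z - y)) \<le> \<epsilon> * gnorm (z - y)"
proof -
  have "\<exists>\<delta>>0. \<forall>y\<in>U. \<forall>z\<in>U. gnorm (z - x) < \<delta> \<longrightarrow> gnorm (y - x) < \<delta> \<longrightarrow>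
    gnorm (f z - f y - A (z - y)) \<le> \<epsilon> * gnorm (z - y)"
    using assms(1)[unfolded approximates_def, rule_format, OF assms(2)] .
  then show thesis using that by auto
qed

lemma approximatesI:
  assumes "\<And>\<epsilon>. \<epsilon> > 0 \<Longrightarrow> \<exists>\<delta>>0. \<forall>y\<in>U. \<forall>z\<in>U. gnorm (z - x) < \<delta> \<longrightarrow> gnorm (y - x) < \<delta> \<longrightarrow>
    gnorm (f z - f y - A (z - y)) \<le> \<epsilon> * gnorm (z - y)"
  shows "approximates U A x f"
  unfolding approximates_def by (intro allI impI assms)

lemma approximates_left:
  assumes "approximates U A x f" "blin L"
  shows "approximates U (\<lambda>v. L (A v)) x (\<lambda>v. L (f v))"
  unfolding approximates_def
proof (intro allI impI)
  fix \<epsilon> :: real assume e: "\<epsilon> > 0"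
  obtain C where C: "C > 0" "\<And>x. gnorm (L x) \<le> C * gnorm x" using blin_bound[OF assms(2)] by blast
  obtain \<delta> where d: "\<delta> > 0" "\<And>y z. y \<in> U \<Longrightarrow> z \<in> U \<Longrightarrow> gnorm (z - x) < \<delta> \<Longrightarrow> gnorm (y - x) < \<delta> \<Longrightarrow>
      gnorm (f z - f y - A (z - y)) \<le> \<epsilon> / C * gnorm (z - y)"
    by (rule approximatesE[OF assms(1) divide_pos_pos[OF e C(1)]]) (rule that)
  have "gnorm (L (f z) - L (f y) - L (A (z - y))) \<le> \<epsilon> * gnorm (z - y)"
    if "y \<in> U" "z \<in> U" "gnorm (z - x) < \<delta>" "gnorm (y - x) < \<delta>" for y z
  proof -
    have "gnorm (L (f z) - L (f y) - L (A (z - y))) \<le> C * gnorm (f z - f y - A (z - y))"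
      using C(2)[of "f z - f y - A (z - y)"] by (simp add: blin_simps(3)[OF assms(2)])
    also have "\<dots> \<le> C * (\<epsilon> / C * gnorm (z - y))" using C(1) d(2)[OF that] by (intro mult_left_mono) auto
    finally show ?thesis using C(1) by simp
  qed
  then show "\<exists>\<delta>>0. \<forall>y\<in>U. \<forall>z\<in>U. gnorm (z - x) < \<delta> \<longrightarrow> gnorm (y - x) < \<delta> \<longrightarrow>
      gnorm (L (f z) - L (f y) - L (A (z - y))) \<le> \<epsilon> * gnorm (z - y)" using d(1) by blast
qed

lemma approximates_right:
  assumes "approximates U A (L x) f" "blin L"
  shows "approximates {v \<in> N. L v \<in> U} (\<lambda>v. A (L v)) x (\<lambda>v. f (L v))"
  unfolding approximates_def
proof (intro allI impI)
  fix \<epsilon> :: real assume e: "\<epsilon> > 0"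
  obtain C where C: "C > 0" "\<And>x. gnorm (L x) \<le> C * gnorm x" using blin_bound[OF assms(2)] by blast
  obtain \<delta> where d: "\<delta> > 0" "\<And>y z. y \<in> U \<Longrightarrow> z \<in> U \<Longrightarrow> gnorm (z - L x) < \<delta> \<Longrightarrow> gnorm (y - L x) < \<delta> \<Longrightarrow>
      gnorm (f z - f y - A (z - y)) \<le> \<epsilon> / C * gnorm (z - y)"
    by (rule approximatesE[OF assms(1) divide_pos_pos[OF e C(1)]]) (rule that)
  have near: "gnorm (L v - L x) < \<delta>" if "gnorm (v - x) < \<delta> / C" for v
  proof -
    have "gnorm (L v - L x) \<le> C * gnorm (v - x)"
      using C(2)[of "v - x"] by (simp add: blin_simps(3)[OF assms(2)])
    also have "\<dots> < \<delta>" using that C(1) by (simp add: field_simps)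
    finally show ?thesis .
  qed
  have "gnorm (f (L z) - f (L y) - A (L (z - y))) \<le> \<epsilon> * gnorm (z - y)"
    if "L y \<in> U" "L z \<in> U" "gnorm (z - x) < \<delta> / C" "gnorm (y - x) < \<delta> / C" for y z
  proof -
    have "gnorm (f (L z) - f (L y) - A (L (z - y))) \<le> \<epsilon> / C * gnorm (L (z - y))"
      using d(2)[OF that(1,2) near near] that by (simp add: blin_simps(3)[OF assms(2)])
    also have "\<dots> \<le> \<epsilon> / C * (C * gnorm (z - y))" using C e by (intro mult_left_mono) auto
    finally show ?thesis using C(1) by simp
  qed
  then show "\<exists>\<delta>>0. \<forall>y\<in>{v \<in> N. L v \<in> U}. \<forall>z\<in>{v \<in> N. L v \<in> U}. gnorm (z - x) < \<delta> \<longrightarrow> gnorm (y - x) < \<delta> \<longrightarrow>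
      gnorm (f (L z) - f (L y) - A (L (z - y))) \<le> \<epsilon> * gnorm (z - y)"
    using d(1) C(1) by (intro exI[of _ "\<delta> / C"]) auto
qed

lemma approximates_add:
  assumes "approximates U A x f" "approximates U B x g"
  shows "approximates U (\<lambda>v. A v + B v) x (\<lambda>v. f v + g v)"
  unfolding approximates_def
proof (intro allI impI)
  fix \<epsilon> :: real assume e: "\<epsilon> > 0"
  obtain \<delta> where d: "\<delta> > 0" "\<And>y z. y \<in> U \<Longrightarrow> z \<in> U \<Longrightarrow> gnorm (z - x) < \<delta> \<Longrightarrow> gnorm (y - x) < \<delta> \<Longrightarrow>
      gnorm (f z - f y - A (z - y)) \<le> \<epsilon> / 2 * gnorm (z - y)"
    by (rule approximatesE[OF assms(1) half_gt_zero[OF e]]) (rule that)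
  obtain \<delta>' where d': "\<delta>' > 0" "\<And>y z. y \<in> U \<Longrightarrow> z \<in> U \<Longrightarrow> gnorm (z - x) < \<delta>' \<Longrightarrow> gnorm (y - x) < \<delta>' \<Longrightarrow>
      gnorm (g z - g y - B (z - y)) \<le> \<epsilon> / 2 * gnorm (z - y)"
    by (rule approximatesE[OF assms(2) half_gt_zero[OF e]]) (rule that)
  have "gnorm (f z + g z - (f y + g y) - (A (z - y) + B (z - y))) \<le> \<epsilon> * gnorm (z - y)"
    if "y \<in> U" "z \<in> U" "gnorm (z - x) < min \<delta> \<delta>'" "gnorm (y - x) < min \<delta> \<delta>'" for y z
    using d(2)[of y z] d'(2)[of y z] that
      gnorm_triangle[of "f z - f y - A (z - y)" "g z - g y - B (z - y)"]
    by (simp add: algebra_simps)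
  then show "\<exists>\<delta>>0. \<forall>y\<in>U. \<forall>z\<in>U. gnorm (z - x) < \<delta> \<longrightarrow> gnorm (y - x) < \<delta> \<longrightarrow>
      gnorm (f z + g z - (f y + g y) - (A (z - y) + B (z - y))) \<le> \<epsilon> * gnorm (z - y)"
    using d(1) d'(1) by (intro exI[of _ "min \<delta> \<delta>'"]) auto
qed

lemma stable_Strict: "stable Strict"
proof (rule stableI)
  fix M U f g assume *: "open_domain M U" "Strict M U f" "\<And>x. x \<in> U \<Longrightarrow> f x = g x"
  then show "Strict M U g" unfolding Strict_def approximates_def by simp
next
  fix M U f L assume *: "open_domain M U" "Strict M U f" "blin L"
  have "lin_on M (\<lambda>v. L (A v))" if A: "lin_on M A" for A
  proof -
    obtain C where C: "C > 0" "\<And>x. gnorm (L x) \<le> C * gnorm x" using blin_bound[OF *(3)] by blast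
    obtain D where D: "D > 0" "\<And>x. x \<in> M \<Longrightarrow> gnorm (A x) \<le> D * gnorm x" using lin_on_bound[OF A] by blast
    have "gnorm (L (A x)) \<le> C * D * gnorm x" if "x \<in> M" for x
      using order_trans[OF C(2) mult_left_mono[OF D(2)[OF that] less_imp_le[OF C(1)]]]
      by (simp only: mult.assoc)
    then show ?thesis using A unfolding lin_on_def by (auto simp: blin_simps[OF *(3)])
  qed
  then show "Strict M U (\<lambda>x. L (f x))" using *(2) approximates_left[OF _ *(3)] unfolding Strict_def by blast
next
  fix M U f L N assume *: "open_domain M U" "Strict M U f" "blin L" "closed_subspace N" "L ` N \<subseteq> M"
  have "lin_on N (\<lambda>v. A (L v))" if A: "lin_on M A" for A
  proof -
    obtain C where C: "C > 0" "\<And>x. gnorm (L x) \<le> C * gnorm x" using blin_bound[OF *(3)] by blast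
    obtain D where D: "D > 0" "\<And>x. x \<in> M \<Longrightarrow> gnorm (A x) \<le> D * gnorm x" using lin_on_bound[OF A] by blast
    have "gnorm (A (L x)) \<le> D * C * gnorm x" if "x \<in> N" for x
    proof -
      have "L x \<in> M" using that *(5) by blast
      from order_trans[OF D(2)[OF this] mult_left_mono[OF C(2) less_imp_le[OF D(1)]]]
      show ?thesis by (simp only: mult.assoc)
    qed
    moreover have "L x \<in> M" if "x \<in> N" for x using that *(5) by auto
    ultimately show ?thesis using A unfolding lin_on_def by (auto simp: blin_simps[OF *(3)])
  qed
  then show "Strict N {v \<in> N. L v \<in> U} (\<lambda>x. f (L x))"
    using *(2) approximates_right[OF _ *(3)] unfolding Strict_def by blast
next
  fix M U f g assume *: "open_domain M U" "Strict M U f" "Strict M U g"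
  have "lin_on M (\<lambda>v. A v + B v)" if A: "lin_on M A" and B: "lin_on M B" for A B
  proof -
    obtain C where C: "C > 0" "\<And>x. x \<in> M \<Longrightarrow> gnorm (A x) \<le> C * gnorm x" using lin_on_bound[OF A] by blast
    obtain D where D: "D > 0" "\<And>x. x \<in> M \<Longrightarrow> gnorm (B x) \<le> D * gnorm x" using lin_on_bound[OF B] by blast
    have "gnorm (A x + B x) \<le> (C + D) * gnorm x" if "x \<in> M" for x
      using C(2)[OF that] D(2)[OF that] gnorm_triangle[of "A x" "B x"] by (simp add: distrib_right)
    moreover have "A (x + y) + B (x + y) = (A x + B x) + (A y + B y)" if "x \<in> M" "y \<in> M" for x y
      using A B that by (simp add: lin_on_def)
    moreover have "A (scl t x) + B (scl t x) = scl t (A x + B x)" if "x \<in> M" for x t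
      using A B that by (simp add: lin_on_def scale_right_distrib)
    ultimately show ?thesis unfolding lin_on_def by blast
  qed
  then show "Strict M U (\<lambda>x. f x + g x)" using *(2,3) approximates_add unfolding Strict_def by blast
next
  fix M U L assume L: "blin L"
  have "approximates U L x L" for x
    by (auto simp: blin_simps[OF L] gnorm_ge_0 intro!: approximatesI exI[of _ 1])
  then show "Strict M U L" using lin_on_blin[OF L] unfolding Strict_def by blast
qed (rule Strict_subdomain)

subsection \<open>Iterated quotients\<close>

text \<open>\<open>P\<close> is required of \<open>f, f\<^sup>[\<^sup>1\<^sup>], \<dots>, f\<^sup>[\<^sup>n\<^sup>-\<^sup>1\<^sup>]\<close> and \<open>R\<close> of \<open>f\<^sup>[\<^sup>n\<^sup>]\<close>.  The three classes of order
  \<open>n\<close> are instances: \<open>C\<^sup>n\<close> with \<open>P\<close> being \<open>C\<^sup>1\<close> and \<open>R\<close> continuity, \<open>SC\<^sup>n\<close> with strict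
  differentiability and a trivial \<open>R\<close>, and \<open>LC\<^sup>n\<close> with the conjunction of \<open>C\<^sup>1\<close> and the Lipschitz
  condition for \<open>P\<close> and the Lipschitz condition for \<open>R\<close>.\<close>

fun iter_prop :: "('w set \<Rightarrow> 'w set \<Rightarrow> ('w \<Rightarrow> 'w) \<Rightarrow> bool) \<Rightarrow> ('w set \<Rightarrow> 'w set \<Rightarrow> ('w \<Rightarrow> 'w) \<Rightarrow> bool) \<Rightarrow>
    nat \<Rightarrow> 'w set \<Rightarrow> 'w set \<Rightarrow> ('w \<Rightarrow> 'w) \<Rightarrow> bool"
  where
    "iter_prop P R 0 M U f \<longleftrightarrow> R M U f"
  | "iter_prop P R (Suc n) M U f \<longleftrightarrow> P M U f \<and> iter_prop P R n (next_sp M) (qdom M U) (qm f)"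

text \<open>Each operation on maps acts on quotient maps by an operation of the same kind: on \<open>f \<circ> L\<close> by
  composition with \<open>lift L\<close>, on a bounded linear map \<open>L\<close> by passage to \<open>L \<circ> py\<close>.\<close>

lemma stable_iter_prop:
  assumes P: "stable P" and R: "stable R"
    and PC: "\<And>M U f. open_domain M U \<Longrightarrow> P M U f \<Longrightarrow> C1 M U f"
  shows "stable (iter_prop P R n)"
proof (induction n)
  case 0
  have "iter_prop P R 0 = R" by (simp add: fun_eq_iff)
  then show ?case using R by simp
next
  case (Suc n)
  note dn = open_domain_next
  show ?case
  proof (rule stableI)
    fix M U V f assume *: "open_domain M U" "iter_prop P R (Suc n) M U f" "openin (top_of_set M) V" "V \<subseteq> U"
    have "open_domain M V" using *(1,3) by (simp add: open_domain_def)
    from dn[OF this] have "openin (top_of_set (next_sp M)) (qdom M V)"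
      by (simp add: open_domain_def)
    then have "iter_prop P R n (next_sp M) (qdom M V) (qm f)"
      using *(2) by (intro stable_subdomain[OF Suc dn[OF *(1)] _ _ qdom_mono[OF *(4)]]) simp_all
    moreover have "P M V f" using *(2) by (intro stable_subdomain[OF P *(1) _ *(3,4)]) simp
    ultimately show "iter_prop P R (Suc n) M V f" by simp
  next
    fix M U f g assume *: "open_domain M U" "iter_prop P R (Suc n) M U f" "\<And>x. x \<in> U \<Longrightarrow> f x = g x"
    have "P M U g" using *(2) by (intro stable_cong[OF P *(1) _ *(3)]) simp_all
    moreover have "iter_prop P R n (next_sp M) (qdom M U) (qm g)"
      using *(2) by (intro stable_cong[OF Suc dn[OF *(1)] _ qm_cong[OF *(1,3)]]) simp_all
    ultimately show "iter_prop P R (Suc n) M U g" by simp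
  next
    fix M U f L assume *: "open_domain M U" "iter_prop P R (Suc n) M U f" "blin L"
    have f: "P M U f" "iter_prop P R n (next_sp M) (qdom M U) (qm f)" using *(2) by simp_all
    have C1: "C1 M U f" using PC[of M U f] * f by blast
    have "iter_prop P R n (next_sp M) (qdom M U) (\<lambda>v. L (qm f v))"
      using stable_left[OF Suc dn[OF *(1)], of "qm f" L] f(2) *(3) by blast
    moreover have "L (qm f v) = qm (\<lambda>x. L (f x)) v" if "v \<in> qdom M U" for v
      using qm_comp_left[of M U f L v] * C1 that by simp
    ultimately have "iter_prop P R n (next_sp M) (qdom M U) (qm (\<lambda>x. L (f x)))"
      using stable_cong[OF Suc dn[OF *(1)], of "\<lambda>v. L (qm f v)" "qm (\<lambda>x. L (f x))"] by blast
    moreover have "P M U (\<lambda>x. L (f x))"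
      using stable_left[OF P *(1), of f L] f(1) *(3) by blast
    ultimately show "iter_prop P R (Suc n) M U (\<lambda>x. L (f x))" by simp
  next
    fix M U f L N assume *: "open_domain M U" "iter_prop P R (Suc n) M U f" "blin L" "closed_subspace N" "L ` N \<subseteq> M"
    have f: "P M U f" "iter_prop P R n (next_sp M) (qdom M U) (qm f)" using *(2) by simp_all
    have qm: "qm (\<lambda>x. f (L x)) = (\<lambda>v. qm f (lift L v))"
      by (simp only: fun_eq_iff qm_comp_right[OF *(3), of f] simp_thms)
    show "iter_prop P R (Suc n) N {v \<in> N. L v \<in> U} (\<lambda>x. f (L x))"
      using stable_right[OF P *(1), of f L N, OF f(1) *(3-5)]
        stable_right[OF Suc dn[OF *(1)], of "qm f" "lift L" "next_sp N", OF f(2) blin_lift[OF *(3)]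
          closed_subspace_next[OF *(4)] lift_next_sp[OF *(5)]]
      by (simp only: iter_prop.simps qm qdom_preimage[OF *(4,3,5)] simp_thms)
  next
    fix M U f g assume *: "open_domain M U" "iter_prop P R (Suc n) M U f" "iter_prop P R (Suc n) M U g"
    have f: "P M U f" "iter_prop P R n (next_sp M) (qdom M U) (qm f)" using *(2) by simp_all
    have g: "P M U g" "iter_prop P R n (next_sp M) (qdom M U) (qm g)" using *(3) by simp_all
    have C1: "C1 M U f" "C1 M U g" using PC[of M U f] PC[of M U g] *(1) f g by blast+
    have "iter_prop P R n (next_sp M) (qdom M U) (\<lambda>v. qm f v + qm g v)"
      using stable_add[OF Suc dn[OF *(1)], of "qm f" "qm g"] f(2) g(2) by blast
    moreover have "qm f v + qm g v = qm (\<lambda>x. f x + g x) v" if "v \<in> qdom M U" for v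
      using qm_add[OF *(1) C1 that] by simp
    ultimately have "iter_prop P R n (next_sp M) (qdom M U) (qm (\<lambda>x. f x + g x))"
      using stable_cong[OF Suc dn[OF *(1)], of "\<lambda>v. qm f v + qm g v" "qm (\<lambda>x. f x + g x)"] by blast
    moreover have "P M U (\<lambda>x. f x + g x)" using stable_add[OF P *(1), of f g] f(1) g(1) by blast
    ultimately show "iter_prop P R (Suc n) M U (\<lambda>x. f x + g x)" by simp
  next
    fix M U L assume *: "open_domain M U" "blin L"
    have qm: "qm L = (\<lambda>v. L (py v))" by (simp add: fun_eq_iff qm_linear[OF *(2)])
    have "iter_prop P R n (next_sp M) (qdom M U) (\<lambda>v. L (py v))"
      using stable_left[OF Suc dn[OF *(1)], of py L] stable_linear[OF Suc dn[OF *(1)] blin_py] *(2) by blast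
    then show "iter_prop P R (Suc n) M U L"
      using stable_linear[OF P *] by (simp add: qm)
  qed
qed

lemma iter_prop_decrease:
  assumes "\<And>M U f. open_domain M U \<Longrightarrow> P M U f \<Longrightarrow> R M U f"
  shows "open_domain M U \<Longrightarrow> iter_prop P R (Suc n) M U f \<Longrightarrow> iter_prop P R n M U f"
proof (induction n arbitrary: M U f)
  case (Suc n)
  then show ?case using open_domain_next[OF Suc.prems(1)] by auto
qed (use assms in auto)

subsection \<open>Inverse maps\<close>

text \<open>A pair of mutually inverse maps that are both \<open>C\<^sup>1\<close>.  Then the derivatives of \<open>f\<close> are
  invertible: those of \<open>g\<close> are their inverses, as \<open>qm_inverse\<close> below shows.\<close>

definition c1_pair :: "'w set \<Rightarrow> 'w set \<Rightarrow> 'w set \<Rightarrow> ('w \<Rightarrow> 'w) \<Rightarrow> ('w \<Rightarrow> 'w) \<Rightarrow> bool"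
  where "c1_pair M V W f g \<longleftrightarrow> open_domain M V \<and> open_domain M W \<and> C1 M V f \<and> C1 M W g \<and>
    (\<forall>x\<in>V. f x \<in> W \<and> g (f x) = x) \<and> (\<forall>y\<in>W. g y \<in> V \<and> f (g y) = y)"

lemma c1_pair_sym: "c1_pair M V W f g \<Longrightarrow> c1_pair M W V g f"
  by (simp add: c1_pair_def)

lemma c1_pairD:
  assumes "c1_pair M V W f g"
  shows "open_domain M V" "open_domain M W" "C1 M V f" "C1 M W g"
    "x \<in> V \<Longrightarrow> f x \<in> W" "x \<in> V \<Longrightarrow> g (f x) = x" "y \<in> W \<Longrightarrow> g y \<in> V" "y \<in> W \<Longrightarrow> f (g y) = y"
  using assms by (auto simp: c1_pair_def)

text \<open>The map \<open>(x, y, t) \<mapsto> (f(x), f\<^sup>[\<^sup>1\<^sup>](x, y, t), t)\<close>, which at \<open>t = 0\<close> is the tangent map.\<close>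

definition prolong :: "('w \<Rightarrow> 'w) \<Rightarrow> 'w \<Rightarrow> 'w"
  where "prolong f v = pt (f (px v)) (qm f v) (ps v)"

lemma continuous_on_scale [continuous_intros]:
  "continuous_on S f \<Longrightarrow> continuous_on S g \<Longrightarrow> continuous_on S (\<lambda>x. scl (f x) (g x))"
  by (auto simp: continuous_on_def intro: tendsto_scale)

lemma continuous_on_pt [continuous_intros]:
  "continuous_on S f \<Longrightarrow> continuous_on S g \<Longrightarrow> continuous_on S h \<Longrightarrow> continuous_on S (\<lambda>x. pt (f x) (g x) (h x))"
  by (auto simp: continuous_on_def intro: tendsto_pt)

lemma continuous_on_proj [continuous_intros]:
  "continuous_on S f \<Longrightarrow> continuous_on S (\<lambda>x. px (f x))"
  "continuous_on S f \<Longrightarrow> continuous_on S (\<lambda>x. py (f x))"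
  "continuous_on S f \<Longrightarrow> continuous_on S (\<lambda>x. ps (f x))"
  by (auto simp: continuous_on_def intro: tendsto_px tendsto_py tendsto_ps)

lemma continuous_on_mult_scalar [continuous_intros]:
  fixes f g :: "'a::topological_space \<Rightarrow> 'k"
  shows "continuous_on S f \<Longrightarrow> continuous_on S g \<Longrightarrow> continuous_on S (\<lambda>x. f x * g x)"
  by (auto simp: continuous_on_def intro: tendsto_mult_valued)

text \<open>The prolongation maps the domain of \<open>f\<^sup>[\<^sup>1\<^sup>]\<close> into that of \<open>g\<^sup>[\<^sup>1\<^sup>]\<close>, because
  \<open>f(x) + t f\<^sup>[\<^sup>1\<^sup>](x, y, t) = f(x + t y)\<close>.\<close>

lemma prolong_in_qdom:
  assumes p: "c1_pair M V W f g" and v: "v \<in> qdom M V"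
  shows "prolong f v \<in> qdom M W" "qm f v \<in> M"
proof -
  note D = c1_pairD[OF p]
  obtain x y t where v_eq: "v = pt x y t" and xy: "x \<in> V" "y \<in> M" "x + scl t y \<in> V"
    using v by (auto elim: qdom_cases)
  show q: "qm f v \<in> M"
    using qm_in[OF D(1,3) open_domain_space[OF D(1)] _ v] D(5) open_domain_subset[OF D(2)] by blast
  have "f x + scl t (qm f v) = f (x + scl t y)"
    using qm_scale[OF D(1), of x y t f] v by (simp add: v_eq)
  then show "prolong f v \<in> qdom M W"
    using q xy D(5) by (auto simp: prolong_def v_eq pt_in_qdom[OF D(2)])
qed

lemma continuous_on_prolong:
  assumes "open_domain M V" "C1 M V f"
  shows "continuous_on (qdom M V) (prolong f)"
proof -
  have "continuous_on (qdom M V) (\<lambda>v. f (px v))"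
    using assms by (intro continuous_on_compose2[of V f "qdom M V" px] continuous_on_parts)
      (auto simp: C1_def qdom_def)
  then show ?thesis
    unfolding prolong_def using assms by (intro continuous_on_pt continuous_on_parts) (simp_all add: C1_def)
qed

text \<open>The passage from \<open>f\<close> to \<open>(x, y, t) \<mapsto> (f(x), f\<^sup>[\<^sup>1\<^sup>](x, y, t), t)\<close> respects inverses: for
  \<open>t \<noteq> 0\<close> this is the definition of the difference quotient, and \<open>t = 0\<close> follows by continuity.\<close>

lemma qm_inverse:
  assumes p: "c1_pair M V W f g" and v: "v \<in> qdom M V"
  shows "qm g (prolong f v) = py v"
proof -
  note D = c1_pairD[OF p]
  have nz: "qm g (prolong f (pt x y t)) = y" if v: "pt x y t \<in> qdom M V" and t: "t \<noteq> 0" for x y t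
  proof -
    have "f x + scl t (qm f (pt x y t)) = f (x + scl t y)"
      using qm_scale[OF D(1) v, of f] by simp
    then show ?thesis
      using v t D(6) by (simp add: prolong_def qm_pt dq_def pt_in_qdom[OF D(1)])
  qed
  obtain x y t where v_eq: "v = pt x y t" and xy: "x \<in> V" "y \<in> M"
    using v by (auto elim: qdom_cases)
  show ?thesis
  proof (cases "t = 0")
    case True
    have "continuous_on (qdom M V) (\<lambda>v. qm g (prolong f v))"
      using D continuous_on_prolong[OF D(1,3)] prolong_in_qdom[OF p]
      by (intro continuous_on_compose2[of "qdom M W" "qm g" "qdom M V" "prolong f"]) (auto simp: C1_def)
    then have "((\<lambda>s. qm g (prolong f (pt x y s))) \<longlongrightarrow> qm g (prolong f (pt x y 0))) (at 0)"
      by (intro tendsto_qdom[OF D(1) xy])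
    moreover have "\<forall>\<^sub>F s in at 0. qm g (prolong f (pt x y s)) = y"
      using eventually_pt_in_qdom[OF D(1) xy] eventually_neq_at_within[of 0 0 UNIV]
      by eventually_elim (rule nz)
    then have "((\<lambda>s. qm g (prolong f (pt x y s))) \<longlongrightarrow> y) (at 0)" by (rule tendsto_eventually)
    ultimately have "qm g (prolong f (pt x y 0)) = y" by (intro tendsto_unique) auto
    then show ?thesis by (simp add: v_eq True)
  qed (use nz v in \<open>simp add: v_eq\<close>)
qed

lemma prolong_inverse:
  assumes p: "c1_pair M V W f g" and v: "v \<in> qdom M V"
  shows "prolong g (prolong f v) = v"
proof -
  have "v \<in> next_sp M" "px v \<in> V" using v by (auto simp: qdom_def)
  then show ?thesis
    using qm_inverse[OF p v] c1_pairD(6)[OF p] unfolding prolong_def[of g]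
    by (auto simp: prolong_def elim!: next_sp_cases)
qed

text \<open>The difference quotients of \<open>g\<^sup>[\<^sup>1\<^sup>]\<close> in terms of \<open>f\<close>, \<open>f\<^sup>[\<^sup>2\<^sup>]\<close>, \<open>g\<close> and \<open>g\<^sup>[\<^sup>1\<^sup>]\<close>.  Write
  \<open>z = g\<^sup>[\<^sup>1\<^sup>](x, y, t)\<close> and \<open>z + s \<zeta>\<close> for the value at the moved point.  Since
  \<open>f\<^sup>[\<^sup>1\<^sup>](g x, z, t) = y\<close> and likewise at the moved point, \<open>s y\<^sub>1\<close> is an increment of
  \<open>f\<^sup>[\<^sup>1\<^sup>]\<close>.  It is the sum of an increment in the first and third argument, which is \<open>s R\<close>
  for a value \<open>R\<close> of \<open>f\<^sup>[\<^sup>2\<^sup>]\<close>, and of an increment in the second argument, which is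
  \<open>s f\<^sup>[\<^sup>1\<^sup>](a, \<zeta>, \<tau>)\<close>.  So \<open>\<zeta>\<close> is the value of \<open>g\<^sup>[\<^sup>1\<^sup>]\<close> at \<open>(f a, y\<^sub>1 - R, \<tau>)\<close>, an expression
  that makes sense for \<open>s = 0\<close> as well.\<close>

lemma second_quotient_formula:
  assumes p: "c1_pair M V W f g" and q: "C1 (next_sp M) (qdom M V) (qm f)"
    and \<omega>: "pt (pt x y t) (pt x1 y1 t1) s \<in> qdom (next_sp M) (qdom M W)"
    and z: "z = qm g (pt x y t)"
    and a: "a = g (x + scl s x1) + scl (t + s * t1) z" "a \<in> V"
    and A: "A = pt (pt (g x) z t) (pt (qm g (pt x x1 s)) 0 t1) s"
    and R: "R = qm (qm f) A"
    and B: "B = pt (f a) (y1 - R) (s * (t + s * t1))"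
  shows "A \<in> qdom (next_sp M) (qdom M V)" "B \<in> qdom M W"
    "s \<noteq> 0 \<Longrightarrow> qm (qm g) (pt (pt x y t) (pt x1 y1 t1) s) = qm g B"
proof -
  note D = c1_pairD[OF p]
  note M = open_domain_space[OF D(1)]
  note Vq = open_domain_next[OF D(1)] and Wq = open_domain_next[OF D(2)]
  have xyt: "pt x y t \<in> qdom M W" and d: "x1 \<in> M" "y1 \<in> M"
    and moved: "pt (x + scl s x1) (y + scl s y1) (t + s * t1) \<in> qdom M W"
    using \<omega> by (auto simp: pt_in_qdom[OF Wq] pt_add pt_scale)
  have xyt': "x \<in> W" "y \<in> M" "x + scl s x1 \<in> W"
    using xyt moved by (auto simp: pt_in_qdom[OF D(2)])
  have xx1: "pt x x1 s \<in> qdom M W" using xyt' d by (simp add: pt_in_qdom[OF D(2)])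
  define b where "b = g (x + scl s x1)"
  define u where "u = qm g (pt x x1 s)"
  define t' where "t' = t + s * t1"
  have zM: "z \<in> M" and uM: "u \<in> M"
    using prolong_in_qdom(2)[OF c1_pair_sym[OF p]] xyt xx1 by (auto simp: z u_def)
  have base: "pt (g x) z t \<in> qdom M V"
    using prolong_in_qdom(1)[OF c1_pair_sym[OF p] xyt] by (simp add: prolong_def z)
  have base_val: "qm f (pt (g x) z t) = y"
    using qm_inverse[OF c1_pair_sym[OF p] xyt] by (simp add: prolong_def z)
  have b_eq: "g x + scl s u = b"
    using qm_scale[OF D(2) xx1, of g] by (simp add: b_def u_def)
  have bV: "b \<in> V" using D(7) xyt' by (simp add: b_def)
  have a_eq: "a = b + scl t' z" by (simp add: a b_def t'_def)
  have bz: "pt b z t' \<in> qdom M V"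
    using bV zM a(2) by (simp add: pt_in_qdom[OF D(1)] flip: a_eq)
  show A_in: "A \<in> qdom (next_sp M) (qdom M V)"
    using base bz uM M b_eq
    by (auto simp: A pt_in_qdom[OF Vq] pt_add pt_scale t'_def simp flip: u_def)
  have RM: "R \<in> M"
    using qm_in[OF Vq q M _ A_in] prolong_in_qdom(2)[OF p] by (simp add: R)
  have step: "B \<in> qdom M W \<and> qm g B = dq (qm g) (pt x y t) (pt x1 y1 t1) s" if s: "s \<noteq> 0"
  proof -
    define z' where "z' = qm g (pt (x + scl s x1) (y + scl s y1) t')"
    define \<zeta> where "\<zeta> = scl (1 / s) (z' - z)"
    have z'M: "z' \<in> M"
      using prolong_in_qdom(2)[OF c1_pair_sym[OF p] moved] by (simp add: z'_def t'_def)
    then have \<zeta>M: "\<zeta> \<in> M" using zM M by (auto simp: \<zeta>_def)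
    have z'_eq: "z' = z + scl s \<zeta>" using s by (simp add: \<zeta>_def)
    have moved_in: "pt b z' t' \<in> qdom M V"
      using prolong_in_qdom(1)[OF c1_pair_sym[OF p] moved] by (simp add: prolong_def b_def z'_def t'_def)
    have moved_val: "qm f (pt b z' t') = y + scl s y1"
      using qm_inverse[OF c1_pair_sym[OF p] moved] by (simp add: prolong_def b_def z'_def t'_def)
    have bz'V: "b + scl t' z' \<in> V" using moved_in by (simp add: pt_in_qdom[OF D(1)])
    have "qm f (pt b (z + scl s \<zeta>) t') = qm f (pt b z t') + scl s (qm f (pt (b + scl t' z) \<zeta> (s * t')))"
      using a(2) bz'V by (intro qm_increment[OF D(1,3) bV zM \<zeta>M]) (simp_all add: a_eq z'_eq)
    then have inc: "y + scl s y1 = qm f (pt b z t') + scl s (qm f (pt a \<zeta> (s * t')))"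
      using moved_val by (simp add: z'_eq a_eq)
    have "R = scl (1 / s) (qm f (pt b z t') - y)"
      using s base_val b_eq
      by (simp add: R A qm_pt dq_def pt_add pt_scale t'_def flip: u_def)
    then have "qm f (pt b z t') = y + scl s R" using s by simp
    then have "scl s y1 = scl s R + scl s (qm f (pt a \<zeta> (s * t')))"
      using inc by (simp add: add.assoc)
    then have "scl s (y1 - R) = scl s (qm f (pt a \<zeta> (s * t')))"
      by (simp add: scale_right_diff_distrib)
    then have val: "qm f (pt a \<zeta> (s * t')) = y1 - R" using s by simp
    have "a + scl (s * t') \<zeta> = b + scl t' z'"
      by (simp add: a_eq z'_eq algebra_simps)
    then have in_V: "pt a \<zeta> (s * t') \<in> qdom M V"
      using a(2) \<zeta>M bz'V by (simp add: pt_in_qdom[OF D(1)])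
    have B_eq: "B = prolong f (pt a \<zeta> (s * t'))"
      by (simp only: prolong_def val B px_pt py_pt ps_pt) (simp add: t'_def)
    have "qm g B = \<zeta>" using qm_inverse[OF p in_V] by (simp add: B_eq)
    moreover have "B \<in> qdom M W" using prolong_in_qdom(1)[OF p in_V] by (simp add: B_eq)
    moreover have "dq (qm g) (pt x y t) (pt x1 y1 t1) s = \<zeta>"
      by (simp add: dq_def \<zeta>_def pt_add pt_scale z z'_def t'_def)
    ultimately show ?thesis by simp
  qed
  show "B \<in> qdom M W"
  proof (cases "s = 0")
    case True
    then show ?thesis using D(5) a(2) d RM M by (auto simp: B pt_in_qdom[OF D(2)])
  qed (use step in blast)
  show "qm (qm g) (pt (pt x y t) (pt x1 y1 t1) s) = qm g B" if "s \<noteq> 0"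
    using step[OF that] that by (simp add: qm_pt)
qed

text \<open>The formula for the difference quotients of \<open>g\<^sup>[\<^sup>1\<^sup>]\<close> is available where \<open>a\<close> lies in \<open>V\<close>.
  At \<open>s = 0\<close> this holds since \<open>a = g(x) + t g\<^sup>[\<^sup>1\<^sup>](x, y, t) = g(x + t y)\<close> there, hence also
  nearby.  So near \<open>s = 0\<close> the formula is the continuous extension of the difference quotients.\<close>

lemma C1_quotient_inverse:
  assumes p: "c1_pair M V W f g" and q: "C1 (next_sp M) (qdom M V) (qm f)"
  shows "C1 (next_sp M) (qdom M W) (qm g)"
proof (rule C1_I_at_zero)
  note D = c1_pairD[OF p]
  note M = open_domain_space[OF D(1)]
  note Vq = open_domain_next[OF D(1)] and Wq = open_domain_next[OF D(2)]
  show "open_domain (next_sp M) (qdom M W)" by (rule Wq)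
  show "continuous_on (qdom M W) (qm g)" using D(4) by (simp add: C1_def)
  define N where "N = next_sp M"
  define \<Omega> where "\<Omega> = qdom N (qdom M W)"
  define a where "a = (\<lambda>\<omega>. g (px (px \<omega>) + scl (ps \<omega>) (px (py \<omega>)))
    + scl (ps (px \<omega>) + ps \<omega> * ps (py \<omega>)) (qm g (px \<omega>)))"
  define A where "A = (\<lambda>\<omega>. pt (pt (g (px (px \<omega>))) (qm g (px \<omega>)) (ps (px \<omega>)))
    (pt (qm g (pt (px (px \<omega>)) (px (py \<omega>)) (ps \<omega>))) 0 (ps (py \<omega>))) (ps \<omega>))"
  define B where "B = (\<lambda>\<omega>. pt (f (a \<omega>)) (py (py \<omega>) - qm (qm f) (A \<omega>))
    (ps \<omega> * (ps (px \<omega>) + ps \<omega> * ps (py \<omega>))))"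
  have cases: thesis if "\<omega> \<in> \<Omega>" and
    "\<And>x y t x1 y1 t1 s. \<omega> = pt (pt x y t) (pt x1 y1 t1) s \<Longrightarrow> pt x y t \<in> qdom M W \<Longrightarrow> x \<in> W \<Longrightarrow> x + scl s x1 \<in> W \<Longrightarrow>
      x1 \<in> M \<Longrightarrow> y1 \<in> M \<Longrightarrow> pt x x1 s \<in> qdom M W \<Longrightarrow> thesis" for \<omega> thesis
  proof -
    obtain v d s where 1: "\<omega> = pt v d s" "v \<in> qdom M W" "d \<in> N" "v + scl s d \<in> qdom M W"
      using \<open>\<omega> \<in> \<Omega>\<close> unfolding \<Omega>_def by (auto elim: qdom_cases)
    obtain x y t where v: "v = pt x y t" "x \<in> W" using 1(2) by (auto elim: qdom_cases)
    obtain x1 y1 t1 where d: "d = pt x1 y1 t1" "x1 \<in> M" "y1 \<in> M"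
      using 1(3) unfolding N_def by (auto elim: next_sp_cases)
    have "x + scl s x1 \<in> W" using 1(4) by (simp add: v d pt_add pt_scale pt_in_qdom[OF D(2)])
    then show thesis using that(2)[of x y t x1 y1 t1 s] 1 v d by (simp add: pt_in_qdom[OF D(2)])
  qed
  have step: "A \<omega> \<in> qdom N (qdom M V)" "B \<omega> \<in> qdom M W" "ps \<omega> \<noteq> 0 \<Longrightarrow> qm (qm g) \<omega> = qm g (B \<omega>)"
    if \<omega>: "\<omega> \<in> \<Omega>" "a \<omega> \<in> V" for \<omega>
  proof -
    obtain x y t x1 y1 t1 s where eq: "\<omega> = pt (pt x y t) (pt x1 y1 t1) s"
      using cases[OF \<omega>(1)] by metis
    show "A \<omega> \<in> qdom N (qdom M V)" "B \<omega> \<in> qdom M W" "ps \<omega> \<noteq> 0 \<Longrightarrow> qm (qm g) \<omega> = qm g (B \<omega>)"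
      using second_quotient_formula[OF p q \<omega>(1)[unfolded eq \<Omega>_def N_def] refl _ _ refl refl refl] \<omega>(2)
      by (simp_all add: A_def B_def a_def eq N_def)
  qed
  have cg: "continuous_on S (\<lambda>\<omega>. g (h \<omega>))" if "continuous_on S h" "h ` S \<subseteq> W"
    for h and S :: "'w set"
    using D(4) by (intro continuous_on_compose2[OF _ that]) (simp add: C1_def)
  have cqg: "continuous_on S (\<lambda>\<omega>. qm g (h \<omega>))" if "continuous_on S h" "h ` S \<subseteq> qdom M W"
    for h and S :: "'w set"
    using D(4) by (intro continuous_on_compose2[OF _ that]) (simp add: C1_def)
  have a_cont: "continuous_on \<Omega> a"
    unfolding a_def
    by (intro continuous_intros cg cqg continuous_on_id) (auto elim!: cases)
  have a_in: "a \<omega> \<in> M" if \<omega>: "\<omega> \<in> \<Omega>" for \<omega>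
  proof -
    obtain x y t x1 y1 t1 s where eq: "\<omega> = pt (pt x y t) (pt x1 y1 t1) s"
      "pt x y t \<in> qdom M W" "x + scl s x1 \<in> W"
      using cases[OF \<omega>] by metis
    then show ?thesis
      using D(7) open_domain_subset[OF D(1)] prolong_in_qdom(2)[OF c1_pair_sym[OF p]] M
      by (auto simp: a_def intro!: subspace_ops(2,4))
  qed
  \<comment> \<open>the part of the domain where the formula is valid\<close>
  define \<Omega>' where "\<Omega>' = {\<omega> \<in> \<Omega>. a \<omega> \<in> V}"
  have \<Phi>_cont: "continuous_on \<Omega>' (\<lambda>\<omega>. qm g (B \<omega>))"
  proof (rule cqg)
    have "continuous_on \<Omega>' A"
      unfolding A_def
      by (intro continuous_intros cg cqg continuous_on_id) (auto simp: \<Omega>'_def elim!: cases)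
    then have "continuous_on \<Omega>' (\<lambda>\<omega>. qm (qm f) (A \<omega>))"
      using q step(1)
      by (intro continuous_on_compose2[of "qdom N (qdom M V)" "qm (qm f)" \<Omega>' A])
        (auto simp: C1_def \<Omega>'_def N_def)
    moreover have "continuous_on \<Omega>' (\<lambda>\<omega>. f (a \<omega>))"
      using D(3) continuous_on_subset[OF a_cont, of \<Omega>']
      by (intro continuous_on_compose2[of V f \<Omega>' a]) (auto simp: C1_def \<Omega>'_def)
    ultimately show "continuous_on \<Omega>' B"
      unfolding B_def by (intro continuous_intros continuous_on_id)
    show "B ` \<Omega>' \<subseteq> qdom M W" using step(2) by (auto simp: \<Omega>'_def)
  qed
  have dom\<Omega>: "open_domain (next_sp N) \<Omega>" unfolding \<Omega>_def N_def by (rule open_domain_next[OF Wq])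
  have a_zero: "a (pt v d 0) \<in> V" if v_in: "v \<in> qdom M W" "d \<in> N" for v d
  proof -
    obtain x y t where v: "v = pt x y t" "x + scl t y \<in> W" using v_in by (auto elim: qdom_cases)
    have "a (pt v d 0) = g (x + scl t y)"
      using qm_scale[OF D(2), of x y t g] v_in by (simp add: a_def v)
    then show ?thesis using D(7) v by simp
  qed
  have open_V: "\<forall>\<^sub>F \<omega> in F. a (h \<omega>) \<in> V"
    if "(h \<longlongrightarrow> pt v d 0) F" "v \<in> qdom M W" "d \<in> N" "\<forall>\<^sub>F \<omega> in F. h \<omega> \<in> \<Omega>"
    for h v d and F :: "'a filter"
  proof (rule eventually_openin[of M V])
    show "openin (top_of_set M) V" using D(1) by (simp add: open_domain_def)
    have "pt v d 0 \<in> \<Omega>" unfolding \<Omega>_def N_def using that Wq by (simp add: pt_in_qdom N_def)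
    then show "((\<lambda>\<omega>. a (h \<omega>)) \<longlongrightarrow> a (pt v d 0)) F"
      using that by (intro continuous_on_tendsto_compose[OF a_cont])
    show "a (pt v d 0) \<in> V" by (rule a_zero) fact+
    show "\<forall>\<^sub>F \<omega> in F. a (h \<omega>) \<in> M" using that(4) by eventually_elim (rule a_in)
  qed
  have zero: "qm (qm g) (pt v d 0) = qm g (B (pt v d 0))" if v: "v \<in> qdom M W" and d: "d \<in> N" for v d
  proof (rule qm_zeroI)
    have in_\<Omega>: "\<forall>\<^sub>F s in at 0. pt v d s \<in> \<Omega>"
      unfolding \<Omega>_def N_def using d by (intro eventually_pt_in_qdom[OF Wq v]) (simp add: N_def)
    have lim: "((\<lambda>s. pt v d s) \<longlongrightarrow> pt v d 0) (at 0)" by (intro tendsto_intros tendsto_ident_at)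
    have ev: "\<forall>\<^sub>F s in at 0. pt v d s \<in> \<Omega>'"
      using open_V[OF lim v d in_\<Omega>] in_\<Omega> by eventually_elim (simp add: \<Omega>'_def)
    have "pt v d 0 \<in> \<Omega>'" using a_zero[OF v d] v d Wq by (simp add: \<Omega>'_def \<Omega>_def N_def pt_in_qdom)
    then have "((\<lambda>s. qm g (B (pt v d s))) \<longlongrightarrow> qm g (B (pt v d 0))) (at 0)"
      by (intro continuous_on_tendsto_compose[OF \<Phi>_cont lim _ ev])
    moreover have "\<forall>\<^sub>F s in at 0. qm g (B (pt v d s)) = dq (qm g) v d s"
      using ev eventually_neq_at_within[of 0 0 UNIV]
    proof eventually_elim
      case (elim s)
      then have "qm (qm g) (pt v d s) = qm g (B (pt v d s))" by (intro step(3)) (auto simp: \<Omega>'_def)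
      then show ?case using elim by (simp add: qm_pt)
    qed
    ultimately show "(dq (qm g) v d \<longlongrightarrow> qm g (B (pt v d 0))) (at 0)" by (rule Lim_transform_eventually)
  qed
  fix v d assume v: "v \<in> qdom M W" and d: "d \<in> next_sp M"
  then have dN: "d \<in> N" by (simp add: N_def)
  let ?F = "at (pt v d 0) within \<Omega>"
  have id: "((\<lambda>\<omega>. \<omega>) \<longlongrightarrow> pt v d 0) ?F" by (rule tendsto_ident_at)
  have in_\<Omega>: "\<forall>\<^sub>F \<omega> in ?F. \<omega> \<in> \<Omega>" by (simp add: eventually_at_filter)
  have ev: "\<forall>\<^sub>F \<omega> in ?F. \<omega> \<in> \<Omega>'"
    using open_V[OF id v dN in_\<Omega>] in_\<Omega> by eventually_elim (simp add: \<Omega>'_def)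
  have "pt v d 0 \<in> \<Omega>'" using a_zero[OF v dN] v d Wq by (simp add: \<Omega>'_def \<Omega>_def N_def pt_in_qdom)
  then have "((\<lambda>\<omega>. qm g (B \<omega>)) \<longlongrightarrow> qm g (B (pt v d 0))) ?F"
    by (intro continuous_on_tendsto_compose[OF \<Phi>_cont id _ ev])
  moreover have "\<forall>\<^sub>F \<omega> in ?F. qm g (B \<omega>) = qm (qm g) \<omega>"
    using ev
  proof eventually_elim
    case (elim \<omega>)
    show ?case
    proof (cases "ps \<omega> = 0")
      case True
      obtain v' d' where "\<omega> = pt v' d' 0" "v' \<in> qdom M W" "d' \<in> N"
        using elim True unfolding \<Omega>'_def \<Omega>_def by (auto elim: qdom_cases)
      then show ?thesis using zero by simp
    next
      case False
      then show ?thesis using step(3)[of \<omega>] elim by (simp add: \<Omega>'_def)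
    qed
  qed
  ultimately have "(qm (qm g) \<longlongrightarrow> qm g (B (pt v d 0))) ?F" by (rule Lim_transform_eventually)
  then show "(qm (qm g) \<longlongrightarrow> qm (qm g) (pt v d 0)) (at (pt v d 0) within qdom (next_sp M) (qdom M W))"
    by (simp add: zero[OF v dN] \<Omega>_def N_def)
qed

text \<open>The prolongation is a sum of three maps, each of which is composed from \<open>h\<close>, \<open>h\<^sup>[\<^sup>1\<^sup>]\<close> or the
  projections with bounded linear maps.\<close>

lemma stable_prolong:
  assumes T: "stable T" and dom: "open_domain M U" and h: "T M U h"
    and q: "T (next_sp M) (qdom M U) (qm h)"
  shows "T (next_sp M) (qdom M U) (prolong h)"
proof -
  note dom' = open_domain_next[OF dom] and M = open_domain_space[OF dom]
  have px: "px ` next_sp M \<subseteq> M" by (auto simp: next_sp_def)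
  have "T (next_sp M) {v \<in> next_sp M. px v \<in> U} (\<lambda>v. h (px v))"
    by (rule stable_right[OF T dom, of h px "next_sp M", OF h blin_px closed_subspace_next[OF M] px])
  then have "T (next_sp M) (qdom M U) (\<lambda>v. h (px v))"
    by (rule stable_subdomain[OF T open_domain_preimage[OF dom closed_subspace_next[OF M] blin_px px]])
      (use dom' in \<open>simp add: open_domain_def\<close>, auto simp: qdom_def)
  then have 1: "T (next_sp M) (qdom M U) (\<lambda>v. pt (h (px v)) 0 0)"
    by (rule stable_left[OF T dom', of "\<lambda>v. h (px v)" "\<lambda>v. pt v 0 0", OF _ blin_pt_first])
  have 2: "T (next_sp M) (qdom M U) (\<lambda>v. pt 0 (qm h v) 0)"
    by (rule stable_left[OF T dom', of "qm h" "\<lambda>v. pt 0 v 0", OF q blin_pt_second])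
  have 3: "T (next_sp M) (qdom M U) (\<lambda>v. pt 0 0 (ps v))"
    by (rule stable_linear[OF T dom' blin_pt_third])
  have 12: "T (next_sp M) (qdom M U) (\<lambda>v. pt (h (px v)) 0 0 + pt 0 (qm h v) 0)"
    by (rule stable_add[OF T dom', of "\<lambda>v. pt (h (px v)) 0 0" "\<lambda>v. pt 0 (qm h v) 0", OF 1 2])
  have 123: "T (next_sp M) (qdom M U) (\<lambda>v. pt (h (px v)) 0 0 + pt 0 (qm h v) 0 + pt 0 0 (ps v))"
    by (rule stable_add[OF T dom', of "\<lambda>v. pt (h (px v)) 0 0 + pt 0 (qm h v) 0" "\<lambda>v. pt 0 0 (ps v)", OF 12 3])
  have "prolong h v = pt (h (px v)) 0 0 + pt 0 (qm h v) 0 + pt 0 0 (ps v)" for v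
    by (simp add: prolong_def pt_add)
  then have eq: "prolong h = (\<lambda>v. pt (h (px v)) 0 0 + pt 0 (qm h v) 0 + pt 0 0 (ps v))" by (rule ext)
  show ?thesis unfolding eq by (rule 123)
qed

lemma c1_pair_next:
  assumes p: "c1_pair M V W f g" and q: "C1 (next_sp M) (qdom M V) (qm f)"
  shows "c1_pair (next_sp M) (qdom M V) (qdom M W) (prolong f) (prolong g)"
proof -
  note D = c1_pairD[OF p]
  have C1: "C1 (next_sp M) (qdom M U) (prolong h)"
    if "open_domain M U" "C1 M U h" "C1 (next_sp M) (qdom M U) (qm h)" for U h
    using stable_prolong[OF stable_C1 that] .
  show ?thesis
    unfolding c1_pair_def
    using open_domain_next[OF D(1)] open_domain_next[OF D(2)] C1[OF D(1,3) q]
      C1[OF D(2,4) C1_quotient_inverse[OF p q]] prolong_in_qdom(1)[OF p] prolong_inverse[OF p]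
      prolong_in_qdom(1)[OF c1_pair_sym[OF p]] prolong_inverse[OF c1_pair_sym[OF p]]
    by simp
qed

lemma Lip_at:
  assumes "Lip M U f" "x0 \<in> U"
  obtains L \<delta> where "L \<ge> 0" "\<delta> > 0" "\<And>x y. x \<in> U \<Longrightarrow> y \<in> U \<Longrightarrow> gnorm (x - x0) < \<delta> \<Longrightarrow>
    gnorm (y - x0) < \<delta> \<Longrightarrow> gnorm (f y - f x) \<le> L * gnorm (y - x)"
proof -
  obtain L \<delta> where d: "\<delta> > 0" "\<And>x y. x \<in> U \<Longrightarrow> y \<in> U \<Longrightarrow> gnorm (x - x0) < \<delta> \<Longrightarrow>
      gnorm (y - x0) < \<delta> \<Longrightarrow> gnorm (f y - f x) \<le> L * gnorm (y - x)"
    using assms unfolding Lip_def by meson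
  have "L * gnorm (y - x) \<le> max L 0 * gnorm (y - x)" for x y
    using gnorm_ge_0 by (intro mult_right_mono) auto
  then show thesis
    using d(1) by (intro that[of "max L 0" \<delta>] order_trans[OF d(2)]) auto
qed

text \<open>The quotient map of a Lipschitz map is bounded by a multiple of its second argument: this is
  the Lipschitz condition divided by \<open>t\<close>.\<close>

lemma Lip_quotient_bound:
  assumes dom: "open_domain M W" and g: "C1 M W g" and v: "pt u w t \<in> qdom M W"
    and L: "\<And>x y. x \<in> W \<Longrightarrow> y \<in> W \<Longrightarrow> gnorm (x - c) < \<delta> \<Longrightarrow> gnorm (y - c) < \<delta> \<Longrightarrow>
      gnorm (g y - g x) \<le> L * gnorm (y - x)"
    and near: "gnorm (u - c) < \<delta>" "gnorm (u + scl t w - c) < \<delta>"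
  shows "gnorm (qm g (pt u w t)) \<le> L * gnorm w"
proof -
  have u: "u \<in> W" and w: "w \<in> M" using v by (auto simp: pt_in_qdom[OF dom])
  have dq: "gnorm (dq g u w s) \<le> L * gnorm w"
    if "pt u w s \<in> qdom M W" "gnorm (u + scl s w - c) < \<delta>" "s \<noteq> 0" for s
  proof -
    have "gnorm (g (u + scl s w) - g u) \<le> L * gnorm (u + scl s w - u)"
      using that near by (intro L) (auto simp: pt_in_qdom[OF dom])
    then have "gnorm s * gnorm (dq g u w s) \<le> gnorm s * (L * gnorm w)"
      using that(3) by (simp add: gnorm_scale mult_ac flip: dq_eq[of s g u w])
    moreover have "gnorm s > 0" using that by simp
    ultimately show ?thesis by (simp only: mult_le_cancel_left_pos)
  qed
  show ?thesis
  proof (cases "t = 0")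
    case True
    have "((\<lambda>s. gnorm (u + scl s w - c)) \<longlongrightarrow> gnorm (u + scl 0 w - c)) (at 0)"
      by (intro tendsto_intros tendsto_ident_at)
    then have "\<forall>\<^sub>F s in at 0. gnorm (u + scl s w - c) < \<delta>"
      using near by (intro order_tendstoD(2)) auto
    then have "\<forall>\<^sub>F s in at 0. gnorm (dq g u w s) \<le> L * gnorm w"
      using eventually_pt_in_qdom[OF dom u w] eventually_neq_at_within[of 0 0 UNIV]
      by eventually_elim (use dq in auto)
    moreover have "((\<lambda>s. gnorm (dq g u w s)) \<longlongrightarrow> gnorm (qm g (pt u w 0))) (at 0)"
      by (intro tendsto_gnorm C1_tendsto_dq[OF dom g u w])
    ultimately have "gnorm (qm g (pt u w 0)) \<le> L * gnorm w" by (intro tendsto_upperbound) auto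
    then show ?thesis by (simp add: True)
  qed (use dq v near in \<open>auto simp: qm_pt\<close>)
qed

text \<open>Two values \<open>z = g\<^sup>[\<^sup>1\<^sup>](x, y, t)\<close> and \<open>z' = g\<^sup>[\<^sup>1\<^sup>](x', y', t')\<close> differ by a value of \<open>g\<^sup>[\<^sup>1\<^sup>]\<close>,
  namely at \<open>(f a, w, t')\<close> with \<open>a = g x' + t' z\<close> and \<open>w = y' - f\<^sup>[\<^sup>1\<^sup>](g x', z, t')\<close>.  The Lipschitz
  condition on \<open>f\<^sup>[\<^sup>1\<^sup>]\<close> bounds \<open>w\<close>, and \<open>g\<^sup>[\<^sup>1\<^sup>]\<close> is bounded by a multiple of its second
  argument because \<open>g\<close> is locally Lipschitz.\<close>

lemma Lip_quotient_inverse: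
  assumes p: "c1_pair M V W f g" and q: "Lip (next_sp M) (qdom M V) (qm f)"
  shows "Lip (next_sp M) (qdom M W) (qm g)"
  unfolding Lip_def
proof
  note D = c1_pairD[OF p]
  note M = open_domain_space[OF D(1)]
  note p' = c1_pair_sym[OF p]
  define \<Omega> where "\<Omega> = qdom M W"
  fix v0 assume v0: "v0 \<in> qdom M W"
  obtain x0 y0 t0 where v0_eq: "v0 = pt x0 y0 t0" and x0: "x0 \<in> W" and y0: "y0 \<in> M"
    and c0: "x0 + scl t0 y0 \<in> W"
    using v0 by (auto elim: qdom_cases)
  define c where "c = x0 + scl t0 y0"
  define z0 where "z0 = qm g v0"
  obtain L1 \<delta>1 where L1: "L1 \<ge> 0" "\<delta>1 > 0" "\<And>x y. x \<in> W \<Longrightarrow> y \<in> W \<Longrightarrow> gnorm (x - x0) < \<delta>1 \<Longrightarrow>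
      gnorm (y - x0) < \<delta>1 \<Longrightarrow> gnorm (g y - g x) \<le> L1 * gnorm (y - x)"
    by (rule Lip_at[OF C1_imp_Lip[OF D(2,4)] x0]) (rule that)
  obtain L2 \<delta>2 where L2: "L2 \<ge> 0" "\<delta>2 > 0" "\<And>x y. x \<in> W \<Longrightarrow> y \<in> W \<Longrightarrow> gnorm (x - c) < \<delta>2 \<Longrightarrow>
      gnorm (y - c) < \<delta>2 \<Longrightarrow> gnorm (g y - g x) \<le> L2 * gnorm (y - x)"
    by (rule Lip_at[OF C1_imp_Lip[OF D(2,4)] c0[folded c_def]]) (rule that)
  have Gv0: "pt (g x0) z0 t0 \<in> qdom M V"
    using prolong_in_qdom(1)[OF p' v0] by (simp add: prolong_def z0_def v0_eq)
  obtain L3 \<delta>3 where L3: "L3 \<ge> 0" "\<delta>3 > 0" "\<And>u v. u \<in> qdom M V \<Longrightarrow> v \<in> qdom M V \<Longrightarrow>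
      gnorm (u - pt (g x0) z0 t0) < \<delta>3 \<Longrightarrow> gnorm (v - pt (g x0) z0 t0) < \<delta>3 \<Longrightarrow>
      gnorm (qm f v - qm f u) \<le> L3 * gnorm (v - u)"
    by (rule Lip_at[OF q Gv0]) (rule that)
  \<comment> \<open>a pair of points \<open>v, v'\<close> of \<open>\<Omega>\<close> tending to \<open>v0\<close>; either may equal \<open>v0\<close>\<close>
  define F where "F = inf (nhds v0) (principal \<Omega>)"
  define F2 where "F2 = F \<times>\<^sub>F F"
  have id: "((\<lambda>v. v) \<longlongrightarrow> v0) F" unfolding F_def by (simp add: filterlim_iff eventually_inf_principal eventually_mono)
  have l1: "(fst \<longlongrightarrow> v0) F2" and l2: "(snd \<longlongrightarrow> v0) F2"
    unfolding F2_def by (rule filterlim_compose[OF id filterlim_fst] filterlim_compose[OF id filterlim_snd])+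
  have "\<forall>\<^sub>F v in F. v \<in> \<Omega>" unfolding F_def by (simp add: eventually_inf_principal)
  then have e1: "\<forall>\<^sub>F p in F2. fst p \<in> \<Omega>" and e2: "\<forall>\<^sub>F p in F2. snd p \<in> \<Omega>"
    unfolding F2_def
    by (rule eventually_compose_filterlim[OF _ filterlim_fst] eventually_compose_filterlim[OF _ filterlim_snd];
        assumption)+
  have gx1: "((\<lambda>p. g (px (fst p))) \<longlongrightarrow> g x0) F2" and gx2: "((\<lambda>p. g (px (snd p))) \<longlongrightarrow> g x0) F2"
  proof -
    have cg: "continuous_on W g" using D(4) by (simp add: C1_def)
    show "((\<lambda>p. g (px (fst p))) \<longlongrightarrow> g x0) F2"
      using tendsto_px[OF l1] by (intro continuous_on_tendsto_compose[OF cg _ x0] eventually_mono[OF e1])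
        (auto simp: v0_eq \<Omega>_def qdom_def)
    show "((\<lambda>p. g (px (snd p))) \<longlongrightarrow> g x0) F2"
      using tendsto_px[OF l2] by (intro continuous_on_tendsto_compose[OF cg _ x0] eventually_mono[OF e2])
        (auto simp: v0_eq \<Omega>_def qdom_def)
  qed
  have qg: "((\<lambda>p. qm g (fst p)) \<longlongrightarrow> z0) F2"
    unfolding z0_def using D(4) v0 e1 unfolding \<Omega>_def
    by (intro continuous_on_tendsto_compose[of "qdom M W" "qm g", OF _ l1]) (auto simp: C1_def)
  define a where "a = (\<lambda>p. g (px (snd p)) + scl (ps (snd p)) (qm g (fst p)))"
  have a_lim: "(a \<longlongrightarrow> g x0 + scl t0 z0) F2"
    unfolding a_def using tendsto_ps[OF l2] by (intro tendsto_intros gx2 qg) (simp add: v0_eq)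
  have a0: "g x0 + scl t0 z0 = g c"
    using qm_scale[OF D(2), of x0 y0 t0 g] v0 by (simp add: v0_eq z0_def c_def)
  have aM: "a p \<in> M" if "fst p \<in> \<Omega>" "snd p \<in> \<Omega>" for p
    using that D(7) open_domain_subset[OF D(1)] prolong_in_qdom(2)[OF p'] M
    unfolding \<Omega>_def by (auto simp: a_def qdom_def intro!: subspace_ops(2,4))
  have aV: "\<forall>\<^sub>F p in F2. a p \<in> V"
  proof (rule eventually_openin[of M V a, OF _ a_lim])
    show "openin (top_of_set M) V" using D(1) by (simp add: open_domain_def)
    show "g x0 + scl t0 z0 \<in> V" using D(7) c0 by (simp add: a0 c_def)
    show "\<forall>\<^sub>F p in F2. a p \<in> M" using e1 e2 by eventually_elim (rule aM)
  qed
  have "((\<lambda>p. f (a p)) \<longlongrightarrow> f (g c)) F2"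
    using D(3) a_lim aV D(7) c0 unfolding a0
    by (intro continuous_on_tendsto_compose[of V f a]) (auto simp: C1_def c_def)
  then have "((\<lambda>p. gnorm (f (a p) - c)) \<longlongrightarrow> gnorm (c - c)) F2"
    using D(8) c0 by (intro tendsto_intros) (simp_all add: c_def)
  then have n1: "\<forall>\<^sub>F p in F2. gnorm (f (a p) - c) < \<delta>2" using L2(2) by (intro order_tendstoD(2)) auto
  have "((\<lambda>p. gnorm (px (snd p) + scl (ps (snd p)) (py (snd p)) - c)) \<longlongrightarrow>
      gnorm (px v0 + scl (ps v0) (py v0) - c)) F2"
    by (intro tendsto_intros l2)
  then have n2: "\<forall>\<^sub>F p in F2. gnorm (px (snd p) + scl (ps (snd p)) (py (snd p)) - c) < \<delta>2"
    using L2(2) by (intro order_tendstoD(2)) (auto simp: v0_eq c_def)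
  have "((\<lambda>p. gnorm (px (fst p) - x0)) \<longlongrightarrow> gnorm (px v0 - x0)) F2" by (intro tendsto_intros l1)
  then have n3: "\<forall>\<^sub>F p in F2. gnorm (px (fst p) - x0) < \<delta>1"
    using L1(2) by (intro order_tendstoD(2)) (auto simp: v0_eq)
  have "((\<lambda>p. gnorm (px (snd p) - x0)) \<longlongrightarrow> gnorm (px v0 - x0)) F2" by (intro tendsto_intros l2)
  then have n4: "\<forall>\<^sub>F p in F2. gnorm (px (snd p) - x0) < \<delta>1"
    using L1(2) by (intro order_tendstoD(2)) (auto simp: v0_eq)
  have "((\<lambda>p. gnorm (pt (g (px (fst p))) (qm g (fst p)) (ps (fst p)) - pt (g x0) z0 t0)) \<longlongrightarrow>
      gnorm (pt (g x0) z0 (ps v0) - pt (g x0) z0 t0)) F2"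
    by (intro tendsto_intros l1 gx1 qg)
  then have n5: "\<forall>\<^sub>F p in F2. gnorm (pt (g (px (fst p))) (qm g (fst p)) (ps (fst p)) - pt (g x0) z0 t0) < \<delta>3"
    using L3(2) by (intro order_tendstoD(2)) (auto simp: v0_eq)
  have "((\<lambda>p. gnorm (pt (g (px (snd p))) (qm g (fst p)) (ps (snd p)) - pt (g x0) z0 t0)) \<longlongrightarrow>
      gnorm (pt (g x0) z0 (ps v0) - pt (g x0) z0 t0)) F2"
    by (intro tendsto_intros l2 gx2 qg)
  then have n6: "\<forall>\<^sub>F p in F2. gnorm (pt (g (px (snd p))) (qm g (fst p)) (ps (snd p)) - pt (g x0) z0 t0) < \<delta>3"
    using L3(2) by (intro order_tendstoD(2)) (auto simp: v0_eq)
  define K where "K = L2 * (1 + L3 * (L1 + 1))"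
  have "\<forall>\<^sub>F p in F2. gnorm (qm g (snd p) - qm g (fst p)) \<le> K * gnorm (snd p - fst p)"
    using e1 e2 aV n1 n2 n3 n4 n5 n6
  proof eventually_elim
    case (elim pp)
    obtain v v' where pp: "pp = (v, v')" by (cases pp)
    note elim = elim[unfolded pp fst_conv snd_conv]
    have v: "v \<in> qdom M W" and v': "v' \<in> qdom M W" using elim by (auto simp: \<Omega>_def)
    obtain x y t where v_eq: "v = pt x y t" and x: "x \<in> W" and y: "y \<in> M" using v by (auto elim: qdom_cases)
    obtain x' y' t' where v'_eq: "v' = pt x' y' t'" and x': "x' \<in> W" and y': "y' \<in> M"
      using v' by (auto elim: qdom_cases)
    define z where "z = qm g v"
    define z' where "z' = qm g v'"
    define b where "b = g x'"
    have zM: "z \<in> M" and z'M: "z' \<in> M" using prolong_in_qdom(2)[OF p'] v v' by (auto simp: z_def z'_def)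
    have hM: "z' - z \<in> M" using M zM z'M by blast
    have bV: "b \<in> V" using D(7) x' by (simp add: b_def)
    have a_eq: "a (v, v') = b + scl t' z" by (simp add: a_def b_def v'_eq z_def)
    have aV: "b + scl t' z \<in> V" using elim(3) by (simp add: a_eq)
    have base: "pt (g x) z t \<in> qdom M V" "qm f (pt (g x) z t) = y"
      using prolong_in_qdom(1)[OF p' v] qm_inverse[OF p' v] by (auto simp: prolong_def v_eq z_def)
    have moved: "pt b z' t' \<in> qdom M V" "qm f (pt b z' t') = y'"
      using prolong_in_qdom(1)[OF p' v'] qm_inverse[OF p' v'] by (auto simp: prolong_def v'_eq z'_def b_def)
    have bz: "pt b z t' \<in> qdom M V" using bV zM aV by (simp add: pt_in_qdom[OF D(1)])
    have bz'V: "b + scl t' z' \<in> V" using moved by (simp add: pt_in_qdom[OF D(1)])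
    define w where "w = qm f (pt (b + scl t' z) (z' - z) t')"
    have "qm f (pt b (z + scl 1 (z' - z)) t') = qm f (pt b z t') + scl 1 (qm f (pt (b + scl t' z) (z' - z) (1 * t')))"
      using bz'V by (intro qm_increment[OF D(1,3) bV zM hM aV]) simp
    then have w: "w = (y' - y) - (qm f (pt b z t') - qm f (pt (g x) z t))"
      using moved base by (simp add: w_def)
    have az: "b + scl t' z + scl t' (z' - z) = b + scl t' z'" by (simp add: scale_right_diff_distrib)
    have in_V: "pt (b + scl t' z) (z' - z) t' \<in> qdom M V"
      using aV hM bz'V by (simp add: pt_in_qdom[OF D(1)] az)
    have ext_eq: "prolong f (pt (b + scl t' z) (z' - z) t') = pt (f (b + scl t' z)) w t'"
      by (simp add: prolong_def w_def)
    have h: "qm g (pt (f (b + scl t' z)) w t') = z' - z"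
      using qm_inverse[OF p in_V] by (simp add: ext_eq)
    have in_W: "pt (f (b + scl t' z)) w t' \<in> qdom M W"
      using prolong_in_qdom(1)[OF p in_V] by (simp add: ext_eq)
    have end_pt: "f (b + scl t' z) + scl t' w = x' + scl t' y'"
    proof -
      have "f (b + scl t' z) + scl t' w = f (b + scl t' z')"
        using qm_scale[OF D(1) in_V, of f] by (simp add: w_def az)
      also have "b + scl t' z' = g (x' + scl t' y')"
        using qm_scale[OF D(2), of x' y' t' g] v' by (simp add: b_def z'_def v'_eq)
      also have "f \<dots> = x' + scl t' y'" using v' D(8) by (simp add: v'_eq pt_in_qdom[OF D(2)])
      finally show ?thesis .
    qed
    have "gnorm (z' - z) \<le> L2 * gnorm w"
      unfolding h[symmetric]
      using elim(4)[unfolded a_eq] elim(5) by (intro Lip_quotient_bound[OF D(2,4) in_W L2(3)])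
        (auto simp: end_pt v'_eq)
    also have "\<dots> \<le> L2 * ((1 + L3 * (L1 + 1)) * gnorm (v' - v))"
    proof (rule mult_left_mono[OF _ L2(1)])
      have nx: "gnorm (x' - x) \<le> gnorm (v' - v)" and ny: "gnorm (y' - y) \<le> gnorm (v' - v)"
        and nt: "gnorm (t' - t) \<le> gnorm (v' - v)"
        using gnorm_px[of "v' - v"] gnorm_py[of "v' - v"] gnorm_ps[of "v' - v"] by (auto simp: v_eq v'_eq)
      have "gnorm (pt b z t' - pt (g x) z t) \<le> gnorm (g x' - g x) + gnorm (t' - t)"
        using gnorm_pt[of "g x' - g x" 0 "t' - t"] by (simp add: pt_diff b_def)
      also have "\<dots> \<le> L1 * gnorm (x' - x) + gnorm (t' - t)"
        using elim(6,7) x x' by (intro add_right_mono L1(3)) (auto simp: v_eq v'_eq)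
      also have "\<dots> \<le> L1 * gnorm (v' - v) + gnorm (v' - v)"
        using nx nt L1(1) by (intro add_mono mult_left_mono)
      finally have diff: "gnorm (pt b z t' - pt (g x) z t) \<le> (L1 + 1) * gnorm (v' - v)"
        by (simp add: distrib_right)
      have "gnorm w \<le> gnorm (y' - y) + gnorm (qm f (pt b z t') - qm f (pt (g x) z t))"
        unfolding w by (rule gnorm_diff_le)
      also have "\<dots> \<le> gnorm (v' - v) + L3 * gnorm (pt b z t' - pt (g x) z t)"
        using elim(8,9) base bz ny
        by (intro add_mono L3(3)) (auto simp: v_eq v'_eq b_def z_def)
      also have "\<dots> \<le> gnorm (v' - v) + L3 * ((L1 + 1) * gnorm (v' - v))"
        using diff L3(1) by (intro add_left_mono mult_left_mono)
      finally show "gnorm w \<le> (1 + L3 * (L1 + 1)) * gnorm (v' - v)"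
        by (simp only: distrib_right mult_1 mult.assoc)
    qed
    finally show ?case by (simp add: pp z_def z'_def K_def mult.assoc)
  qed
  then obtain Q where Q: "eventually Q F" "\<And>v v'. Q v \<Longrightarrow> Q v' \<Longrightarrow>
      gnorm (qm g v' - qm g v) \<le> K * gnorm (v' - v)"
    unfolding F2_def eventually_prod_same by (auto simp: case_prod_unfold)
  obtain \<delta> where d: "\<delta> > 0" "\<And>v. dist v v0 < \<delta> \<Longrightarrow> v \<in> \<Omega> \<Longrightarrow> Q v"
    using Q(1) unfolding F_def eventually_inf_principal eventually_nhds_metric by blast
  show "\<exists>L. \<exists>\<delta>>0. \<forall>v\<in>qdom M W. \<forall>v'\<in>qdom M W. gnorm (v - v0) < \<delta> \<longrightarrow> gnorm (v' - v0) < \<delta> \<longrightarrow>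
      gnorm (qm g v' - qm g v) \<le> L * gnorm (v' - v)"
    using d Q(2) unfolding \<Omega>_def dist_gnorm by (intro exI[of _ K] exI[of _ \<delta>]) auto
qed

text \<open>Apply \<open>B\<close> to the error \<open>f(z) - f(y) - A(z - y)\<close>, where \<open>z = g(v)\<close> and \<open>y = g(u)\<close>: up to
  sign it becomes the error \<open>g(v) - g(u) - B(v - u)\<close> of the inverse map.  It is small compared to
  \<open>z - y\<close>, and therefore \<open>z - y\<close> is bounded by a multiple of \<open>v - u\<close>.\<close>

lemma approximates_inverse:
  assumes M: "closed_subspace M" "V \<subseteq> M" "W \<subseteq> M"
    and inv: "\<And>y. y \<in> W \<Longrightarrow> g y \<in> V" "\<And>y. y \<in> W \<Longrightarrow> f (g y) = y"
    and g: "continuous_on W g" and y0: "y0 \<in> W"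
    and A: "approximates V A (g y0) f" "\<And>h. h \<in> M \<Longrightarrow> A h \<in> M"
    and B: "lin_on M B" "\<And>h. h \<in> M \<Longrightarrow> B (A h) = h"
  shows "approximates W B y0 g"
proof (rule approximatesI)
  fix \<epsilon> :: real assume e: "\<epsilon> > 0"
  obtain C where C: "C > 0" "\<And>x. x \<in> M \<Longrightarrow> gnorm (B x) \<le> C * gnorm x" using lin_on_bound[OF B(1)] by blast
  \<comment> \<open>the first bound yields \<open>gnorm (z - y) \<le> 2 * C * gnorm (v - u)\<close>, the second one the claim\<close>
  define \<epsilon>1 where "\<epsilon>1 = min (1 / (2 * C)) (\<epsilon> / (2 * C * C))"
  have e1: "\<epsilon>1 > 0" "C * \<epsilon>1 \<le> 1 / 2" "C * \<epsilon>1 * (2 * C) \<le> \<epsilon>"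
  proof -
    show "\<epsilon>1 > 0" using e C(1) by (simp add: \<epsilon>1_def)
    have "C * \<epsilon>1 \<le> C * (1 / (2 * C))" using C(1) by (intro mult_left_mono) (auto simp: \<epsilon>1_def)
    then show "C * \<epsilon>1 \<le> 1 / 2" using C(1) by simp
    have "C * \<epsilon>1 * (2 * C) \<le> C * (\<epsilon> / (2 * C * C)) * (2 * C)"
      using C(1) by (intro mult_right_mono mult_left_mono) (auto simp: \<epsilon>1_def)
    also have "\<dots> = \<epsilon>" using C(1) by simp
    finally show "C * \<epsilon>1 * (2 * C) \<le> \<epsilon>" .
  qed
  obtain \<delta> where d: "\<delta> > 0" "\<And>y z. y \<in> V \<Longrightarrow> z \<in> V \<Longrightarrow> gnorm (z - g y0) < \<delta> \<Longrightarrow> gnorm (y - g y0) < \<delta> \<Longrightarrow>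
      gnorm (f z - f y - A (z - y)) \<le> \<epsilon>1 * gnorm (z - y)"
    by (rule approximatesE[OF A(1) e1(1)]) (rule that)
  obtain \<delta>' where d': "\<delta>' > 0" "\<And>y. y \<in> W \<Longrightarrow> gnorm (y - y0) < \<delta>' \<Longrightarrow> gnorm (g y - g y0) < \<delta>"
    using g y0 d(1) unfolding continuous_on_iff dist_gnorm by blast
  have "gnorm (g v - g u - B (v - u)) \<le> \<epsilon> * gnorm (v - u)"
    if u: "u \<in> W" "gnorm (u - y0) < \<delta>'" and v: "v \<in> W" "gnorm (v - y0) < \<delta>'" for u v
  proof -
    define h where "h = g v - g u"
    have hM: "h \<in> M" using M inv(1) u v by (auto simp: h_def)
    have uvM: "v - u \<in> M" using M u v by blast
    have "gnorm (v - u - A h) \<le> \<epsilon>1 * gnorm h"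
      using d(2)[OF inv(1)[OF u(1)] inv(1)[OF v(1)]] d'(2) u v inv(2) by (simp add: h_def)
    moreover have rM: "v - u - A h \<in> M" using M(1) uvM A(2)[OF hM] by blast
    ultimately have Br: "gnorm (B (v - u - A h)) \<le> C * \<epsilon>1 * gnorm h"
      using C(2)[OF rM] mult_left_mono[of _ _ C] C(1) by (metis (no_types) less_imp_le mult.assoc order_trans)
    have "B (v - u) = B (v - u - A h) + B (A h)"
      using B(1) rM A(2)[OF hM] unfolding lin_on_def by (metis diff_add_cancel)
    then have B_eq: "B (v - u) = B (v - u - A h) + h" using B(2)[OF hM] by simp
    have "gnorm h \<le> gnorm (B (v - u)) + gnorm (B (v - u - A h))"
      using gnorm_diff_le[of "B (v - u)" "B (v - u - A h)"] by (simp add: B_eq)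
    also have "\<dots> \<le> C * gnorm (v - u) + 1 / 2 * gnorm h"
      using C(2)[OF uvM] Br mult_right_mono[OF e1(2) gnorm_ge_0[of h]] by linarith
    finally have h_le: "gnorm h \<le> 2 * C * gnorm (v - u)" by simp
    have "gnorm (g v - g u - B (v - u)) = gnorm (B (v - u - A h))"
      using gnorm_uminus[of "B (v - u - A h)"] by (simp add: B_eq flip: h_def)
    also have "\<dots> \<le> C * \<epsilon>1 * (2 * C * gnorm (v - u))"
      using Br h_le C(1) e1(1) by (meson less_imp_le mult_left_mono mult_nonneg_nonneg order_trans)
    also have "\<dots> = C * \<epsilon>1 * (2 * C) * gnorm (v - u)" by simp
    also have "\<dots> \<le> \<epsilon> * gnorm (v - u)" using e1(3) gnorm_ge_0 by (intro mult_right_mono)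
    finally show ?thesis .
  qed
  then show "\<exists>\<delta>>0. \<forall>y\<in>W. \<forall>z\<in>W. gnorm (z - y0) < \<delta> \<longrightarrow> gnorm (y - y0) < \<delta> \<longrightarrow>
      gnorm (g z - g y - B (z - y)) \<le> \<epsilon> * gnorm (z - y)"
    using d'(1) by blast
qed

text \<open>The derivative of \<open>f\<close> at \<open>g(y)\<close> has the inverse \<open>h \<mapsto> g\<^sup>[\<^sup>1\<^sup>](y, h, 0)\<close>.\<close>

lemma Strict_inverse:
  assumes p: "c1_pair M V W f g" and f: "Strict M V f"
  shows "Strict M W g"
  unfolding Strict_def
proof
  note D = c1_pairD[OF p]
  note M = open_domain_space[OF D(1)]
  fix y assume y: "y \<in> W"
  obtain A where A: "lin_on M A" "approximates V A (g y) f" using f D(7)[OF y] unfolding Strict_def by blast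
  define B where "B = (\<lambda>h. qm g (pt y h 0))"
  have B: "lin_on M B" unfolding B_def by (rule C1_derivative_lin_on[OF D(2,4) y])
  have A_eq: "A h = qm f (pt (g y) h 0)" if "h \<in> M" for h
    using qm_zeroI[OF approximates_tendsto_dq[OF D(1) A D(7)[OF y] that]] by simp
  have in_V: "pt (g y) h 0 \<in> qdom M V" if "h \<in> M" for h
    using that D(7)[OF y] by (simp add: pt_in_qdom[OF D(1)])
  have "approximates W B y g"
  proof (rule approximates_inverse[OF M _ _ D(7,8) _ y A(2) _ B])
    show "V \<subseteq> M" "W \<subseteq> M" using open_domain_subset D(1,2) by blast+
    show "continuous_on W g" using D(4) by (simp add: C1_def)
    show "A h \<in> M" if "h \<in> M" for h
      using prolong_in_qdom(2)[OF p in_V[OF that]] by (simp add: A_eq[OF that])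
    show "B (A h) = h" if "h \<in> M" for h
      using qm_inverse[OF p in_V[OF that]] D(8)[OF y] by (simp add: A_eq[OF that] B_def prolong_def)
  qed
  then show "\<exists>A. lin_on M A \<and> approximates W A y g" using B by blast
qed

text \<open>The start of the induction on the order: here the inverse map is only known to be continuous,
  and the invertibility of the derivatives is a hypothesis.\<close>

lemma c1_pairI_Strict:
  assumes dom: "open_domain M V" "open_domain M W" and f: "Strict M V f"
    and inv: "\<And>x. x \<in> V \<Longrightarrow> f x \<in> W \<and> g (f x) = x" "\<And>y. y \<in> W \<Longrightarrow> g y \<in> V \<and> f (g y) = y"
    and g: "continuous_on W g"
    and B: "\<And>x A. x \<in> V \<Longrightarrow> lin_on M A \<Longrightarrow> approximates V A x f \<Longrightarrow>
      (\<forall>h\<in>M. A h \<in> M) \<and> (\<exists>B. lin_on M B \<and> (\<forall>h\<in>M. B (A h) = h))"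
  shows "c1_pair M V W f g"
proof -
  have "Strict M W g"
    unfolding Strict_def
  proof
    fix y assume y: "y \<in> W"
    then have gy: "g y \<in> V" using inv by blast
    obtain A where A: "lin_on M A" "approximates V A (g y) f" using f gy unfolding Strict_def by blast
    obtain B where "lin_on M B" "\<forall>h\<in>M. B (A h) = h" and "\<forall>h\<in>M. A h \<in> M"
      using B[OF gy A] by blast
    then show "\<exists>A. lin_on M A \<and> approximates W A y g"
      using approximates_inverse[OF open_domain_space[OF dom(1)] _ _ _ _ g y A(2), of B]
        open_domain_subset dom inv by blast
  qed
  then show ?thesis
    using dom inv Strict_imp_C1[OF dom(1) f] Strict_imp_C1[OF dom(2)] by (simp add: c1_pair_def)
qed

text \<open>The induction on the order.  One step replaces the pair \<open>f, g\<close> by their prolongations,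
  which are again mutually inverse \<open>C\<^sup>1\<close>-maps and one order less smooth.\<close>

lemma iter_prop_inverse:
  assumes P: "stable P" and R: "stable R"
    and PC: "\<And>M U f. open_domain M U \<Longrightarrow> P M U f \<Longrightarrow> C1 M U f"
    and PR: "\<And>M U f. open_domain M U \<Longrightarrow> P M U f \<Longrightarrow> R M U f"
    and inv_P: "\<And>M V W f g. c1_pair M V W f g \<Longrightarrow> P M V f \<Longrightarrow> P M W g"
    and inv_R0: "\<And>M V W f g. c1_pair M V W f g \<Longrightarrow> R M W g"
    and inv_R: "\<And>M V W f g. c1_pair M V W f g \<Longrightarrow> R (next_sp M) (qdom M V) (qm f) \<Longrightarrow>
      R (next_sp M) (qdom M W) (qm g)"
  shows "c1_pair M V W f g \<Longrightarrow> iter_prop P R n M V f \<Longrightarrow> iter_prop P R n M W g"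
proof (induction n arbitrary: M V W f g)
  case 0
  then show ?case using inv_R0 by simp
next
  case (Suc n)
  note p = Suc.prems(1)
  note D = c1_pairD[OF p]
  have Pf: "P M V f" and Rf: "iter_prop P R n (next_sp M) (qdom M V) (qm f)" using Suc.prems(2) by simp_all
  have "iter_prop P R n (next_sp M) (qdom M W) (qm g)"
  proof (cases n)
    case 0
    then show ?thesis using inv_R[OF p] Rf by simp
  next
    case (Suc m)
    have st: "stable (iter_prop P R n)" by (rule stable_iter_prop[OF P R PC])
    have q: "C1 (next_sp M) (qdom M V) (qm f)"
      using Rf PC[OF open_domain_next[OF D(1)]] by (simp add: Suc)
    have "iter_prop P R n M V f" using iter_prop_decrease[OF PR D(1) Suc.prems(2)] .
    then have "iter_prop P R n (next_sp M) (qdom M V) (prolong f)"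
      by (intro stable_prolong[OF st D(1)] Rf)
    then have "iter_prop P R n (next_sp M) (qdom M W) (prolong g)"
      by (rule Suc.IH[OF c1_pair_next[OF p q]])
    then have "iter_prop P R n (next_sp M) (qdom M W) (\<lambda>v. py (prolong g v))"
      by (rule stable_left[OF st open_domain_next[OF D(2)], of "prolong g" py, OF _ blin_py])
    then show ?thesis by (simp add: prolong_def)
  qed
  then show ?case using inv_P[OF p Pf] by simp
qed

abbreviation C1_Lip :: "'w set \<Rightarrow> 'w set \<Rightarrow> ('w \<Rightarrow> 'w) \<Rightarrow> bool"
  where "C1_Lip M U f \<equiv> C1 M U f \<and> Lip M U f"

lemma inverse_Ck:
  assumes "c1_pair M V W f g" "iter_prop C1 (\<lambda>M. continuous_on) n M V f"
  shows "iter_prop C1 (\<lambda>M. continuous_on) n M W g"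
  by (rule iter_prop_inverse[OF stable_C1 stable_continuous _ _ _ _ _ assms])
    (auto simp: c1_pair_def C1_def[of _ _ g for g])

lemma inverse_SCk:
  assumes "c1_pair M V W f g" "iter_prop Strict (\<lambda>M U f. True) n M V f"
  shows "iter_prop Strict (\<lambda>M U f. True) n M W g"
  by (rule iter_prop_inverse[OF stable_Strict stable_True _ _ _ _ _ assms])
    (auto simp: Strict_imp_C1 Strict_inverse)

lemma inverse_LCk:
  assumes "c1_pair M V W f g" "iter_prop (\<lambda>M U f. C1_Lip M U f) Lip n M V f"
  shows "iter_prop (\<lambda>M U f. C1_Lip M U f) Lip n M W g"
  by (rule iter_prop_inverse[OF stable_conj[OF stable_C1 stable_Lip] stable_Lip _ _ _ _ _ assms])
    (auto simp: Lip_quotient_inverse intro: C1_imp_Lip c1_pairD(2,4))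

section \<open>Topological vector spaces as subspaces of a normed space\<close>

text \<open>The space \<open>X\<close> is isomorphic to the subspace \<open>M\<close> by the linear homeomorphism \<open>\<rho>\<close> with inverse
  \<open>\<sigma>\<close>.  A map \<open>f\<close> between two such spaces corresponds to the map \<open>v \<mapsto> \<rho>' (f (\<sigma> v))\<close> between
  the subspaces.\<close>

definition rep :: "('k, 'x) tvs \<Rightarrow> ('x \<Rightarrow> 'w) \<Rightarrow> ('w \<Rightarrow> 'x) \<Rightarrow> 'w set \<Rightarrow> bool"
  where "rep X \<rho> \<sigma> M \<longleftrightarrow> closed_subspace M \<and> homeomorphic_maps (top_of X) (top_of_set M) \<rho> \<sigma> \<and>
    (\<forall>x\<in>carrier_of X. \<forall>y\<in>carrier_of X. add_of X x y \<in> carrier_of X \<and> \<rho> (add_of X x y) = \<rho> x + \<rho> y) \<and>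
    (\<forall>t. \<forall>x\<in>carrier_of X. scale_of X t x \<in> carrier_of X \<and> \<rho> (scale_of X t x) = scl t (\<rho> x))"

lemma repD:
  assumes "rep X \<rho> \<sigma> M"
  shows "closed_subspace M" "continuous_map (top_of X) (top_of_set M) \<rho>"
    "continuous_map (top_of_set M) (top_of X) \<sigma>"
    "\<And>x. x \<in> carrier_of X \<Longrightarrow> \<rho> x \<in> M" "\<And>v. v \<in> M \<Longrightarrow> \<sigma> v \<in> carrier_of X"
    "\<And>x. x \<in> carrier_of X \<Longrightarrow> \<sigma> (\<rho> x) = x" "\<And>v. v \<in> M \<Longrightarrow> \<rho> (\<sigma> v) = v"
    "\<And>x y. x \<in> carrier_of X \<Longrightarrow> y \<in> carrier_of X \<Longrightarrow> add_of X x y \<in> carrier_of X"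
    "\<And>x y. x \<in> carrier_of X \<Longrightarrow> y \<in> carrier_of X \<Longrightarrow> \<rho> (add_of X x y) = \<rho> x + \<rho> y"
    "\<And>t x. x \<in> carrier_of X \<Longrightarrow> scale_of X t x \<in> carrier_of X"
    "\<And>t x. x \<in> carrier_of X \<Longrightarrow> \<rho> (scale_of X t x) = scl t (\<rho> x)"
    "\<And>x y. x \<in> carrier_of X \<Longrightarrow> y \<in> carrier_of X \<Longrightarrow> diff_of X x y \<in> carrier_of X"
    "\<And>x y. x \<in> carrier_of X \<Longrightarrow> y \<in> carrier_of X \<Longrightarrow> \<rho> (diff_of X x y) = \<rho> x - \<rho> y"
proof -
  have hm: "homeomorphic_maps (top_of X) (top_of_set M) \<rho> \<sigma>" using assms by (simp add: rep_def)
  show c1: "continuous_map (top_of X) (top_of_set M) \<rho>" and c2: "continuous_map (top_of_set M) (top_of X) \<sigma>"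
    using hm by (simp_all add: homeomorphic_maps_def)
  show "\<sigma> (\<rho> x) = x" if "x \<in> carrier_of X" for x using hm that by (simp add: homeomorphic_maps_def)
  show "\<rho> (\<sigma> v) = v" if "v \<in> M" for v using hm that by (simp add: homeomorphic_maps_def)
  show "\<rho> x \<in> M" if "x \<in> carrier_of X" for x
    using continuous_map_image_subset_topspace[OF c1] that by auto
  show "\<sigma> v \<in> carrier_of X" if "v \<in> M" for v
    using continuous_map_image_subset_topspace[OF c2] that by auto
  show "closed_subspace M" using assms by (simp add: rep_def)
  show add: "add_of X x y \<in> carrier_of X" "\<rho> (add_of X x y) = \<rho> x + \<rho> y"
    if "x \<in> carrier_of X" "y \<in> carrier_of X" for x y
    using assms that by (simp_all add: rep_def)
  show scale: "scale_of X t x \<in> carrier_of X" "\<rho> (scale_of X t x) = scl t (\<rho> x)"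
    if "x \<in> carrier_of X" for x t
    using assms that by (simp_all add: rep_def)
  show "diff_of X x y \<in> carrier_of X" "\<rho> (diff_of X x y) = \<rho> x - \<rho> y"
    if "x \<in> carrier_of X" "y \<in> carrier_of X" for x y
    using add scale that by (simp_all add: diff_of_def)
qed

lemma rep_inj: "rep X \<rho> \<sigma> M \<Longrightarrow> x \<in> carrier_of X \<Longrightarrow> y \<in> carrier_of X \<Longrightarrow> \<rho> x = \<rho> y \<Longrightarrow> x = y"
  by (metis repD(6))

lemma rep_image_subset:
  assumes "rep X \<rho> \<sigma> M" "W \<subseteq> carrier_of X"
  shows "\<rho> ` W \<subseteq> M"
  using repD(4)[OF assms(1)] assms(2) by blast

lemma rep_openin:
  assumes "rep X \<rho> \<sigma> M" "W \<subseteq> carrier_of X"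
  shows "openin (top_of_set M) (\<rho> ` W) \<longleftrightarrow> openin (top_of X) W"
proof -
  have "homeomorphic_map (top_of X) (top_of_set M) \<rho>"
    using assms(1) unfolding rep_def by (auto intro: homeomorphic_maps_imp_map)
  then show ?thesis using assms(2) by (rule homeomorphic_map_openness)
qed

lemma rep_continuous_to:
  assumes X: "rep X \<rho> \<sigma> M" and Y: "rep Y \<rho>' \<sigma>' N" and W: "W \<subseteq> carrier_of X"
  shows "continuous_to X Y W f \<longleftrightarrow>
    (\<forall>x\<in>W. f x \<in> carrier_of Y) \<and> continuous_on (\<rho> ` W) (\<lambda>v. \<rho>' (f (\<sigma> v)))"
proof
  assume "continuous_to X Y W f"
  then have f: "continuous_map (subtopology (top_of X) W) (top_of Y) f" by (simp add: continuous_to_def)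
  have f_in: "\<forall>x\<in>W. f x \<in> carrier_of Y"
    using f W by (force simp: continuous_map_def topspace_subtopology)
  have "continuous_map (top_of_set (\<rho> ` W)) (subtopology (top_of X) W) \<sigma>"
  proof (rule continuous_map_into_subtopology)
    show "continuous_map (top_of_set (\<rho> ` W)) (top_of X) \<sigma>"
      by (rule continuous_map_from_subtopology_mono[OF repD(3)[OF X] rep_image_subset[OF X W]])
    show "\<sigma> \<in> topspace (top_of_set (\<rho> ` W)) \<rightarrow> W" using repD(6)[OF X] W by auto
  qed
  from continuous_map_compose[OF continuous_map_compose[OF this f] repD(2)[OF Y]]
  have "continuous_map (top_of_set (\<rho> ` W)) (top_of_set N) (\<lambda>v. \<rho>' (f (\<sigma> v)))"
    by (simp add: comp_def)
  then show "(\<forall>x\<in>W. f x \<in> carrier_of Y) \<and> continuous_on (\<rho> ` W) (\<lambda>v. \<rho>' (f (\<sigma> v)))"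
    using f_in by (simp add: continuous_map_in_subtopology)
next
  assume *: "(\<forall>x\<in>W. f x \<in> carrier_of Y) \<and> continuous_on (\<rho> ` W) (\<lambda>v. \<rho>' (f (\<sigma> v)))"
  have "continuous_map (subtopology (top_of X) W) (top_of_set (\<rho> ` W)) \<rho>"
  proof (rule continuous_map_into_subtopology)
    show "continuous_map (subtopology (top_of X) W) euclidean \<rho>"
      using repD(2)[OF X] by (simp add: continuous_map_in_subtopology continuous_map_from_subtopology)
    show "\<rho> \<in> topspace (subtopology (top_of X) W) \<rightarrow> \<rho> ` W" by auto
  qed
  moreover have "continuous_map (top_of_set (\<rho> ` W)) (top_of_set N) (\<lambda>v. \<rho>' (f (\<sigma> v)))"
    using * repD(4)[OF Y] repD(6)[OF X] W by (auto simp: continuous_map_in_subtopology)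
  ultimately have "continuous_map (subtopology (top_of X) W) (top_of Y)
      (\<sigma>' \<circ> ((\<lambda>v. \<rho>' (f (\<sigma> v))) \<circ> \<rho>))"
    using repD(3)[OF Y] by (intro continuous_map_compose)
  then show "continuous_to X Y W f"
    unfolding continuous_to_def
    by (rule continuous_map_eq)
      (use * repD(6)[OF X] repD(6)[OF Y] W in \<open>auto simp: topspace_subtopology\<close>)
qed

subsection \<open>The space of triples\<close>

lemma rep_quot_space:
  assumes X: "rep X \<rho> \<sigma> M"
  shows "rep (quot_space X) (\<lambda>(x, y, t). pt (\<rho> x) (\<rho> y) t) (\<lambda>v. (\<sigma> (px v), \<sigma> (py v), ps v)) (next_sp M)"
  unfolding rep_def
proof (intro conjI)
  note D = repD[OF X]
  let ?P = "prod_topology (top_of X) (prod_topology (top_of X) (euclidean :: 'k topology))"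
  show "closed_subspace (next_sp M)" by (rule closed_subspace_next[OF D(1)])
  have top: "top_of (quot_space X) = ?P" by (simp add: quot_space_def)
  have \<rho>e: "continuous_map (top_of X) euclidean \<rho>" using D(2) by (simp add: continuous_map_in_subtopology)
  show "homeomorphic_maps (top_of (quot_space X)) (top_of_set (next_sp M))
      (\<lambda>(x, y, t). pt (\<rho> x) (\<rho> y) t) (\<lambda>v. (\<sigma> (px v), \<sigma> (py v), ps v))"
    unfolding homeomorphic_maps_def top
  proof (intro conjI ballI)
    have 1: "continuous_map ?P euclidean (\<lambda>p. \<rho> (fst p))"
      and 2: "continuous_map ?P euclidean (\<lambda>p. \<rho> (fst (snd p)))"
      and 3: "continuous_map ?P euclidean (\<lambda>p. snd (snd p))"
    proof -
      show "continuous_map ?P euclidean (\<lambda>p. \<rho> (fst p))"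
        by (rule continuous_map_compose[OF continuous_map_fst \<rho>e, unfolded comp_def])
      show "continuous_map ?P euclidean (\<lambda>p. \<rho> (fst (snd p)))"
        by (rule continuous_map_compose[OF continuous_map_compose[OF continuous_map_snd continuous_map_fst] \<rho>e,
              unfolded comp_def])
      show "continuous_map ?P euclidean (\<lambda>p. snd (snd p))"
        by (rule continuous_map_compose[OF continuous_map_snd continuous_map_snd, unfolded comp_def])
    qed
    have "continuous_map ?P euclidean (\<lambda>p. pt (\<rho> (fst p)) (\<rho> (fst (snd p))) (snd (snd p)))"
      unfolding continuous_map_atin limitin_canonical_iff
    proof
      fix p assume p: "p \<in> topspace ?P"
      show "((\<lambda>p. pt (\<rho> (fst p)) (\<rho> (fst (snd p))) (snd (snd p))) \<longlongrightarrow>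
          pt (\<rho> (fst p)) (\<rho> (fst (snd p))) (snd (snd p))) (atin ?P p)"
        using 1[unfolded continuous_map_atin limitin_canonical_iff, rule_format, OF p]
          2[unfolded continuous_map_atin limitin_canonical_iff, rule_format, OF p]
          3[unfolded continuous_map_atin limitin_canonical_iff, rule_format, OF p]
        by (rule tendsto_pt)
    qed
    moreover have "(\<lambda>(x, y, t). pt (\<rho> x) (\<rho> y) t) \<in> topspace ?P \<rightarrow> next_sp M"
      by (rule funcsetI) (clarsimp simp: D(4))
    ultimately show "continuous_map ?P (top_of_set (next_sp M)) (\<lambda>(x, y, t). pt (\<rho> x) (\<rho> y) t)"
      by (simp add: continuous_map_in_subtopology case_prod_unfold)
    have "px \<in> next_sp M \<rightarrow> M" "py \<in> next_sp M \<rightarrow> M"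
      by (rule funcsetI, simp add: next_sp_def)+
    then have 4: "continuous_map (top_of_set (next_sp M)) (top_of_set M) px"
      and 5: "continuous_map (top_of_set (next_sp M)) (top_of_set M) py"
      using continuous_on_parts by (simp_all add: continuous_map_in_subtopology)
    show "continuous_map (top_of_set (next_sp M)) ?P (\<lambda>v. (\<sigma> (px v), \<sigma> (py v), ps v))"
      unfolding continuous_map_paired
      using continuous_map_compose[OF 4 D(3), unfolded comp_def] continuous_map_compose[OF 5 D(3), unfolded comp_def]
        continuous_on_parts(3)[of "next_sp M"] by simp
  next
    fix p assume "p \<in> topspace ?P"
    then show "(\<lambda>v. (\<sigma> (px v), \<sigma> (py v), ps v)) ((\<lambda>(x, y, t). pt (\<rho> x) (\<rho> y) t) p) = p"
      using D(6) by auto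
  next
    fix v assume "v \<in> topspace (top_of_set (next_sp M))"
    then show "(\<lambda>(x, y, t). pt (\<rho> x) (\<rho> y) t) (\<sigma> (px v), \<sigma> (py v), ps v) = v"
      using D(7) by (simp add: next_sp_def)
  qed
  show "\<forall>x\<in>carrier_of (quot_space X). \<forall>y\<in>carrier_of (quot_space X).
      add_of (quot_space X) x y \<in> carrier_of (quot_space X) \<and>
      (case add_of (quot_space X) x y of (x, y, t) \<Rightarrow> pt (\<rho> x) (\<rho> y) t) =
      (case x of (x, y, t) \<Rightarrow> pt (\<rho> x) (\<rho> y) t) + (case y of (x, y, t) \<Rightarrow> pt (\<rho> x) (\<rho> y) t)"
    using D(8,9) by (auto simp: quot_space_def pt_add)
  show "\<forall>t. \<forall>x\<in>carrier_of (quot_space X). scale_of (quot_space X) t x \<in> carrier_of (quot_space X) \<and>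
      (case scale_of (quot_space X) t x of (x, y, t) \<Rightarrow> pt (\<rho> x) (\<rho> y) t) =
      scl t (case x of (x, y, t) \<Rightarrow> pt (\<rho> x) (\<rho> y) t)"
    using D(10,11) by (auto simp: quot_space_def pt_scale)
qed

lemma rep_quot_dom:
  assumes X: "rep X \<rho> \<sigma> M" and W: "W \<subseteq> carrier_of X"
  shows "quot_dom X W \<subseteq> carrier_of (quot_space X)"
    and "(\<lambda>(x, y, t). pt (\<rho> x) (\<rho> y) t) ` quot_dom X W = qdom M (\<rho> ` W)"
proof -
  note D = repD[OF X]
  show "quot_dom X W \<subseteq> carrier_of (quot_space X)" using W by (auto simp: quot_dom_def quot_space_def)
  show "(\<lambda>(x, y, t). pt (\<rho> x) (\<rho> y) t) ` quot_dom X W = qdom M (\<rho> ` W)"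
  proof (intro equalityI subsetI)
    fix v assume "v \<in> (\<lambda>(x, y, t). pt (\<rho> x) (\<rho> y) t) ` quot_dom X W"
    then obtain x y t where v: "v = pt (\<rho> x) (\<rho> y) t" "x \<in> W" "y \<in> carrier_of X"
      "add_of X x (scale_of X t y) \<in> W" by (auto simp: quot_dom_def)
    have "\<rho> (add_of X x (scale_of X t y)) = \<rho> x + scl t (\<rho> y)" using v W D by (simp add: subsetD)
    then have "\<rho> x + scl t (\<rho> y) \<in> \<rho> ` W" using v(4) by (metis imageI)
    then show "v \<in> qdom M (\<rho> ` W)" using v W D(4) by (auto simp: qdom_def)
  next
    fix v assume "v \<in> qdom M (\<rho> ` W)"
    then obtain x t where v: "v = pt (\<rho> x) (py v) t" "x \<in> W" "py v \<in> M" "\<rho> x + scl t (py v) \<in> \<rho> ` W"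
      by (force elim!: qdom_cases)
    then obtain x' where x': "x' \<in> W" "\<rho> x' = \<rho> x + scl t (py v)" by auto
    have "add_of X x (scale_of X t (\<sigma> (py v))) = x'"
      using v x' W D by (intro rep_inj[OF X]) (auto simp: subsetD)
    then have "(x, \<sigma> (py v), t) \<in> quot_dom X W" using v x' D(5) by (simp add: quot_dom_def)
    moreover have "v = (\<lambda>(x, y, t). pt (\<rho> x) (\<rho> y) t) (x, \<sigma> (py v), t)" using v(1,3) D(7) by simp
    ultimately show "v \<in> (\<lambda>(x, y, t). pt (\<rho> x) (\<rho> y) t) ` quot_dom X W" by (rule rev_image_eqI)
  qed
qed

lemma rep_quotient:
  assumes X: "rep X \<rho> \<sigma> M" and Y: "rep Y \<rho>' \<sigma>' N" and W: "W \<subseteq> carrier_of X"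
    and f: "\<forall>x\<in>W. f x \<in> carrier_of Y" and p: "(x, y, t) \<in> quot_dom X W"
  shows "\<rho>' (scale_of Y (1 / t) (diff_of Y (f (add_of X x (scale_of X t y))) (f x))) =
    dq (\<lambda>v. \<rho>' (f (\<sigma> v))) (\<rho> x) (\<rho> y) t"
    and "scale_of Y (1 / t) (diff_of Y (f (add_of X x (scale_of X t y))) (f x)) \<in> carrier_of Y"
proof -
  note D = repD[OF X] and D' = repD[OF Y]
  have xy: "x \<in> W" "y \<in> carrier_of X" "add_of X x (scale_of X t y) \<in> W" using p by (auto simp: quot_dom_def)
  have "\<rho> (add_of X x (scale_of X t y)) = \<rho> x + scl t (\<rho> y)" using xy W D by (simp add: subsetD)
  then have "\<sigma> (\<rho> x + scl t (\<rho> y)) = add_of X x (scale_of X t y)" using xy W D(6) by (metis subsetD)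
  moreover have "\<sigma> (\<rho> x) = x" using xy W D(6) by blast
  ultimately show "\<rho>' (scale_of Y (1 / t) (diff_of Y (f (add_of X x (scale_of X t y))) (f x))) =
    dq (\<lambda>v. \<rho>' (f (\<sigma> v))) (\<rho> x) (\<rho> y) t"
    using f xy D' by (simp add: dq_def)
  show "scale_of Y (1 / t) (diff_of Y (f (add_of X x (scale_of X t y))) (f x)) \<in> carrier_of Y"
    using f xy D' by simp
qed

text \<open>Any continuous extension of the difference quotients corresponds to \<open>qm\<close>, by uniqueness.\<close>

lemma rep_extends_quot:
  assumes X: "rep X \<rho> \<sigma> M" and Y: "rep Y \<rho>' \<sigma>' N" and W: "W \<subseteq> carrier_of X"
    and dom: "open_domain M (\<rho> ` W)" and f: "\<forall>x\<in>W. f x \<in> carrier_of Y"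
    and cont: "continuous_on (\<rho> ` W) (\<lambda>v. \<rho>' (f (\<sigma> v)))" and g: "extends_quot X Y W f g"
  shows "C1 M (\<rho> ` W) (\<lambda>v. \<rho>' (f (\<sigma> v)))"
    and "(x, y, t) \<in> quot_dom X W \<Longrightarrow> g (x, y, t) \<in> carrier_of Y \<and>
      \<rho>' (g (x, y, t)) = qm (\<lambda>v. \<rho>' (f (\<sigma> v))) (pt (\<rho> x) (\<rho> y) t)"
proof -
  note D = repD[OF X] and D' = repD[OF Y]
  define h where "h = (\<lambda>v. \<rho>' (g (\<sigma> (px v), \<sigma> (py v), ps v)))"
  have g_in: "\<forall>p\<in>quot_dom X W. g p \<in> carrier_of Y" and h: "continuous_on (qdom M (\<rho> ` W)) h"
    using g rep_continuous_to[OF rep_quot_space[OF X] Y rep_quot_dom(1)[OF X W], of g]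
    unfolding extends_quot_def rep_quot_dom(2)[OF X W] h_def by blast+
  have h_at: "h (pt (\<rho> x) (\<rho> y) t) = \<rho>' (g (x, y, t))" if "(x, y, t) \<in> quot_dom X W" for x y t
    using that W D(6) by (auto simp: h_def quot_dom_def)
  have h_eq: "h (pt v w t) = dq (\<lambda>v. \<rho>' (f (\<sigma> v))) v w t"
    if v: "pt v w t \<in> qdom M (\<rho> ` W)" and t: "t \<noteq> 0" for v w t
  proof -
    obtain x y where xy: "v = \<rho> x" "w = \<rho> y" "(x, y, t) \<in> quot_dom X W"
      using v unfolding rep_quot_dom(2)[OF X W, symmetric] by auto
    then have "g (x, y, t) = scale_of Y (1 / t) (diff_of Y (f (add_of X x (scale_of X t y))) (f x))"
      using g t by (simp add: extends_quot_def)
    then show ?thesis using rep_quotient(1)[OF X Y W f xy(3)] h_at[OF xy(3)] xy by simp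
  qed
  show "C1 M (\<rho> ` W) (\<lambda>v. \<rho>' (f (\<sigma> v)))" by (rule C1_I[OF dom cont h h_eq])
  show "g (x, y, t) \<in> carrier_of Y \<and> \<rho>' (g (x, y, t)) = qm (\<lambda>v. \<rho>' (f (\<sigma> v))) (pt (\<rho> x) (\<rho> y) t)"
    if p: "(x, y, t) \<in> quot_dom X W" for x y t
  proof -
    have "pt (\<rho> x) (\<rho> y) t \<in> qdom M (\<rho> ` W)"
      unfolding rep_quot_dom(2)[OF X W, symmetric] using p by force
    then show ?thesis using qm_eqI[OF dom h h_eq] g_in p h_at[OF p] by simp
  qed
qed

lemma rep_C1_map:
  assumes X: "rep X \<rho> \<sigma> M" and Y: "rep Y \<rho>' \<sigma>' N" and W: "W \<subseteq> carrier_of X"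
    and dom: "open_domain M (\<rho> ` W)" and f: "\<forall>x\<in>W. f x \<in> carrier_of Y"
  shows "C1_map X Y W f \<longleftrightarrow> C1 M (\<rho> ` W) (\<lambda>v. \<rho>' (f (\<sigma> v)))"
proof
  assume "C1_map X Y W f"
  then obtain g where "extends_quot X Y W f g" "continuous_to X Y W f" by (auto simp: C1_map_def)
  then show "C1 M (\<rho> ` W) (\<lambda>v. \<rho>' (f (\<sigma> v)))"
    using rep_continuous_to[OF X Y W, of f] by (intro rep_extends_quot(1)[OF X Y W dom f]) auto
next
  note D = repD[OF X] and D' = repD[OF Y]
  let ?f = "\<lambda>v. \<rho>' (f (\<sigma> v))" and ?r = "\<lambda>(x, y, t). pt (\<rho> x) (\<rho> y) t"
  assume C1: "C1 M (\<rho> ` W) ?f"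
  have f': "?f v \<in> N" if "v \<in> \<rho> ` W" for v using that f D(6) D'(4) W by auto
  define g where "g = (\<lambda>p. \<sigma>' (qm ?f (?r p)))"
  have q_in: "qm ?f v \<in> N" if "v \<in> qdom M (\<rho> ` W)" for v using qm_in[OF dom C1 D'(1) f' that] .
  have r_in: "?r p \<in> qdom M (\<rho> ` W)" if "p \<in> quot_dom X W" for p
    unfolding rep_quot_dom(2)[OF X W, symmetric] using that by (rule imageI)
  have "extends_quot X Y W f g"
    unfolding extends_quot_def
  proof (intro conjI allI impI)
    have "\<forall>p\<in>quot_dom X W. g p \<in> carrier_of Y" using q_in r_in D'(5) by (auto simp: g_def)
    moreover have "continuous_on (qdom M (\<rho> ` W)) (\<lambda>v. \<rho>' (g (\<sigma> (px v), \<sigma> (py v), ps v)))"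
    proof -
      have "\<rho>' (g (\<sigma> (px v), \<sigma> (py v), ps v)) = qm ?f v" if v: "v \<in> qdom M (\<rho> ` W)" for v
      proof -
        have "px v \<in> M" "py v \<in> M" "pt (px v) (py v) (ps v) = v" using v by (auto simp: qdom_def next_sp_def)
        then show ?thesis using D(7) D'(7) q_in[OF v] by (simp add: g_def)
      qed
      then show ?thesis using C1 by (simp add: C1_def cong: continuous_on_cong)
    qed
    ultimately show "continuous_to (quot_space X) Y (quot_dom X W) g"
      using rep_continuous_to[OF rep_quot_space[OF X] Y rep_quot_dom(1)[OF X W], of g]
      unfolding rep_quot_dom(2)[OF X W] by blast
    fix x y t assume p: "(x, y, t) \<in> quot_dom X W" and t: "t \<noteq> 0"
    have "g (x, y, t) = \<sigma>' (dq ?f (\<rho> x) (\<rho> y) t)" using t by (simp add: g_def qm_pt)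
    then show "g (x, y, t) = scale_of Y (1 / t) (diff_of Y (f (add_of X x (scale_of X t y))) (f x))"
      using rep_quotient[OF X Y W f p] D'(6) by metis
  qed
  moreover have "continuous_to X Y W f" using C1 f rep_continuous_to[OF X Y W, of f] by (simp add: C1_def)
  ultimately show "C1_map X Y W f" by (auto simp: C1_map_def)
qed

lemma rep_quot_map:
  assumes X: "rep X \<rho> \<sigma> M" and Y: "rep Y \<rho>' \<sigma>' N" and W: "W \<subseteq> carrier_of X"
    and dom: "open_domain M (\<rho> ` W)" and f: "\<forall>x\<in>W. f x \<in> carrier_of Y"
    and C1: "C1_map X Y W f" and p: "(x, y, t) \<in> quot_dom X W"
  shows "quot_map X Y W f (x, y, t) \<in> carrier_of Y \<and>
    \<rho>' (quot_map X Y W f (x, y, t)) = qm (\<lambda>v. \<rho>' (f (\<sigma> v))) (pt (\<rho> x) (\<rho> y) t)"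
proof (rule rep_extends_quot(2)[OF X Y W dom f _ _ p])
  show "continuous_on (\<rho> ` W) (\<lambda>v. \<rho>' (f (\<sigma> v)))"
    using C1[unfolded C1_map_def, THEN conjunct1] rep_continuous_to[OF X Y W, of f] by simp
  show "extends_quot X Y W f (quot_map X Y W f)"
  proof -
    have "\<exists>g. extends_quot X Y W f g" using C1 unfolding C1_map_def by (rule conjunct2)
    then show ?thesis unfolding quot_map_def by (rule someI_ex)
  qed
qed

subsection \<open>Gauges\<close>

text \<open>Upper semicontinuity at zero bounds a gauge on a ball, and homogeneity extends the bound to
  all vectors.\<close>

lemma rep_gauge_bound:
  assumes X: "rep X \<rho> \<sigma> M" and g: "gauge_on X \<gamma>"
  obtains C where "C > 0" "\<And>x. x \<in> carrier_of X \<Longrightarrow> \<gamma> x \<le> C * gnorm (\<rho> x)"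
proof -
  note D = repD[OF X]
  let ?S = "{x \<in> carrier_of X. \<gamma> x < 1}"
  have scale: "\<gamma> (scale_of X t x) = gnorm t * \<gamma> x" if "x \<in> carrier_of X" for t x
    using g that by (simp add: gauge_on_def)
  have z: "\<sigma> 0 \<in> carrier_of X" "\<rho> (\<sigma> 0) = 0" using D(1,5,7) by auto
  have "scale_of X 0 (\<sigma> 0) = \<sigma> 0" using z D(10,11) by (intro rep_inj[OF X]) auto
  then have g0: "\<gamma> (\<sigma> 0) = 0" using scale[OF z(1), of 0] by simp
  have "openin (top_of_set M) (\<rho> ` ?S)"
    using g rep_openin[OF X, of ?S] by (auto simp: gauge_on_def)
  moreover have "0 \<in> \<rho> ` ?S" using z g0 by force
  ultimately obtain r where r: "r > 0" "ball 0 r \<inter> M \<subseteq> \<rho> ` ?S"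
    unfolding openin_contains_ball by blast
  define \<kappa> where "\<kappa> = gnorm (pivot::'k) * r"
  have B: "absorbs M {h \<in> M. gnorm h < r} \<kappa>" unfolding \<kappa>_def by (rule absorbs_ball[OF D(1) r(1)])
  have k: "\<kappa> > 0" using B by (simp add: absorbs_def)
  have "\<gamma> x \<le> 1 / \<kappa> * gnorm (\<rho> x)" if x: "x \<in> carrier_of X" for x
  proof (cases "\<rho> x = 0")
    case True
    then have "x = \<sigma> 0" using D(6)[OF x] by simp
    then show ?thesis using g0 z by simp
  next
    case False
    then obtain t h where th: "h \<in> M" "gnorm h < r" "\<rho> x = scl t h" "gnorm t * \<kappa> \<le> gnorm (\<rho> x)"
      using B D(4)[OF x] unfolding absorbs_def by blast
    have "h \<in> ball 0 r \<inter> M" using th by (simp add: dist_gnorm)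
    then obtain y where y: "h = \<rho> y" "y \<in> carrier_of X" "\<gamma> y < 1" using r(2) by blast
    have "x = scale_of X t y" using x y th D(10,11) by (intro rep_inj[OF X]) auto
    then have "\<gamma> x = gnorm t * \<gamma> y" using scale y by simp
    also have "\<dots> \<le> gnorm t" using y(3) gnorm_ge_0[of t] by (intro mult_left_le) auto
    also have "\<dots> \<le> 1 / \<kappa> * gnorm (\<rho> x)" using th(4) k by (simp add: field_simps)
    finally show ?thesis .
  qed
  then show thesis using k that[of "1 / \<kappa>"] by simp
qed

lemma gauge_on_continuous:
  assumes "continuous_map (top_of X) euclideanreal \<gamma>" "\<And>x. x \<in> carrier_of X \<Longrightarrow> 0 \<le> \<gamma> x"
    and "\<And>t x. x \<in> carrier_of X \<Longrightarrow> \<gamma> (scale_of X t x) = gnorm t * \<gamma> x"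
  shows "gauge_on X \<gamma>"
proof -
  have "openin (top_of X) {x \<in> carrier_of X. \<gamma> x \<in> {..<r}}" for r
    by (rule openin_continuous_map_preimage[OF assms(1)]) simp
  then show ?thesis using assms(2,3) by (simp add: gauge_on_def)
qed

lemma rep_gauge_norm:
  assumes X: "rep X \<rho> \<sigma> M" and "D \<ge> 0"
  shows "gauge_on X (\<lambda>x. D * gnorm (\<rho> x))"
proof (rule gauge_on_continuous)
  have 1: "continuous_map (top_of X) euclidean \<rho>"
    using repD(2)[OF X] by (simp add: continuous_map_in_subtopology)
  have 2: "continuous_map (euclidean :: 'w topology) euclideanreal (\<lambda>v. D * gnorm v)"
    by (auto simp: continuous_on_def intro!: tendsto_intros tendsto_ident_at)
  show "continuous_map (top_of X) euclideanreal (\<lambda>x. D * gnorm (\<rho> x))"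
    using continuous_map_compose[OF 1 2] by (simp add: comp_def)
qed (use assms(2) repD(11)[OF X] in \<open>auto simp: gnorm_scale gnorm_ge_0\<close>)

lemma rep_lipschitz:
  assumes X: "rep X \<rho> \<sigma> M" and Y: "rep Y \<rho>' \<sigma>' N" and W: "W \<subseteq> carrier_of X"
    and f: "\<forall>x\<in>W. f x \<in> carrier_of Y"
  shows "lipschitz_cont X Y W f \<longleftrightarrow> Lip M (\<rho> ` W) (\<lambda>v. \<rho>' (f (\<sigma> v)))"
proof
  note D = repD[OF X] and D' = repD[OF Y]
  have \<sigma>: "\<sigma> (\<rho> x) = x" if "x \<in> W" for x using that W D(6) by blast
  have diff: "\<rho> (diff_of X x y) = \<rho> x - \<rho> y" if "x \<in> W" "y \<in> W" for x y using that W D(13) by blast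
  have diff': "\<rho>' (diff_of Y (f x) (f y)) = \<rho>' (f x) - \<rho>' (f y)" if "x \<in> W" "y \<in> W" for x y
    using that f D'(13) by blast
  {
    assume L: "lipschitz_cont X Y W f"
    show "Lip M (\<rho> ` W) (\<lambda>v. \<rho>' (f (\<sigma> v)))"
      unfolding Lip_def
    proof
      fix v0 assume "v0 \<in> \<rho> ` W"
      then obtain x0 where x0: "v0 = \<rho> x0" "x0 \<in> W" by blast
      have "gauge_on Y (\<lambda>y. 1 * gnorm (\<rho>' y))" by (rule rep_gauge_norm[OF Y]) simp
      then obtain \<eta> \<delta> where \<eta>: "gauge_on X \<eta>" "\<delta> > 0" "\<And>x y. x \<in> W \<Longrightarrow> y \<in> W \<Longrightarrow> \<eta> (diff_of X x x0) < \<delta> \<Longrightarrow>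
          \<eta> (diff_of X y x0) < \<delta> \<Longrightarrow> 1 * gnorm (\<rho>' (diff_of Y (f y) (f x))) \<le> \<eta> (diff_of X y x)"
        using L[unfolded lipschitz_cont_def, rule_format, OF x0(2)] by blast
      obtain C where C: "C > 0" "\<And>x. x \<in> carrier_of X \<Longrightarrow> \<eta> x \<le> C * gnorm (\<rho> x)"
        by (rule rep_gauge_bound[OF X \<eta>(1)]) (rule that)
      have bound: "\<eta> (diff_of X y x) \<le> C * gnorm (\<rho> y - \<rho> x)" if "x \<in> W" "y \<in> W" for x y
        using C(2)[of "diff_of X y x"] D(12)[of y x] diff[of y x] that W by auto
      have near: "\<eta> (diff_of X x x0) < \<delta>" if "x \<in> W" "gnorm (\<rho> x - \<rho> x0) < \<delta> / C" for x
      proof -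
        have "\<eta> (diff_of X x x0) \<le> C * gnorm (\<rho> x - \<rho> x0)" by (rule bound[OF x0(2) that(1)])
        also have "\<dots> < \<delta>" using that(2) C(1) by (simp add: field_simps)
        finally show ?thesis .
      qed
      have "gnorm (\<rho>' (f y) - \<rho>' (f x)) \<le> C * gnorm (\<rho> y - \<rho> x)"
        if "x \<in> W" "y \<in> W" "gnorm (\<rho> x - \<rho> x0) < \<delta> / C" "gnorm (\<rho> y - \<rho> x0) < \<delta> / C" for x y
        using \<eta>(3)[OF that(1,2) near near] that bound[OF that(1,2)] diff'[OF that(2,1)] by simp
      then show "\<exists>L. \<exists>\<delta>>0. \<forall>v\<in>\<rho> ` W. \<forall>w\<in>\<rho> ` W. gnorm (v - v0) < \<delta> \<longrightarrow> gnorm (w - v0) < \<delta> \<longrightarrow>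
          gnorm (\<rho>' (f (\<sigma> w)) - \<rho>' (f (\<sigma> v))) \<le> L * gnorm (w - v)"
        using C(1) \<eta>(2) \<sigma> x0(1) by (intro exI[of _ C] exI[of _ "\<delta> / C"]) simp
    qed
  next
    assume L: "Lip M (\<rho> ` W) (\<lambda>v. \<rho>' (f (\<sigma> v)))"
    show "lipschitz_cont X Y W f"
      unfolding lipschitz_cont_def
    proof (intro ballI allI impI)
      fix x0 \<gamma> assume x0: "x0 \<in> W" and \<gamma>: "gauge_on Y \<gamma>"
      obtain C where C: "C > 0" "\<And>y. y \<in> carrier_of Y \<Longrightarrow> \<gamma> y \<le> C * gnorm (\<rho>' y)"
        by (rule rep_gauge_bound[OF Y \<gamma>]) (rule that)
      obtain L \<delta> where d: "L \<ge> 0" "\<delta> > 0" "\<And>v w. v \<in> \<rho> ` W \<Longrightarrow> w \<in> \<rho> ` W \<Longrightarrow> gnorm (v - \<rho> x0) < \<delta> \<Longrightarrow>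
          gnorm (w - \<rho> x0) < \<delta> \<Longrightarrow> gnorm (\<rho>' (f (\<sigma> w)) - \<rho>' (f (\<sigma> v))) \<le> L * gnorm (w - v)"
        by (rule Lip_at[OF L imageI[OF x0]]) (rule that)
      \<comment> \<open>the summand \<open>1\<close> makes the gauge a positive multiple of the norm, so that it controls the norm\<close>
      define K where "K = C * L + 1"
      have K: "K > 0" using C(1) d(1) by (simp add: K_def add_nonneg_pos)
      have "\<gamma> (diff_of Y (f y) (f x)) \<le> K * gnorm (\<rho> (diff_of X y x))"
        if "x \<in> W" "y \<in> W" "K * gnorm (\<rho> (diff_of X x x0)) < K * \<delta>" "K * gnorm (\<rho> (diff_of X y x0)) < K * \<delta>"
        for x y
      proof -
        have "diff_of Y (f y) (f x) \<in> carrier_of Y" using that f D'(12) by blast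
        then have "\<gamma> (diff_of Y (f y) (f x)) \<le> C * gnorm (\<rho>' (f y) - \<rho>' (f x))"
          using C(2) diff'[OF that(2,1)] by metis
        also have "\<dots> \<le> C * (L * gnorm (\<rho> y - \<rho> x))"
          using d(3)[of "\<rho> x" "\<rho> y"] that K C(1) \<sigma> diff x0 by (intro mult_left_mono) auto
        also have "\<dots> \<le> K * gnorm (\<rho> y - \<rho> x)" using gnorm_ge_0 by (simp add: K_def distrib_right)
        finally show ?thesis using diff that by simp
      qed
      then show "\<exists>\<eta> \<delta>. gauge_on X \<eta> \<and> \<delta> > 0 \<and> (\<forall>x\<in>W. \<forall>y\<in>W. \<eta> (diff_of X x x0) < \<delta> \<longrightarrow>
          \<eta> (diff_of X y x0) < \<delta> \<longrightarrow> \<gamma> (diff_of Y (f y) (f x)) \<le> \<eta> (diff_of X y x))"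
        using rep_gauge_norm[OF X less_imp_le[OF K]] K d(2)
        by (intro exI[of _ "\<lambda>x. K * gnorm (\<rho> x)"] exI[of _ "K * \<delta>"]) simp
    qed
  }
qed

lemma lin_on_continuous:
  assumes "closed_subspace M" "lin_on M A"
  shows "continuous_on M A"
proof (rule Lip_imp_continuous)
  obtain C where C: "C > 0" "\<And>x. x \<in> M \<Longrightarrow> gnorm (A x) \<le> C * gnorm x"
    by (rule lin_on_bound[OF assms(2)]) (rule that)
  have "gnorm (A y - A x) \<le> C * gnorm (y - x)" if "x \<in> M" "y \<in> M" for x y
  proof -
    have d: "y - x \<in> M" using assms(1) that by (intro subspace_ops)
    have "A (y - x + x) = A (y - x) + A x"
      using assms(2)[unfolded lin_on_def, THEN conjunct1, rule_format, OF d that(1)] .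
    then show ?thesis using C(2)[OF d] by simp
  qed
  then show "Lip M M A" unfolding Lip_def by (intro ballI exI[of _ C] exI[of _ 1]) simp
qed

text \<open>For a continuous linear map \<open>A\<close>, the function \<open>x \<mapsto> gnorm (\<rho>' (A x))\<close> is a gauge; the bound on
  gauges is the boundedness of \<open>A\<close>.\<close>

lemma rep_continuous_linear_imp:
  assumes X: "rep X \<rho> \<sigma> M" and Y: "rep Y \<rho>' \<sigma>' N" and A: "continuous_linear X Y A"
  shows "lin_on M (\<lambda>v. \<rho>' (A (\<sigma> v)))" "x \<in> carrier_of X \<Longrightarrow> A x \<in> carrier_of Y"
proof -
  note D = repD[OF X] and D' = repD[OF Y]
  have cont: "continuous_map (top_of X) (top_of Y) A" using A by (simp add: continuous_linear_def)
  show A_in: "A x \<in> carrier_of Y" if "x \<in> carrier_of X" for x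
    using continuous_map_image_subset_topspace[OF cont] that by auto
  have add: "A (add_of X x y) = add_of Y (A x) (A y)" if "x \<in> carrier_of X" "y \<in> carrier_of X" for x y
    using A that by (simp add: continuous_linear_def)
  have scale: "A (scale_of X t x) = scale_of Y t (A x)" if "x \<in> carrier_of X" for t x
    using A that by (simp add: continuous_linear_def)
  have \<sigma>_add: "\<sigma> (v + w) = add_of X (\<sigma> v) (\<sigma> w)" if "v \<in> M" "w \<in> M" for v w
    using that D subspace_ops(2)[OF D(1) that] by (intro rep_inj[OF X]) simp_all
  have \<sigma>_scale: "\<sigma> (scl t v) = scale_of X t (\<sigma> v)" if "v \<in> M" for t v
    using that D subspace_ops(4)[OF D(1) that] by (intro rep_inj[OF X]) simp_all
  have "gauge_on X (\<lambda>x. gnorm (\<rho>' (A x)))"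
  proof (rule gauge_on_continuous)
    have 1: "continuous_map (top_of Y) euclidean \<rho>'"
      using D'(2) by (simp add: continuous_map_in_subtopology)
    have 2: "continuous_map (euclidean :: 'w topology) euclideanreal gnorm"
      by (auto simp: continuous_on_def intro!: tendsto_intros tendsto_ident_at)
    show "continuous_map (top_of X) euclideanreal (\<lambda>x. gnorm (\<rho>' (A x)))"
      using continuous_map_compose[OF continuous_map_compose[OF cont 1] 2] by (simp add: comp_def)
    show "0 \<le> gnorm (\<rho>' (A x))" for x by (rule gnorm_ge_0)
    show "gnorm (\<rho>' (A (scale_of X t x))) = gnorm t * gnorm (\<rho>' (A x))" if "x \<in> carrier_of X" for t x
      using scale[OF that] A_in[OF that] D'(11) by (simp add: gnorm_scale)
  qed
  then obtain C where C: "C > 0" "\<And>x. x \<in> carrier_of X \<Longrightarrow> gnorm (\<rho>' (A x)) \<le> C * gnorm (\<rho> x)"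
    by (rule rep_gauge_bound[OF X]) (rule that)
  have "gnorm (\<rho>' (A (\<sigma> v))) \<le> C * gnorm v" if "v \<in> M" for v
    using C(2)[OF D(5)[OF that]] D(7)[OF that] by simp
  moreover have "\<rho>' (A (\<sigma> (v + w))) = \<rho>' (A (\<sigma> v)) + \<rho>' (A (\<sigma> w))" if "v \<in> M" "w \<in> M" for v w
    using that \<sigma>_add add D(5) A_in D'(9) by simp
  moreover have "\<rho>' (A (\<sigma> (scl t v))) = scl t (\<rho>' (A (\<sigma> v)))" if "v \<in> M" for t v
    using that \<sigma>_scale scale D(5) A_in D'(11) by simp
  ultimately show "lin_on M (\<lambda>v. \<rho>' (A (\<sigma> v)))" unfolding lin_on_def by blast
qed

lemma rep_continuous_linear_from:
  assumes X: "rep X \<rho> \<sigma> M" and Y: "rep Y \<rho>' \<sigma>' N"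
    and B: "lin_on M B" "\<And>v. v \<in> M \<Longrightarrow> B v \<in> N"
  shows "continuous_linear X Y (\<lambda>x. \<sigma>' (B (\<rho> x)))"
proof -
  note D = repD[OF X] and D' = repD[OF Y]
  have "continuous_map (top_of_set M) (top_of_set N) B"
    using lin_on_continuous[OF D(1) B(1)] B(2) by (simp add: continuous_map_in_subtopology)
  from continuous_map_compose[OF continuous_map_compose[OF D(2) this] D'(3)]
  have "continuous_map (top_of X) (top_of Y) (\<lambda>x. \<sigma>' (B (\<rho> x)))" by (simp add: comp_def)
  moreover have "\<sigma>' (B (\<rho> (add_of X x y))) = add_of Y (\<sigma>' (B (\<rho> x))) (\<sigma>' (B (\<rho> y)))"
    if "x \<in> carrier_of X" "y \<in> carrier_of X" for x y
  proof -
    have "B (\<rho> x + \<rho> y) = B (\<rho> x) + B (\<rho> y)" using B(1) D(4) that by (simp add: lin_on_def)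
    moreover have "B (\<rho> x) + B (\<rho> y) \<in> N" using B(2) D(4) D'(1) that by (intro subspace_ops) simp_all
    ultimately show ?thesis using B(2) D(4,9) D' that by (intro rep_inj[OF Y]) simp_all
  qed
  moreover have "\<sigma>' (B (\<rho> (scale_of X t x))) = scale_of Y t (\<sigma>' (B (\<rho> x)))" if "x \<in> carrier_of X" for x t
  proof -
    have "B (scl t (\<rho> x)) = scl t (B (\<rho> x))" using B(1) D(4) that by (simp add: lin_on_def)
    moreover have "scl t (B (\<rho> x)) \<in> N" using B(2) D(4) D'(1) that by (intro subspace_ops) simp_all
    ultimately show ?thesis using B(2) D(4,11) D' that by (intro rep_inj[OF Y]) simp_all
  qed
  ultimately show ?thesis unfolding continuous_linear_def by blast
qed

text \<open>In the direction from right to left, the linear map that approximates the corresponding map on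
  \<open>M\<close> takes its values in \<open>N\<close>: they are limits of difference quotients.\<close>

lemma rep_strictly_diff:
  assumes X: "rep X \<rho> \<sigma> M" and Y: "rep Y \<rho>' \<sigma>' N" and W: "W \<subseteq> carrier_of X"
    and dom: "open_domain M (\<rho> ` W)" and f: "\<forall>x\<in>W. f x \<in> carrier_of Y"
  shows "strictly_diff X Y W f \<longleftrightarrow> Strict M (\<rho> ` W) (\<lambda>v. \<rho>' (f (\<sigma> v)))"
proof
  note D = repD[OF X] and D' = repD[OF Y]
  have \<sigma>: "\<sigma> (\<rho> x) = x" if "x \<in> W" for x using that W D(6) by blast
  have diff: "\<rho> (diff_of X x y) = \<rho> x - \<rho> y" "diff_of X x y \<in> carrier_of X"
    "\<sigma> (\<rho> x - \<rho> y) = diff_of X x y" if "x \<in> W" "y \<in> W" for x y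
  proof -
    have xy: "x \<in> carrier_of X" "y \<in> carrier_of X" using that W by blast+
    show 1: "\<rho> (diff_of X x y) = \<rho> x - \<rho> y" and 2: "diff_of X x y \<in> carrier_of X"
      using xy D(12,13) by simp_all
    show "\<sigma> (\<rho> x - \<rho> y) = diff_of X x y" using D(6)[OF 2] 1 by simp
  qed
  {
    assume S: "strictly_diff X Y W f"
    show "Strict M (\<rho> ` W) (\<lambda>v. \<rho>' (f (\<sigma> v)))"
      unfolding Strict_def
    proof
      fix v assume "v \<in> \<rho> ` W"
      then obtain x where x: "v = \<rho> x" "x \<in> W" by blast
      obtain A where A: "continuous_linear X Y A" and Ag: "\<And>\<gamma>. gauge_on Y \<gamma> \<Longrightarrow> \<exists>\<eta>. gauge_on X \<eta> \<and>
          (\<forall>\<epsilon>>0. \<exists>\<delta>>0. \<forall>y\<in>W. \<forall>z\<in>W. \<eta> (diff_of X z x) < \<delta> \<longrightarrow> \<eta> (diff_of X y x) < \<delta> \<longrightarrow>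
            \<gamma> (diff_of Y (diff_of Y (f z) (f y)) (A (diff_of X z y))) \<le> \<epsilon> * \<eta> (diff_of X z y))"
        using S[unfolded strictly_diff_def, rule_format, OF x(2)] by blast
      note lin = rep_continuous_linear_imp[OF X Y A]
      have "gauge_on Y (\<lambda>y. 1 * gnorm (\<rho>' y))" by (rule rep_gauge_norm[OF Y]) simp
      from Ag[OF this] obtain \<eta> where \<eta>: "gauge_on X \<eta>" and est: "\<And>\<epsilon>. \<epsilon> > 0 \<Longrightarrow>
          \<exists>\<delta>>0. \<forall>y\<in>W. \<forall>z\<in>W. \<eta> (diff_of X z x) < \<delta> \<longrightarrow> \<eta> (diff_of X y x) < \<delta> \<longrightarrow>
            1 * gnorm (\<rho>' (diff_of Y (diff_of Y (f z) (f y)) (A (diff_of X z y)))) \<le> \<epsilon> * \<eta> (diff_of X z y)"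
        by blast
      obtain C where C: "C > 0" "\<And>x. x \<in> carrier_of X \<Longrightarrow> \<eta> x \<le> C * gnorm (\<rho> x)"
        by (rule rep_gauge_bound[OF X \<eta>]) (rule that)
      have bound: "\<eta> (diff_of X z y) \<le> C * gnorm (\<rho> z - \<rho> y)" if "y \<in> W" "z \<in> W" for y z
        using C(2)[OF diff(2)[OF that(2,1)]] diff(1)[OF that(2,1)] by simp
      have "approximates (\<rho> ` W) (\<lambda>v. \<rho>' (A (\<sigma> v))) v (\<lambda>v. \<rho>' (f (\<sigma> v)))"
      proof (rule approximatesI)
        fix \<epsilon> :: real assume e: "\<epsilon> > 0"
        then obtain \<delta> where d: "\<delta> > 0" "\<And>y z. y \<in> W \<Longrightarrow> z \<in> W \<Longrightarrow> \<eta> (diff_of X z x) < \<delta> \<Longrightarrow>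
            \<eta> (diff_of X y x) < \<delta> \<Longrightarrow> 1 * gnorm (\<rho>' (diff_of Y (diff_of Y (f z) (f y)) (A (diff_of X z y))))
            \<le> (\<epsilon> / C) * \<eta> (diff_of X z y)"
          using est[of "\<epsilon> / C"] C(1) by auto
        have near: "\<eta> (diff_of X y x) < \<delta>" if "y \<in> W" "gnorm (\<rho> y - \<rho> x) < \<delta> / C" for y
        proof -
          have "\<eta> (diff_of X y x) \<le> C * gnorm (\<rho> y - \<rho> x)" by (rule bound[OF x(2) that(1)])
          also have "\<dots> < \<delta>" using that(2) C(1) by (simp add: field_simps)
          finally show ?thesis .
        qed
        have "gnorm (\<rho>' (f z) - \<rho>' (f y) - \<rho>' (A (\<sigma> (\<rho> z - \<rho> y)))) \<le> \<epsilon> * gnorm (\<rho> z - \<rho> y)"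
          if yz: "y \<in> W" "z \<in> W" "gnorm (\<rho> z - \<rho> x) < \<delta> / C" "gnorm (\<rho> y - \<rho> x) < \<delta> / C" for y z
        proof -
          have c: "f z \<in> carrier_of Y" "f y \<in> carrier_of Y" "A (diff_of X z y) \<in> carrier_of Y"
            using f lin(2) diff(2) yz by simp_all
          have "gnorm (\<rho>' (f z) - \<rho>' (f y) - \<rho>' (A (\<sigma> (\<rho> z - \<rho> y))))
              = gnorm (\<rho>' (diff_of Y (diff_of Y (f z) (f y)) (A (diff_of X z y))))"
            using c D'(12,13) diff(3)[OF yz(2,1)] by simp
          also have "\<dots> \<le> (\<epsilon> / C) * \<eta> (diff_of X z y)" using d(2)[OF yz(1,2) near near] yz by simp
          also have "\<dots> \<le> (\<epsilon> / C) * (C * gnorm (\<rho> z - \<rho> y))"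
            using e C(1) bound[OF yz(1,2)] by (intro mult_left_mono) simp_all
          finally show ?thesis using C(1) by simp
        qed
        then show "\<exists>\<delta>>0. \<forall>v'\<in>\<rho> ` W. \<forall>w\<in>\<rho> ` W. gnorm (w - v) < \<delta> \<longrightarrow> gnorm (v' - v) < \<delta> \<longrightarrow>
            gnorm (\<rho>' (f (\<sigma> w)) - \<rho>' (f (\<sigma> v')) - \<rho>' (A (\<sigma> (w - v')))) \<le> \<epsilon> * gnorm (w - v')"
          using d(1) C(1) \<sigma> by (intro exI[of _ "\<delta> / C"]) (simp add: x(1))
      qed
      then show "\<exists>A. lin_on M A \<and> approximates (\<rho> ` W) A v (\<lambda>v. \<rho>' (f (\<sigma> v)))" using lin(1) by blast
    qed
  next
    assume S: "Strict M (\<rho> ` W) (\<lambda>v. \<rho>' (f (\<sigma> v)))"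
    show "strictly_diff X Y W f"
      unfolding strictly_diff_def
    proof
      fix x assume x: "x \<in> W"
      obtain B where B: "lin_on M B" "approximates (\<rho> ` W) B (\<rho> x) (\<lambda>v. \<rho>' (f (\<sigma> v)))"
        using S[unfolded Strict_def, rule_format, OF imageI[OF x]] by blast
      have B_in: "B v \<in> N" if v: "v \<in> M" for v
      proof -
        have "closed N" using D'(1) by (simp add: closed_subspace_def)
        moreover have "\<forall>\<^sub>F s in at 0. dq (\<lambda>v. \<rho>' (f (\<sigma> v))) (\<rho> x) v s \<in> N"
          using eventually_pt_in_qdom[OF dom imageI[OF x] v]
        proof eventually_elim
          case (elim s)
          then have "\<rho> x + scl s v \<in> \<rho> ` W" by (simp add: pt_in_qdom[OF dom])
          then obtain z where z: "z \<in> W" "\<rho> x + scl s v = \<rho> z" by blast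
          show ?case
            unfolding dq_def z(2) using f x z(1) \<sigma> D'(4)
            by (intro subspace_ops[OF D'(1)]) simp_all
        qed
        ultimately show ?thesis
          using approximates_tendsto_dq[OF dom B imageI[OF x] v] by (intro Lim_in_closed_set) auto
      qed
      define A where "A = (\<lambda>x. \<sigma>' (B (\<rho> x)))"
      have A: "continuous_linear X Y A" unfolding A_def by (rule rep_continuous_linear_from[OF X Y B(1) B_in])
      have "\<exists>\<eta>. gauge_on X \<eta> \<and> (\<forall>\<epsilon>>0. \<exists>\<delta>>0. \<forall>y\<in>W. \<forall>z\<in>W. \<eta> (diff_of X z x) < \<delta> \<longrightarrow> \<eta> (diff_of X y x) < \<delta> \<longrightarrow>
          \<gamma> (diff_of Y (diff_of Y (f z) (f y)) (A (diff_of X z y))) \<le> \<epsilon> * \<eta> (diff_of X z y))"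
        if \<gamma>: "gauge_on Y \<gamma>" for \<gamma>
      proof -
        obtain C where C: "C > 0" "\<And>y. y \<in> carrier_of Y \<Longrightarrow> \<gamma> y \<le> C * gnorm (\<rho>' y)"
          by (rule rep_gauge_bound[OF Y \<gamma>]) (rule that)
        have "\<exists>\<delta>>0. \<forall>y\<in>W. \<forall>z\<in>W. 1 * gnorm (\<rho> (diff_of X z x)) < \<delta> \<longrightarrow> 1 * gnorm (\<rho> (diff_of X y x)) < \<delta> \<longrightarrow>
          \<gamma> (diff_of Y (diff_of Y (f z) (f y)) (A (diff_of X z y))) \<le> \<epsilon> * (1 * gnorm (\<rho> (diff_of X z y)))"
          if e: "\<epsilon> > 0" for \<epsilon>
        proof -
          obtain \<delta> where d: "\<delta> > 0" "\<And>v w. v \<in> \<rho> ` W \<Longrightarrow> w \<in> \<rho> ` W \<Longrightarrow> gnorm (w - \<rho> x) < \<delta> \<Longrightarrow>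
              gnorm (v - \<rho> x) < \<delta> \<Longrightarrow> gnorm (\<rho>' (f (\<sigma> w)) - \<rho>' (f (\<sigma> v)) - B (w - v)) \<le> \<epsilon> / C * gnorm (w - v)"
            by (rule approximatesE[OF B(2) divide_pos_pos[OF e C(1)]]) (rule that)
          have "\<gamma> (diff_of Y (diff_of Y (f z) (f y)) (A (diff_of X z y))) \<le> \<epsilon> * gnorm (\<rho> (diff_of X z y))"
            if yz: "y \<in> W" "z \<in> W" "gnorm (\<rho> (diff_of X z x)) < \<delta>" "gnorm (\<rho> (diff_of X y x)) < \<delta>" for y z
          proof -
            have M: "\<rho> z - \<rho> y \<in> M" using D(4)[OF diff(2)[OF yz(2,1)]] diff(1)[OF yz(2,1)] by simp
            have c: "f z \<in> carrier_of Y" "f y \<in> carrier_of Y" "A (diff_of X z y) \<in> carrier_of Y"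
              "\<rho>' (A (diff_of X z y)) = B (\<rho> z - \<rho> y)"
              using f yz B_in[OF M] D'(5,7) by (simp_all add: A_def diff(1)[OF yz(2,1)])
            have in_Y: "diff_of Y (diff_of Y (f z) (f y)) (A (diff_of X z y)) \<in> carrier_of Y"
              using c D'(12) by simp
            have "\<rho>' (diff_of Y (diff_of Y (f z) (f y)) (A (diff_of X z y))) = \<rho>' (f z) - \<rho>' (f y) - B (\<rho> z - \<rho> y)"
              using c D'(12,13) by simp
            then have "\<gamma> (diff_of Y (diff_of Y (f z) (f y)) (A (diff_of X z y)))
                \<le> C * gnorm (\<rho>' (f z) - \<rho>' (f y) - B (\<rho> z - \<rho> y))"
              using C(2)[OF in_Y] by simp
            also have "\<dots> \<le> C * (\<epsilon> / C * gnorm (\<rho> z - \<rho> y))"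
              using d(2)[OF imageI[OF yz(1)] imageI[OF yz(2)]] yz \<sigma> diff(1) x C(1)
              by (intro mult_left_mono) simp_all
            finally show ?thesis using C(1) diff(1)[OF yz(2,1)] by simp
          qed
          then show ?thesis using d(1) by (intro exI[of _ \<delta>]) simp
        qed
        then show ?thesis
          using rep_gauge_norm[OF X, of 1] by (intro exI[of _ "\<lambda>x. 1 * gnorm (\<rho> x)"]) simp
      qed
      then show "\<exists>A. continuous_linear X Y A \<and> (\<forall>\<gamma>. gauge_on Y \<gamma> \<longrightarrow> (\<exists>\<eta>. gauge_on X \<eta> \<and>
          (\<forall>\<epsilon>>0. \<exists>\<delta>>0. \<forall>y\<in>W. \<forall>z\<in>W. \<eta> (diff_of X z x) < \<delta> \<longrightarrow> \<eta> (diff_of X y x) < \<delta> \<longrightarrow>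
            \<gamma> (diff_of Y (diff_of Y (f z) (f y)) (A (diff_of X z y))) \<le> \<epsilon> * \<eta> (diff_of X z y))))"
        using A by blast
    qed
  }
qed

subsection \<open>Iteration\<close>

lemma rep_copy_tvs:
  assumes X: "rep X \<rho> \<sigma> M" and d: "\<And>x. d (i x) = x"
  shows "rep (copy_tvs i d X) (\<lambda>a. \<rho> (d a)) (\<lambda>v. i (\<sigma> v)) M"
    and "carrier_of (copy_tvs i d X) = i ` carrier_of X"
proof -
  note D = repD[OF X]
  have top: "top_of (copy_tvs i d X) = pullback_topology (range i) d (top_of X)" by (simp add: copy_tvs_def)
  show carrier: "carrier_of (copy_tvs i d X) = i ` carrier_of X"
    unfolding top topspace_pullback_topology using d by force
  have c1: "continuous_map (top_of (copy_tvs i d X)) (top_of_set M) (\<lambda>a. \<rho> (d a))"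
    unfolding top using continuous_map_pullback[OF D(2), of "range i" d] by (simp add: comp_def)
  have c2: "continuous_map (top_of_set M) (top_of (copy_tvs i d X)) (\<lambda>v. i (\<sigma> v))"
    unfolding top by (rule continuous_map_pullback') (use D(3) d in \<open>auto simp: comp_def\<close>)
  have "homeomorphic_maps (top_of (copy_tvs i d X)) (top_of_set M) (\<lambda>a. \<rho> (d a)) (\<lambda>v. i (\<sigma> v))"
    unfolding homeomorphic_maps_def carrier using c1 c2 D(6,7) d by auto
  then show "rep (copy_tvs i d X) (\<lambda>a. \<rho> (d a)) (\<lambda>v. i (\<sigma> v)) M"
    unfolding rep_def carrier using D d by (auto simp: copy_tvs_def)
qed

text \<open>The isomorphism of the space of triples with \<open>next_sp M\<close>, obtained from an isomorphism of the
  preceding space with \<open>M\<close>.\<close>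

definition node_rep :: "(('x, 'k) iter_point \<Rightarrow> 'w) \<Rightarrow> ('x, 'k) iter_point \<Rightarrow> 'w"
  where "node_rep \<rho> p = (case node_of p of (a, b, t) \<Rightarrow> pt (\<rho> a) (\<rho> b) t)"

definition node_inv :: "('w \<Rightarrow> ('x, 'k) iter_point) \<Rightarrow> 'w \<Rightarrow> ('x, 'k) iter_point"
  where "node_inv \<sigma> v = Node (\<sigma> (px v), \<sigma> (py v), ps v)"

text \<open>The situation in which a map on an iterated space corresponds to a map on a subspace.\<close>

definition valid :: "('k, 'y) tvs \<Rightarrow> ('k, 'x) tvs \<Rightarrow> ('x \<Rightarrow> 'w) \<Rightarrow> ('w \<Rightarrow> 'x) \<Rightarrow> 'w set \<Rightarrow> 'x set \<Rightarrow>
    ('x \<Rightarrow> 'y) \<Rightarrow> bool"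
  where "valid Y S \<rho> \<sigma> M W g \<longleftrightarrow> rep S \<rho> \<sigma> M \<and> W \<subseteq> carrier_of S \<and> open_domain M (\<rho> ` W) \<and>
    (\<forall>x\<in>W. g x \<in> carrier_of Y)"

lemma valid_next:
  assumes v: "valid Y S \<rho> \<sigma> M W g" and Y: "rep Y \<rho>' \<sigma>' N" and C1: "C1_map S Y W g"
  shows "valid Y (next_space S) (node_rep \<rho>) (node_inv \<sigma>) (next_sp M) (next_dom S W) (next_map S Y W g)"
    and "node_rep \<rho> ` next_dom S W = qdom M (\<rho> ` W)"
    and "u \<in> qdom M (\<rho> ` W) \<Longrightarrow>
      \<rho>' (next_map S Y W g (node_inv \<sigma> u)) = qm (\<lambda>v. \<rho>' (g (\<sigma> v))) u"
proof -
  have S: "rep S \<rho> \<sigma> M" and W: "W \<subseteq> carrier_of S" and dom: "open_domain M (\<rho> ` W)"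
    and g: "\<forall>x\<in>W. g x \<in> carrier_of Y" using v by (simp_all add: valid_def)
  note D = repD[OF S]
  have eq: "node_rep \<rho> = (\<lambda>a. (\<lambda>(x, y, t). pt (\<rho> x) (\<rho> y) t) (node_of a))"
    "node_inv \<sigma> = (\<lambda>v. Node (\<sigma> (px v), \<sigma> (py v), ps v))"
    by (simp_all add: node_rep_def[abs_def] node_inv_def[abs_def])
  have rep: "rep (next_space S) (node_rep \<rho>) (node_inv \<sigma>) (next_sp M)"
    unfolding next_space_def eq by (rule rep_copy_tvs(1)[OF rep_quot_space[OF S]]) simp
  show img: "node_rep \<rho> ` next_dom S W = qdom M (\<rho> ` W)"
    unfolding rep_quot_dom(2)[OF S W, symmetric] by (simp add: next_dom_def image_image eq)
  have sub: "next_dom S W \<subseteq> carrier_of (next_space S)"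
    unfolding next_space_def rep_copy_tvs(2)[OF rep_quot_space[OF S], of node_of Node, OF iter_point.sel(2)]
    unfolding next_dom_def using rep_quot_dom(1)[OF S W] by (rule image_mono)
  have vals: "\<forall>p\<in>next_dom S W. next_map S Y W g p \<in> carrier_of Y"
    using rep_quot_map[OF S Y W dom g C1] by (auto simp: next_dom_def next_map_def)
  show "valid Y (next_space S) (node_rep \<rho>) (node_inv \<sigma>) (next_sp M) (next_dom S W) (next_map S Y W g)"
    unfolding valid_def img using rep sub open_domain_next[OF dom] vals by simp
  show "\<rho>' (next_map S Y W g (node_inv \<sigma> u)) = qm (\<lambda>v. \<rho>' (g (\<sigma> v))) u" if u: "u \<in> qdom M (\<rho> ` W)" for u
  proof -
    obtain x y t where p: "(x, y, t) \<in> quot_dom S W" "u = pt (\<rho> x) (\<rho> y) t"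
      using u unfolding rep_quot_dom(2)[OF S W, symmetric] by auto
    have "x \<in> carrier_of S" "y \<in> carrier_of S" using p(1) W by (auto simp: quot_dom_def)
    then have "node_inv \<sigma> u = Node (x, y, t)" using D(6) by (simp add: node_inv_def p(2))
    then show ?thesis using rep_quot_map[OF S Y W dom g C1 p(1)] by (simp add: next_map_def p(2))
  qed
qed

text \<open>The statement that a map is of one of the classes of order \<open>n\<close> enters as \<open>\<Phi> n\<close>, with its
  recursion in \<open>n\<close>.  The three classes are compared with \<open>iter_prop\<close> by this one induction.\<close>

lemma iter_transfer:
  fixes \<Phi> :: "nat \<Rightarrow> ('k, ('x, 'k) iter_point) tvs \<Rightarrow> ('x, 'k) iter_point set \<Rightarrow> (('x, 'k) iter_point \<Rightarrow> 'y) \<Rightarrow> bool"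
  assumes Y: "rep Y \<rho>' \<sigma>' N" and st: "stable P" "stable R"
    and PC: "\<And>M U f. open_domain M U \<Longrightarrow> P M U f \<Longrightarrow> C1 M U f"
    and PD: "\<And>S \<rho> \<sigma> M W g. valid Y S \<rho> \<sigma> M W g \<Longrightarrow> PD S W g \<longleftrightarrow> P M (\<rho> ` W) (\<lambda>v. \<rho>' (g (\<sigma> v)))"
    and \<Phi>0: "\<And>S \<rho> \<sigma> M W g. valid Y S \<rho> \<sigma> M W g \<Longrightarrow> \<Phi> 0 S W g \<longleftrightarrow> R M (\<rho> ` W) (\<lambda>v. \<rho>' (g (\<sigma> v)))"
    and \<Phi>_Suc: "\<And>n S \<rho> \<sigma> M W g. valid Y S \<rho> \<sigma> M W g \<Longrightarrow>
      \<Phi> (Suc n) S W g \<longleftrightarrow> PD S W g \<and> \<Phi> n (next_space S) (next_dom S W) (next_map S Y W g)"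
  shows "valid Y S \<rho> \<sigma> M W g \<Longrightarrow> \<Phi> n S W g \<longleftrightarrow> iter_prop P R n M (\<rho> ` W) (\<lambda>v. \<rho>' (g (\<sigma> v)))"
proof (induction n arbitrary: S \<rho> \<sigma> M W g)
  case 0
  then show ?case using \<Phi>0 by simp
next
  case (Suc n)
  note v = Suc.prems
  have dom: "open_domain M (\<rho> ` W)" using v by (simp add: valid_def)
  show ?case
  proof (cases "PD S W g")
    case False
    then show ?thesis using PD[OF v] \<Phi>_Suc[OF v] by simp
  next
    case True
    then have P: "P M (\<rho> ` W) (\<lambda>v. \<rho>' (g (\<sigma> v)))" using PD[OF v] by simp
    have "C1_map S Y W g"
      using rep_C1_map[of S \<rho> \<sigma> M Y \<rho>' \<sigma>' N W g] v Y PC[OF dom P] by (simp add: valid_def)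
    note nx = valid_next[OF v Y this]
    have "\<Phi> (Suc n) S W g \<longleftrightarrow> \<Phi> n (next_space S) (next_dom S W) (next_map S Y W g)"
      using \<Phi>_Suc[OF v] True by simp
    also have "\<dots> \<longleftrightarrow> iter_prop P R n (next_sp M) (qdom M (\<rho> ` W)) (\<lambda>v. \<rho>' (next_map S Y W g (node_inv \<sigma> v)))"
      using Suc.IH[OF nx(1)] nx(2) by simp
    also have "\<dots> \<longleftrightarrow> iter_prop P R n (next_sp M) (qdom M (\<rho> ` W)) (qm (\<lambda>v. \<rho>' (g (\<sigma> v))))"
    proof
      let ?f = "\<lambda>v. \<rho>' (next_map S Y W g (node_inv \<sigma> v))" and ?q = "qm (\<lambda>v. \<rho>' (g (\<sigma> v)))"
      have st': "stable (iter_prop P R n)" by (rule stable_iter_prop[OF st PC])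
      note c = stable_cong[OF st' open_domain_next[OF dom]]
      have eq: "?f u = ?q u" "?q u = ?f u" if "u \<in> qdom M (\<rho> ` W)" for u using nx(3)[OF that] by simp_all
      show "iter_prop P R n (next_sp M) (qdom M (\<rho> ` W)) ?q"
        if "iter_prop P R n (next_sp M) (qdom M (\<rho> ` W)) ?f"
        by (rule c[of ?f ?q, OF that eq(1)])
      show "iter_prop P R n (next_sp M) (qdom M (\<rho> ` W)) ?f"
        if "iter_prop P R n (next_sp M) (qdom M (\<rho> ` W)) ?q"
        by (rule c[of ?q ?f, OF that eq(2)])
    qed
    finally show ?thesis using P by simp
  qed
qed

text \<open>For \<open>n = 0\<close> the left-hand side does not mention the continuity of the quotient map; it is
  contained in the \<open>C\<^sup>1\<close> condition.\<close>

lemma iter_Ck_Suc: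
  assumes v: "valid Y S \<rho> \<sigma> M W g" and Y: "rep Y \<rho>' \<sigma>' N"
  shows "iter_Ck (Suc n) S Y W g \<longleftrightarrow>
    C1_map S Y W g \<and> iter_Ck n (next_space S) Y (next_dom S W) (next_map S Y W g)"
proof (cases n)
  case 0
  have "continuous_to (next_space S) Y (next_dom S W) (next_map S Y W g)" if C1: "C1_map S Y W g"
  proof -
    note nx = valid_next[OF v Y C1]
    have "C1 M (\<rho> ` W) (\<lambda>v. \<rho>' (g (\<sigma> v)))"
      using rep_C1_map[of S \<rho> \<sigma> M Y \<rho>' \<sigma>' N W g] v Y C1 by (simp add: valid_def)
    then have "continuous_on (qdom M (\<rho> ` W)) (\<lambda>v. \<rho>' (next_map S Y W g (node_inv \<sigma> v)))"
      by (simp add: C1_def nx(3) cong: continuous_on_cong)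
    then show ?thesis
      using rep_continuous_to[of "next_space S" "node_rep \<rho>" "node_inv \<sigma>" "next_sp M" Y \<rho>' \<sigma>' N
          "next_dom S W" "next_map S Y W g"] nx(1,2) Y by (simp add: valid_def)
  qed
  then show ?thesis using 0 by auto
qed (cases n; simp)

lemma transfer_Ck:
  fixes S :: "('k, ('x, 'k) iter_point) tvs" and Y :: "('k, 'y) tvs"
  assumes v: "valid Y S \<rho> \<sigma> M W g" and Y: "rep Y \<rho>' \<sigma>' N"
  shows "iter_Ck n S Y W g \<longleftrightarrow> iter_prop C1 (\<lambda>M. continuous_on) n M (\<rho> ` W) (\<lambda>v. \<rho>' (g (\<sigma> v)))"
proof (rule iter_transfer[OF Y stable_C1 stable_continuous, where \<Phi> = "\<lambda>n S W g. iter_Ck n S Y W g"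
      and PD = "\<lambda>S W g. C1_map S Y W g"])
  fix S :: "('k, ('x, 'k) iter_point) tvs" and \<rho> \<sigma> M W and g :: "('x, 'k) iter_point \<Rightarrow> 'y" and n
  assume v: "valid Y S \<rho> \<sigma> M W g"
  show "C1_map S Y W g = C1 M (\<rho> ` W) (\<lambda>v. \<rho>' (g (\<sigma> v)))"
    using rep_C1_map[of S \<rho> \<sigma> M Y \<rho>' \<sigma>' N W g] v Y by (simp add: valid_def)
  show "iter_Ck 0 S Y W g = continuous_on (\<rho> ` W) (\<lambda>v. \<rho>' (g (\<sigma> v)))"
    using rep_continuous_to[of S \<rho> \<sigma> M Y \<rho>' \<sigma>' N W g] v Y by (simp add: valid_def)
  show "iter_Ck (Suc n) S Y W g \<longleftrightarrow>
      C1_map S Y W g \<and> iter_Ck n (next_space S) Y (next_dom S W) (next_map S Y W g)"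
    by (rule iter_Ck_Suc[OF v Y])
qed (use v in simp_all)

lemma iter_SCk_eq:
  "iter_SCk (Suc n) S Y W g \<longleftrightarrow>
    (\<forall>j<Suc n. strictly_diff (iter_space j S) Y (iter_dom j S W) (iter_map j S Y W g))"
  by (induction n) (auto simp: less_Suc_eq)

lemma transfer_SCk:
  fixes S :: "('k, ('x, 'k) iter_point) tvs" and Y :: "('k, 'y) tvs"
  assumes v: "valid Y S \<rho> \<sigma> M W g" and Y: "rep Y \<rho>' \<sigma>' N"
  shows "iter_SCk (Suc n) S Y W g \<longleftrightarrow> iter_prop Strict (\<lambda>M U f. True) (Suc n) M (\<rho> ` W) (\<lambda>v. \<rho>' (g (\<sigma> v)))"
  unfolding iter_SCk_eq
proof (rule iter_transfer[OF Y stable_Strict stable_True, where n = "Suc n" and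
      \<Phi> = "\<lambda>n S W g. \<forall>j<n. strictly_diff (iter_space j S) Y (iter_dom j S W) (iter_map j S Y W g)"
      and PD = "\<lambda>S W g. strictly_diff S Y W g"])
  fix S :: "('k, ('x, 'k) iter_point) tvs" and \<rho> \<sigma> M W and g :: "('x, 'k) iter_point \<Rightarrow> 'y" and n
  assume v: "valid Y S \<rho> \<sigma> M W g"
  show "strictly_diff S Y W g = Strict M (\<rho> ` W) (\<lambda>v. \<rho>' (g (\<sigma> v)))"
    using rep_strictly_diff[of S \<rho> \<sigma> M Y \<rho>' \<sigma>' N W g] v Y by (simp add: valid_def)
  show "(\<forall>j<Suc n. strictly_diff (iter_space j S) Y (iter_dom j S W) (iter_map j S Y W g)) \<longleftrightarrow>
      strictly_diff S Y W g \<and> (\<forall>j<n. strictly_diff (iter_space j (next_space S)) Y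
        (iter_dom j (next_space S) (next_dom S W)) (iter_map j (next_space S) Y (next_dom S W) (next_map S Y W g)))"
    by (simp add: All_less_Suc2)
qed (use v Strict_imp_C1 in simp_all)

lemma transfer_LCk:
  fixes S :: "('k, ('x, 'k) iter_point) tvs" and Y :: "('k, 'y) tvs"
  assumes v: "valid Y S \<rho> \<sigma> M W g" and Y: "rep Y \<rho>' \<sigma>' N"
  shows "iter_Ck n S Y W g \<and>
      (\<forall>j<Suc n. lipschitz_cont (iter_space j S) Y (iter_dom j S W) (iter_map j S Y W g)) \<longleftrightarrow>
    iter_prop (\<lambda>M U f. C1_Lip M U f) Lip n M (\<rho> ` W) (\<lambda>v. \<rho>' (g (\<sigma> v)))"
proof (rule iter_transfer[OF Y stable_conj[OF stable_C1 stable_Lip] stable_Lip, where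
      \<Phi> = "\<lambda>n S W g. iter_Ck n S Y W g \<and>
        (\<forall>j<Suc n. lipschitz_cont (iter_space j S) Y (iter_dom j S W) (iter_map j S Y W g))"
      and PD = "\<lambda>S W g. C1_map S Y W g \<and> lipschitz_cont S Y W g"])
  fix S :: "('k, ('x, 'k) iter_point) tvs" and \<rho> \<sigma> M W and g :: "('x, 'k) iter_point \<Rightarrow> 'y" and n
  assume v: "valid Y S \<rho> \<sigma> M W g"
  have lip: "lipschitz_cont S Y W g = Lip M (\<rho> ` W) (\<lambda>v. \<rho>' (g (\<sigma> v)))"
    using rep_lipschitz[of S \<rho> \<sigma> M Y \<rho>' \<sigma>' N W g] v Y by (simp add: valid_def)
  show "(C1_map S Y W g \<and> lipschitz_cont S Y W g) = C1_Lip M (\<rho> ` W) (\<lambda>v. \<rho>' (g (\<sigma> v)))"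
    using rep_C1_map[of S \<rho> \<sigma> M Y \<rho>' \<sigma>' N W g] lip v Y by (simp add: valid_def)
  show "(iter_Ck 0 S Y W g \<and> (\<forall>j<Suc 0. lipschitz_cont (iter_space j S) Y (iter_dom j S W) (iter_map j S Y W g)))
      = Lip M (\<rho> ` W) (\<lambda>v. \<rho>' (g (\<sigma> v)))"
    using rep_continuous_to[of S \<rho> \<sigma> M Y \<rho>' \<sigma>' N W g] lip v Y
      Lip_imp_continuous[of M "\<rho> ` W" "\<lambda>v. \<rho>' (g (\<sigma> v))"] by (auto simp: valid_def)
  show "(iter_Ck (Suc n) S Y W g \<and>
      (\<forall>j<Suc (Suc n). lipschitz_cont (iter_space j S) Y (iter_dom j S W) (iter_map j S Y W g))) \<longleftrightarrow>
    (C1_map S Y W g \<and> lipschitz_cont S Y W g) \<and>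
      iter_Ck n (next_space S) Y (next_dom S W) (next_map S Y W g) \<and>
      (\<forall>j<Suc n. lipschitz_cont (iter_space j (next_space S)) Y
        (iter_dom j (next_space S) (next_dom S W)) (iter_map j (next_space S) Y (next_dom S W) (next_map S Y W g)))"
    unfolding iter_Ck_Suc[OF v Y] All_less_Suc2[of "Suc n"] by auto
qed (use v in simp_all)

end

section \<open>A normed space containing all iterated spaces\<close>

text \<open>The domains of the iterated quotient maps lie in \<open>E\<close>, \<open>E \<times> E \<times> K\<close>,
  \<open>(E \<times> E \<times> K) \<times> (E \<times> E \<times> K) \<times> K\<close>, and so on.  An induction over them needs all of them
  inside one normed space.  A point of an iterated space is a finite binary tree with vectors at
  its leaves and scalars at its inner nodes.  Recording at each position of the tree a vector or a
  scalar, and zero elsewhere, makes it a bounded family of pairs indexed by the positions.\<close>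

typedef (overloaded) ('e::normed_group, 'k::normed_group) coords =
  "{h :: bool list \<Rightarrow> 'e \<times> 'k. \<exists>B. \<forall>\<pi>. gnorm (fst (h \<pi>)) \<le> B \<and> gnorm (snd (h \<pi>)) \<le> B}"
  morphisms coord Coords
  by (intro exI[of _ "\<lambda>_. (0, 0)"]) auto

setup_lifting type_definition_coords

lemma coord_bounded:
  "\<exists>B. \<forall>\<pi>. gnorm (fst (coord v \<pi>)) \<le> B \<and> gnorm (snd (coord v \<pi>)) \<le> B"
  using coord[of v] by auto

instantiation coords :: (normed_group, normed_group) ab_group_add
begin

lift_definition zero_coords :: "('a, 'b) coords" is "\<lambda>_. (0, 0)"
  by auto

lift_definition plus_coords :: "('a, 'b) coords \<Rightarrow> ('a, 'b) coords \<Rightarrow> ('a, 'b) coords"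
  is "\<lambda>g h \<pi>. g \<pi> + h \<pi>"
proof -
  fix g h :: "bool list \<Rightarrow> 'a \<times> 'b"
  assume "\<exists>B. \<forall>\<pi>. gnorm (fst (g \<pi>)) \<le> B \<and> gnorm (snd (g \<pi>)) \<le> B"
    and "\<exists>B. \<forall>\<pi>. gnorm (fst (h \<pi>)) \<le> B \<and> gnorm (snd (h \<pi>)) \<le> B"
  then obtain B C where "\<forall>\<pi>. gnorm (fst (g \<pi>)) \<le> B \<and> gnorm (snd (g \<pi>)) \<le> B"
    and "\<forall>\<pi>. gnorm (fst (h \<pi>)) \<le> C \<and> gnorm (snd (h \<pi>)) \<le> C" by blast
  then show "\<exists>B. \<forall>\<pi>. gnorm (fst (g \<pi> + h \<pi>)) \<le> B \<and> gnorm (snd (g \<pi> + h \<pi>)) \<le> B"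
    by (intro exI[of _ "B + C"]) (auto intro!: order_trans[OF gnorm_triangle] add_mono)
qed

lift_definition uminus_coords :: "('a, 'b) coords \<Rightarrow> ('a, 'b) coords" is "\<lambda>h \<pi>. - h \<pi>"
  by simp

definition minus_coords :: "('a, 'b) coords \<Rightarrow> ('a, 'b) coords \<Rightarrow> ('a, 'b) coords"
  where "minus_coords g h = g + - h"

instance
  by standard (unfold minus_coords_def, (transfer; simp add: fun_eq_iff ac_simps zero_prod_def)+)

end

lemma coord_zero [simp]: "coord 0 \<pi> = 0"
  by transfer (simp add: zero_prod_def)
lemma coord_add [simp]: "coord (v + w) \<pi> = coord v \<pi> + coord w \<pi>"
  by transfer simp
lemma coord_uminus [simp]: "coord (- v) \<pi> = - coord v \<pi>"
  by transfer simp
lemma coord_diff [simp]: "coord (v - w) \<pi> = coord v \<pi> - coord w \<pi>"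
  using coord_add[of v "- w" \<pi>] by simp

lemma coords_eqI: "(\<And>\<pi>. coord v \<pi> = coord w \<pi>) \<Longrightarrow> v = w"
  by (simp add: coord_inject[symmetric] fun_eq_iff)

instantiation coords :: (normed_group, normed_group) normed_group
begin

definition gnorm_coords :: "('a, 'b) coords \<Rightarrow> real"
  where "gnorm_coords v = (SUP \<pi>. max (gnorm (fst (coord v \<pi>))) (gnorm (snd (coord v \<pi>))))"

definition dist_coords :: "('a, 'b) coords \<Rightarrow> ('a, 'b) coords \<Rightarrow> real"
  where "dist_coords v w = gnorm (v - w)"

definition uniformity_coords :: "(('a, 'b) coords \<times> ('a, 'b) coords) filter"
  where "uniformity_coords = (INF e\<in>{0<..}. principal {(v, w). dist v w < e})"

definition open_coords :: "('a, 'b) coords set \<Rightarrow> bool"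
  where "open_coords S \<longleftrightarrow> (\<forall>x\<in>S. \<forall>\<^sub>F (x', y) in uniformity. x' = x \<longrightarrow> y \<in> S)"

lemma gnorm_coords_le:
  fixes v :: "('a, 'b) coords"
  assumes "\<And>\<pi>. gnorm (fst (coord v \<pi>)) \<le> B" "\<And>\<pi>. gnorm (snd (coord v \<pi>)) \<le> B"
  shows "gnorm v \<le> B"
  unfolding gnorm_coords_def by (rule cSUP_least) (use assms in auto)

lemma gnorm_coord_le:
  fixes v :: "('a, 'b) coords"
  shows "gnorm (fst (coord v \<pi>)) \<le> gnorm v" "gnorm (snd (coord v \<pi>)) \<le> gnorm v"
proof -
  obtain B where "\<forall>\<pi>. gnorm (fst (coord v \<pi>)) \<le> B \<and> gnorm (snd (coord v \<pi>)) \<le> B"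
    using coord_bounded[of v] by blast
  then have "bdd_above (range (\<lambda>\<pi>. max (gnorm (fst (coord v \<pi>))) (gnorm (snd (coord v \<pi>)))))"
    by (intro bdd_aboveI2[where M = B]) auto
  then have "max (gnorm (fst (coord v \<pi>))) (gnorm (snd (coord v \<pi>))) \<le> gnorm v"
    unfolding gnorm_coords_def by (intro cSUP_upper) auto
  then show "gnorm (fst (coord v \<pi>)) \<le> gnorm v" "gnorm (snd (coord v \<pi>)) \<le> gnorm v" by auto
qed

instance
proof
  fix x y z :: "('a, 'b) coords"
  show "dist x y = gnorm (x - y)" by (rule dist_coords_def)
  show "(dist x y = 0) = (x = y)"
  proof
    assume "dist x y = 0"
    then have "gnorm (x - y) = 0" by (simp add: dist_coords_def)
    then have "coord (x - y) \<pi> = 0" for \<pi>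
      using gnorm_coord_le[of "x - y" \<pi>] gnorm_ge_0[of "fst (coord (x - y) \<pi>)"]
        gnorm_ge_0[of "snd (coord (x - y) \<pi>)"]
      by (intro prod_eqI) (metis gnorm_eq_0_iff order_antisym fst_zero snd_zero)+
    then show "x = y" by (intro coords_eqI) simp
  next
    assume "x = y"
    then show "dist x y = 0" by (simp add: dist_coords_def gnorm_coords_def)
  qed
  show "dist x y \<le> dist x z + dist y z"
    unfolding dist_coords_def
  proof (rule gnorm_coords_le)
    fix \<pi>
    show "gnorm (fst (coord (x - y) \<pi>)) \<le> gnorm (x - z) + gnorm (y - z)"
      using gnorm_coord_le(1)[of "x - z" \<pi>] gnorm_coord_le(1)[of "y - z" \<pi>]
        gnorm_diff_le[of "fst (coord (x - z) \<pi>)" "fst (coord (y - z) \<pi>)"] by simp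
    show "gnorm (snd (coord (x - y) \<pi>)) \<le> gnorm (x - z) + gnorm (y - z)"
      using gnorm_coord_le(2)[of "x - z" \<pi>] gnorm_coord_le(2)[of "y - z" \<pi>]
        gnorm_diff_le[of "snd (coord (x - z) \<pi>)" "snd (coord (y - z) \<pi>)"] by simp
  qed
qed (fact uniformity_coords_def open_coords_def)+

end

text \<open>Without \<open>gnorm (scl t x) = gnorm t * gnorm x\<close> the scaled family might be unbounded; the value
  is then zero by default.\<close>

lift_definition coords_scale ::
  "('k::valued_field \<Rightarrow> 'e::normed_group \<Rightarrow> 'e) \<Rightarrow> 'k \<Rightarrow> ('e, 'k) coords \<Rightarrow> ('e, 'k) coords"
  is "\<lambda>scl t h. if normed_space scl then (\<lambda>\<pi>. (scl t (fst (h \<pi>)), t * snd (h \<pi>))) else (\<lambda>_. 0)"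
proof -
  fix scl :: "'k \<Rightarrow> 'e \<Rightarrow> 'e" and t :: 'k and h :: "bool list \<Rightarrow> 'e \<times> 'k"
  assume "\<exists>B. \<forall>\<pi>. gnorm (fst (h \<pi>)) \<le> B \<and> gnorm (snd (h \<pi>)) \<le> B"
  then obtain B where "\<forall>\<pi>. gnorm (fst (h \<pi>)) \<le> B \<and> gnorm (snd (h \<pi>)) \<le> B" by blast
  then show "\<exists>B. \<forall>\<pi>. gnorm (fst ((if normed_space scl
      then (\<lambda>\<pi>. (scl t (fst (h \<pi>)), t * snd (h \<pi>))) else (\<lambda>_. 0)) \<pi>)) \<le> B \<and>
    gnorm (snd ((if normed_space scl
      then (\<lambda>\<pi>. (scl t (fst (h \<pi>)), t * snd (h \<pi>))) else (\<lambda>_. 0)) \<pi>)) \<le> B"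
    by (intro exI[of _ "if normed_space scl then gnorm t * B else 0"])
      (auto simp: normed_space.gnorm_scale abs_value_mult gnorm_ge_0 intro!: mult_left_mono)
qed

text \<open>The triple \<open>(v, w, t)\<close> as a family of coordinates: the families \<open>v\<close> and \<open>w\<close> are placed at
  the positions starting with \<^term>\<open>True\<close> and \<^term>\<open>False\<close>, and \<open>t\<close> at the empty position.\<close>

lift_definition triple ::
  "('e::normed_group, 'k::normed_group) coords \<Rightarrow> ('e, 'k) coords \<Rightarrow> 'k \<Rightarrow> ('e, 'k) coords"
  is "\<lambda>v w t \<pi>. case \<pi> of [] \<Rightarrow> (0, t) | b # \<pi>' \<Rightarrow> if b then v \<pi>' else w \<pi>'"
proof -
  fix v w :: "bool list \<Rightarrow> 'e \<times> 'k" and t :: 'k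
  assume "\<exists>B. \<forall>\<pi>. gnorm (fst (v \<pi>)) \<le> B \<and> gnorm (snd (v \<pi>)) \<le> B"
    and "\<exists>B. \<forall>\<pi>. gnorm (fst (w \<pi>)) \<le> B \<and> gnorm (snd (w \<pi>)) \<le> B"
  then obtain B C where "\<forall>\<pi>. gnorm (fst (v \<pi>)) \<le> B \<and> gnorm (snd (v \<pi>)) \<le> B"
    and "\<forall>\<pi>. gnorm (fst (w \<pi>)) \<le> C \<and> gnorm (snd (w \<pi>)) \<le> C" by blast
  then show "\<exists>B. \<forall>\<pi>.
      gnorm (fst (case \<pi> of [] \<Rightarrow> (0, t) | b # \<pi>' \<Rightarrow> if b then v \<pi>' else w \<pi>')) \<le> B \<and>
      gnorm (snd (case \<pi> of [] \<Rightarrow> (0, t) | b # \<pi>' \<Rightarrow> if b then v \<pi>' else w \<pi>')) \<le> B"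
    using gnorm_ge_0[of t]
    by (intro exI[of _ "max (gnorm t) (max B C)"])
      (auto split: list.split simp: le_max_iff_disj gnorm_ge_0)
qed

lift_definition fst_part :: "('e::normed_group, 'k::normed_group) coords \<Rightarrow> ('e, 'k) coords"
  is "\<lambda>v \<pi>. v (True # \<pi>)"
  by blast

lift_definition snd_part :: "('e::normed_group, 'k::normed_group) coords \<Rightarrow> ('e, 'k) coords"
  is "\<lambda>v \<pi>. v (False # \<pi>)"
  by blast

lift_definition scalar_part :: "('e::normed_group, 'k::normed_group) coords \<Rightarrow> 'k"
  is "\<lambda>v. snd (v [])" .

text \<open>The embedding of \<open>E\<close>: the tree consisting of one leaf.\<close>

lift_definition base_vec :: "'e \<Rightarrow> ('e::normed_group, 'k::normed_group) coords"
  is "\<lambda>x \<pi>. if \<pi> = [] then (x, 0) else 0"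
proof -
  fix x :: 'e
  show "\<exists>B. \<forall>\<pi>. gnorm (fst (if \<pi> = [] then (x, 0::'k) else 0)) \<le> B \<and>
      gnorm (snd (if \<pi> = [] then (x, 0::'k) else 0)) \<le> B"
    by (intro exI[of _ "gnorm x"]) (auto simp: gnorm_ge_0)
qed

lift_definition base_part :: "('e::normed_group, 'k::normed_group) coords \<Rightarrow> 'e"
  is "\<lambda>v. fst (v [])" .

lemma coord_triple:
  "coord (triple v w t) \<pi> = (case \<pi> of [] \<Rightarrow> (0, t) | b # \<pi>' \<Rightarrow> if b then coord v \<pi>' else coord w \<pi>')"
  by transfer simp

lemma coord_part [simp]:
  "coord (fst_part v) \<pi> = coord v (True # \<pi>)" "coord (snd_part v) \<pi> = coord v (False # \<pi>)"
  by (transfer, simp)+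

lemma coord_base_vec: "coord (base_vec x) \<pi> = (if \<pi> = [] then (x, 0) else 0)"
  by transfer simp

lemma coord_coords_scale:
  "normed_space scl \<Longrightarrow> coord (coords_scale scl t v) \<pi> = (scl t (fst (coord v \<pi>)), t * snd (coord v \<pi>))"
  by transfer simp

lemma coord_scalar_part: "scalar_part v = snd (coord v [])"
  by transfer simp

lemma coord_base_part: "base_part v = fst (coord v [])"
  by transfer simp

lemma coords_triple_space:
  assumes "normed_space scl"
  shows "triple_space (coords_scale scl) triple fst_part snd_part scalar_part"
proof -
  interpret normed_space scl by fact
  note c = coord_coords_scale[OF assms]
  have le: "gnorm (coords_scale scl t v) \<le> gnorm t * gnorm v" for t v
    by (rule gnorm_coords_le)
      (auto simp: c gnorm_scale abs_value_mult gnorm_ge_0 intro!: mult_left_mono gnorm_coord_le)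
  have inv: "coords_scale scl (1 / t) (coords_scale scl t v) = v" if "t \<noteq> 0" for t v
    by (rule coords_eqI) (simp add: c that)
  have zero: "coords_scale scl 0 v = 0" for v
    by (rule coords_eqI) (simp add: c zero_prod_def)
  show ?thesis
  proof (unfold_locales, goal_cases)
    case (5 t v)
    show ?case
    proof (cases "t = 0")
      case False
      have "gnorm v \<le> gnorm (1 / t) * gnorm (coords_scale scl t v)"
        using le[of "1 / t" "coords_scale scl t v"] by (simp add: inv[OF False])
      moreover have "gnorm t > 0" using False by simp
      ultimately have "gnorm t * gnorm v \<le> gnorm (coords_scale scl t v)"
        by (simp add: gnorm_inverse field_simps)
      then show ?thesis using le[of t v] by simp
    qed (simp add: zero)
  next
    case (17 v)
    show ?case by (rule gnorm_coords_le) (simp_all add: gnorm_coord_le)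
  next
    case (18 v)
    show ?case by (rule gnorm_coords_le) (simp_all add: gnorm_coord_le)
  next
    case (19 v)
    show ?case by (simp add: coord_scalar_part gnorm_coord_le)
  next
    case (20 v w t)
    have nn: "0 \<le> gnorm v" "0 \<le> gnorm w" "0 \<le> gnorm t" by (rule gnorm_ge_0)+
    have "gnorm (fst (coord v \<pi>)) \<le> gnorm v" "gnorm (snd (coord v \<pi>)) \<le> gnorm v"
      "gnorm (fst (coord w \<pi>)) \<le> gnorm w" "gnorm (snd (coord w \<pi>)) \<le> gnorm w" for \<pi>
      by (rule gnorm_coord_le)+
    then have b: "gnorm (fst (coord v \<pi>)) \<le> gnorm v + gnorm w + gnorm t"
      "gnorm (snd (coord v \<pi>)) \<le> gnorm v + gnorm w + gnorm t"
      "gnorm (fst (coord w \<pi>)) \<le> gnorm v + gnorm w + gnorm t"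
      "gnorm (snd (coord w \<pi>)) \<le> gnorm v + gnorm w + gnorm t" for \<pi>
      using nn by (smt (verit))+
    show ?case
      by (rule gnorm_coords_le) (use nn b in \<open>auto simp: coord_triple split: list.split\<close>)
  qed (rule coords_eqI, simp add: c coord_triple coord_scalar_part algebra_simps prod_eq_iff split: list.split;
      fail | simp add: c coord_triple coord_scalar_part algebra_simps)+
qed

lemma coord_base: "base_part (base_vec x) = x"
  by (simp add: coord_base_part coord_base_vec)

lemma base_vec_add: "base_vec (x + y) = base_vec x + base_vec y"
  by (rule coords_eqI) (simp add: coord_base_vec)

lemma base_vec_scale:
  assumes "normed_space scl"
  shows "base_vec (scl t x) = coords_scale scl t (base_vec x)"
proof -
  interpret normed_space scl by fact
  show ?thesis by (rule coords_eqI) (simp add: coord_base_vec coord_coords_scale[OF assms] zero_prod_def)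
qed

lemma base_vec_diff: "base_vec (x - y) = base_vec x - base_vec y"
  by (rule coords_eqI) (simp add: coord_base_vec)

lemma base_vec_zero: "base_vec 0 = 0"
  by (rule coords_eqI) (simp add: coord_base_vec zero_prod_def)

lemma base_vec_eq_iff: "base_vec x = base_vec y \<longleftrightarrow> x = y"
  using coord_base by metis

lemma gnorm_base_vec: "gnorm (base_vec x :: ('e::normed_group, 'k::normed_group) coords) = gnorm x"
proof (rule order_antisym)
  show "gnorm (base_vec x :: ('e, 'k) coords) \<le> gnorm x"
    by (rule gnorm_coords_le) (simp_all add: coord_base_vec gnorm_ge_0)
  show "gnorm x \<le> gnorm (base_vec x :: ('e, 'k) coords)"
    using gnorm_coord_le(1)[of "base_vec x :: ('e, 'k) coords" "[]"] by (simp add: coord_base_vec)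
qed

lemma gnorm_base_part_diff: "gnorm (base_part v - base_part w) \<le> gnorm (v - w)"
  using gnorm_coord_le(1)[of "v - w" "[]"] by (simp add: coord_base_part)

lemma tendsto_base_vec: "(f \<longlongrightarrow> x) F \<Longrightarrow> ((\<lambda>a. base_vec (f a)) \<longlongrightarrow> base_vec x) F"
  unfolding tendsto_iff_gnorm[of _ "base_vec x"] base_vec_diff[symmetric] gnorm_base_vec
  by (simp flip: tendsto_iff_gnorm)

lemma tendsto_base_part: "(f \<longlongrightarrow> v) F \<Longrightarrow> ((\<lambda>a. base_part (f a)) \<longlongrightarrow> base_part v) F"
  by (rule tendsto_gnorm_squeeze[where h = "\<lambda>a. gnorm (f a - v)"])
    (simp_all add: gnorm_base_part_diff flip: tendsto_iff_gnorm)

lemma continuous_on_base: "continuous_on S base_vec" "continuous_on T base_part"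
  by (auto simp: continuous_on_def intro!: tendsto_base_vec tendsto_base_part tendsto_ident_at)

sublocale banach_over \<subseteq> E: normed_space scl
  by (rule normed_space)

sublocale banach_over \<subseteq> w: triple_space "coords_scale scl" triple fst_part snd_part scalar_part
  by (rule coords_triple_space[OF normed_space])

context banach_over
begin

abbreviation E :: "('k, 'e) tvs" where "E \<equiv> normed_tvs scl"

abbreviation base_sp :: "('e, 'k) coords set" where "base_sp \<equiv> range base_vec"

text \<open>A map on \<open>E\<close> as a map on the copy \<open>base_sp\<close> of \<open>E\<close>.\<close>

definition emb :: "('e \<Rightarrow> 'e) \<Rightarrow> ('e, 'k) coords \<Rightarrow> ('e, 'k) coords"
  where "emb f v = base_vec (f (base_part v))"

lemma emb_base_vec [simp]: "emb f (base_vec x) = base_vec (f x)"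
  by (simp add: emb_def coord_base)

lemma carrier_E [simp]: "carrier_of E = UNIV"
  by (simp add: normed_tvs_def)

lemma closed_subspace_base: "w.closed_subspace base_sp"
  unfolding w.closed_subspace_def
proof
  show "w.subspace base_sp"
  proof (rule w.subspaceI)
    show "0 \<in> base_sp" using base_vec_zero by (metis rangeI)
    show "v + u \<in> base_sp" if "v \<in> base_sp" "u \<in> base_sp" for u v
      using that by (auto simp flip: base_vec_add)
    show "coords_scale scl t v \<in> base_sp" if "v \<in> base_sp" for v t
      using that by (auto simp flip: base_vec_scale[OF normed_space])
  qed
  have "base_sp = {v. base_vec (base_part v) = v}"
    by (auto simp: coord_base) (metis rangeI)
  moreover have "closed {v::('e, 'k) coords. base_vec (base_part v) = v}"
    by (rule closed_Collect_eq)
      (auto simp: continuous_on_def intro!: tendsto_base_vec tendsto_base_part tendsto_ident_at)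
  ultimately show "closed base_sp" by simp
qed

lemma rep_E: "w.rep E base_vec base_part base_sp"
  unfolding w.rep_def
proof (intro conjI)
  show "w.closed_subspace base_sp" by (rule closed_subspace_base)
  show "homeomorphic_maps (top_of E) (top_of_set base_sp) base_vec base_part"
    unfolding homeomorphic_maps_def normed_tvs_def
    using continuous_on_base by (auto simp: coord_base continuous_map_in_subtopology)
qed (simp_all add: normed_tvs_def base_vec_add base_vec_scale[OF normed_space])

lemma open_domain_base: "open V \<Longrightarrow> w.open_domain base_sp (base_vec ` V)"
  using w.rep_openin[OF rep_E, of V] closed_subspace_base
  by (simp add: w.open_domain_def normed_tvs_def)

text \<open>Both the space \<open>E\<close> and its copy \<open>base_space E\<close>, from which the iteration starts, correspond
  to \<open>base_sp\<close>, and \<open>f\<close> and \<open>base_map f\<close> correspond to the same map.\<close>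

lemma valid_base:
  assumes "open V"
  shows "w.valid E (base_space E) (\<lambda>a. base_vec (base_of a)) (\<lambda>v. Base (base_part v)) base_sp
    (base_dom V) (base_map f)"
    and "(\<lambda>a. base_vec (base_of a)) ` base_dom V = base_vec ` V"
    and "(\<lambda>v. base_vec (base_map f (Base (base_part v)))) = emb f"
proof -
  show img: "(\<lambda>a. base_vec (base_of a)) ` base_dom V = base_vec ` V"
    by (simp add: base_dom_def image_image)
  show "w.valid E (base_space E) (\<lambda>a. base_vec (base_of a)) (\<lambda>v. Base (base_part v)) base_sp
    (base_dom V) (base_map f)"
    unfolding w.valid_def img base_space_def
    using w.rep_copy_tvs[OF rep_E, of base_of Base] open_domain_base[OF assms]
    by (auto simp: base_dom_def)
  show "(\<lambda>v. base_vec (base_map f (Base (base_part v)))) = emb f"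
    by (simp add: base_map_def emb_def fun_eq_iff)
qed

text \<open>The finite orders that a possibly infinite order stands for.\<close>

definition order_of :: "enat \<Rightarrow> nat \<Rightarrow> bool"
  where "order_of k n \<longleftrightarrow> k = enat n \<or> k = \<infinity>"

lemma Ck_map_iff:
  assumes "open V"
  shows "Ck_map k E E V f \<longleftrightarrow>
    (\<forall>n. order_of k n \<longrightarrow> w.iter_prop w.C1 (\<lambda>M. continuous_on) n base_sp (base_vec ` V) (emb f))"
  by (cases k) (simp_all add: Ck_map_def order_of_def w.transfer_Ck[OF valid_base(1)[OF assms] rep_E]
      valid_base(2,3)[OF assms])

lemma SCk_map_iff:
  assumes "open V" "k \<ge> 1"
  shows "SCk_map k E E V f \<longleftrightarrow> (k = \<infinity> \<longrightarrow> continuous_on (base_vec ` V) (emb f)) \<and>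
    (\<forall>n. order_of k (Suc n) \<longrightarrow> w.iter_prop w.Strict (\<lambda>M U f. True) (Suc n) base_sp (base_vec ` V) (emb f))"
proof -
  have S: "iter_SCk (Suc n) (base_space E) E (base_dom V) (base_map f) \<longleftrightarrow>
      w.iter_prop w.Strict (\<lambda>M U f. True) (Suc n) base_sp (base_vec ` V) (emb f)" for n
    unfolding w.transfer_SCk[OF valid_base(1)[OF assms(1)] rep_E] valid_base(2,3)[OF assms(1)] ..
  have Z: "iter_SCk 0 (base_space E) E (base_dom V) (base_map f) \<longleftrightarrow> continuous_on (base_vec ` V) (emb f)"
    using w.transfer_Ck[OF valid_base(1)[OF assms(1)] rep_E, of 0 f, unfolded valid_base(2,3)[OF assms(1)]] by simp
  show ?thesis
  proof (cases k)
    case (enat n)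
    then obtain m where m: "n = Suc m" using assms(2) by (cases n) (auto simp: one_enat_def)
    show ?thesis using S unfolding SCk_map_def order_of_def enat m by simp
  next
    case infinity
    have "(\<forall>n. iter_SCk n (base_space E) E (base_dom V) (base_map f)) \<longleftrightarrow>
        iter_SCk 0 (base_space E) E (base_dom V) (base_map f) \<and>
        (\<forall>n. iter_SCk (Suc n) (base_space E) E (base_dom V) (base_map f))"
      by (metis not0_implies_Suc)
    then show ?thesis using S Z by (simp only: SCk_map_def order_of_def infinity enat.case simp_thms)
  qed
qed

lemma LCk_map_iff:
  assumes "open V"
  shows "LCk_map k E E V f \<longleftrightarrow>
    (\<forall>n. order_of k n \<longrightarrow> w.iter_prop (\<lambda>M U f. w.C1 M U f \<and> w.Lip M U f) w.Lip n base_sp (base_vec ` V) (emb f))"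
proof -
  have S: "w.iter_prop (\<lambda>M U f. w.C1 M U f \<and> w.Lip M U f) w.Lip n base_sp (base_vec ` V) (emb f) \<longleftrightarrow>
      iter_Ck n (base_space E) E (base_dom V) (base_map f) \<and>
      (\<forall>j<Suc n. lipschitz_cont (iter_space j (base_space E)) E (iter_dom j (base_space E) (base_dom V))
        (iter_map j (base_space E) E (base_dom V) (base_map f)))" for n
    unfolding w.transfer_LCk[OF valid_base(1)[OF assms] rep_E] valid_base(2,3)[OF assms] ..
  show ?thesis
    unfolding S by (cases k) (auto simp: LCk_map_def Ck_map_def order_of_def less_Suc_eq_le)
qed

section \<open>Existence of the local inverse\<close>

definition linear_iso :: "('e \<Rightarrow> 'e) \<Rightarrow> ('e \<Rightarrow> 'e) \<Rightarrow> real \<Rightarrow> bool"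
  where "linear_iso A B c \<longleftrightarrow> (\<forall>u v. A (u + v) = A u + A v) \<and> (\<forall>t v. A (scl t v) = scl t (A v)) \<and>
    (\<forall>v. B (A v) = v) \<and> (\<forall>v. A (B v) = v) \<and> c > 0 \<and> (\<forall>v. gnorm (B v) \<le> c * gnorm v)"

lemma linear_isoD:
  assumes "linear_iso A B c"
  shows "A (u + v) = A u + A v" "A (u - v) = A u - A v" "A (scl t v) = scl t (A v)" "B (A v) = v" "A (B v) = v" "c > 0"
    "gnorm (B v) \<le> c * gnorm v" "B (u + v) = B u + B v" "B (u - v) = B u - B v" "B (scl t v) = scl t (B v)"
proof -
  show A: "A (u + v) = A u + A v" "A (scl t v) = scl t (A v)" "B (A v) = v" "A (B v) = v" "c > 0"
    "gnorm (B v) \<le> c * gnorm v" for u v t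
    using assms unfolding linear_iso_def by blast+
  show A_diff: "A (u - v) = A u - A v" for u v using A(1)[of "u - v" v] by simp
  show "B (u + v) = B u + B v" using A(3)[of "B u + B v"] A(1)[of "B u" "B v"] A(4) by simp
  show "B (u - v) = B u - B v" using A(3)[of "B u - B v"] A_diff[of "B u" "B v"] A(4) by simp
  show "B (scl t v) = scl t (B v)" using A(3)[of "scl t (B v)"] A(2)[of t "B v"] A(4) by simp
qed

text \<open>The constant is chosen such that \<open>B \<circ> (\<Phi> - A)\<close> is Lipschitz with constant \<open>1 / 2\<close>, where
  \<open>B\<close> is the inverse of \<open>A\<close> and is bounded by \<open>c\<close>.\<close>

definition close_to_linear :: "('e \<Rightarrow> 'e) \<Rightarrow> real \<Rightarrow> 'e set \<Rightarrow> ('e \<Rightarrow> 'e) \<Rightarrow> bool"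
  where "close_to_linear A c V \<Phi> \<longleftrightarrow>
    (\<forall>y\<in>V. \<forall>z\<in>V. gnorm (\<Phi> z - \<Phi> y - A (z - y)) \<le> 1 / (2 * c) * gnorm (z - y))"

lemma close_to_linear_expands:
  assumes iso: "linear_iso A B c" and \<Phi>: "close_to_linear A c V \<Phi>" and y: "y \<in> V" and z: "z \<in> V"
  shows "gnorm (z - y) \<le> 2 * c * gnorm (\<Phi> z - \<Phi> y)"
proof -
  note I = linear_isoD[OF iso]
  have "z - y = B (\<Phi> z - \<Phi> y) - B (\<Phi> z - \<Phi> y - A (z - y))" by (simp add: I(4) I(9))
  then have "gnorm (z - y) \<le> gnorm (B (\<Phi> z - \<Phi> y)) + gnorm (B (\<Phi> z - \<Phi> y - A (z - y)))"
    by (metis gnorm_diff_le)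
  also have "\<dots> \<le> c * gnorm (\<Phi> z - \<Phi> y) + c * gnorm (\<Phi> z - \<Phi> y - A (z - y))"
    by (intro add_mono I(7))
  also have "\<dots> \<le> c * gnorm (\<Phi> z - \<Phi> y) + c * (1 / (2 * c) * gnorm (z - y))"
    using \<Phi> y z I(6) by (intro add_left_mono mult_left_mono) (auto simp: close_to_linear_def)
  finally show ?thesis using I(6) by simp
qed

text \<open>Solving \<open>\<Phi>(y) = v\<close> by the contraction \<open>y \<mapsto> y - B(\<Phi>(y) - v)\<close>; the only place where
  completeness of the Banach space enters.\<close>

lemma close_to_linear_open:
  assumes iso: "linear_iso A B c" and \<Phi>: "close_to_linear A c V \<Phi>" and V: "open V"
  shows "open (\<Phi> ` V)"
  unfolding open_dist
proof
  note I = linear_isoD[OF iso]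
  fix y0 assume "y0 \<in> \<Phi> ` V"
  then obtain z0 where z0: "z0 \<in> V" "y0 = \<Phi> z0" by blast
  obtain s where s: "s > 0" "cball z0 s \<subseteq> V" using V z0 open_contains_cball by blast
  have "v \<in> \<Phi> ` V" if v: "dist v y0 < s / (2 * c)" for v
  proof -
    define T where "T = (\<lambda>y. y - B (\<Phi> y - v))"
    have contr: "dist (T z) (T y) \<le> 1 / 2 * dist z y" if yz: "y \<in> V" "z \<in> V" for y z
    proof -
      have "T z - T y = - B (\<Phi> z - \<Phi> y - A (z - y))"
        by (simp add: T_def I(4) I(9))
      then have "gnorm (T z - T y) \<le> c * gnorm (\<Phi> z - \<Phi> y - A (z - y))" using I(7) by simp
      also have "\<dots> \<le> c * (1 / (2 * c) * gnorm (z - y))"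
        using \<Phi> yz I(6) by (intro mult_left_mono) (auto simp: close_to_linear_def)
      finally show ?thesis using I(6) by (simp add: dist_gnorm)
    qed
    have T_in: "T ` cball z0 s \<subseteq> cball z0 s"
    proof
      fix w assume "w \<in> T ` cball z0 s"
      then obtain y where y: "w = T y" "dist z0 y \<le> s" by auto
      have "gnorm (T z0 - z0) = gnorm (B (y0 - v))" by (simp add: T_def z0)
      also have "\<dots> \<le> c * gnorm (y0 - v)" by (rule I(7))
      also have "\<dots> \<le> s / 2"
        using v I(6) by (simp add: dist_gnorm gnorm_diff_commute[of y0 v] field_simps)
      finally have "dist (T z0) z0 \<le> s / 2" by (simp add: dist_gnorm)
      moreover have "dist (T z0) (T y) \<le> 1 / 2 * dist z0 y"
        using y s z0 by (intro contr) auto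
      ultimately have "dist z0 (T y) \<le> s"
        using dist_triangle[of z0 "T y" "T z0"] y(2) by (simp add: dist_commute)
      then show "w \<in> cball z0 s" by (simp add: y)
    qed
    have "\<exists>!y. y \<in> cball z0 s \<and> T y = y"
      using s contr T_in by (intro Banach_fix[where c = "1 / 2"])
        (auto simp: complete_eq_closed subset_iff)
    then obtain y where y: "y \<in> cball z0 s" "T y = y" by blast
    have "B (\<Phi> y - v) = 0" using y(2) by (simp add: T_def)
    then have "\<Phi> y - v = A 0" using I(5)[of "\<Phi> y - v"] by simp
    then have "\<Phi> y = v" using I(2)[of 0 0] by simp
    then show ?thesis using y(1) s(2) by blast
  qed
  then show "\<exists>e>0. \<forall>v. dist v y0 < e \<longrightarrow> v \<in> \<Phi> ` V"
    using s(1) I(6) by (intro exI[of _ "s / (2 * c)"]) simp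
qed

text \<open>A linear map \<open>A'\<close> with \<open>A' - A\<close> small is itself close to \<open>A\<close> on the whole space, so it is
  injective and its image is open; an open linear subspace is everything.\<close>

lemma close_to_linear_iso:
  assumes iso: "linear_iso A B c"
    and A': "\<And>u v. A' (u + v) = A' u + A' v" "\<And>t v. A' (scl t v) = scl t (A' v)"
    and close: "\<And>h. gnorm (A' h - A h) \<le> 1 / (2 * c) * gnorm h"
  shows "linear_iso A' (inv A') (2 * c)"
proof -
  note I = linear_isoD[OF iso]
  have A'_diff: "A' (u - v) = A' u - A' v" for u v using A'(1)[of "u - v" v] by simp
  have cl: "close_to_linear A c UNIV A'"
    unfolding close_to_linear_def using close by (simp flip: A'_diff)
  have bound: "gnorm (z - y) \<le> 2 * c * gnorm (A' z - A' y)" for y z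
    by (rule close_to_linear_expands[OF iso cl]) simp_all
  have inj: "inj A'"
  proof (rule injI)
    fix y z assume "A' y = A' z"
    then have "gnorm (y - z) \<le> 0" using bound[of y z] by simp
    then show "y = z" using gnorm_ge_0[of "y - z"] gnorm_eq_0_iff[of "y - z"] by simp
  qed
  have A'0: "A' 0 = 0" using A'_diff[of 0 0] by simp
  have "open (range A')" by (rule close_to_linear_open[OF iso cl open_UNIV])
  moreover have "0 \<in> range A'" using A'0 by (metis rangeI)
  ultimately obtain r where r: "r > 0" "\<And>v. dist v 0 < r \<Longrightarrow> v \<in> range A'"
    unfolding open_dist by blast
  have surj: "v \<in> range A'" for v
  proof -
    obtain t h where th: "v = scl t h" "gnorm h < r" using E.rescale[OF r(1), of v] by blast
    then obtain u where "h = A' u" using r(2)[of h] by (auto simp: dist_gnorm)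
    then have "v = A' (scl t u)" using th A'(2) by simp
    then show ?thesis by blast
  qed
  have inv: "A' (inv A' v) = v" for v using surj by (rule f_inv_into_f)
  show ?thesis
    unfolding linear_iso_def using A' inv inj I(6) bound[of "inv A' v" 0 for v] A'0
    by (simp add: inv_f_f)
qed

lemma Strict_derivative_in:
  assumes "open V" "w.lin_on base_sp A" "w.approximates (base_vec ` V) A (base_vec x) (emb f)" "x \<in> V"
  shows "A (base_vec h) \<in> base_sp"
    and "((\<lambda>s. scl (1 / s) (f (x + scl s h) - f x)) \<longlongrightarrow> base_part (A (base_vec h))) (at 0)"
proof -
  have lim: "(w.dq (emb f) (base_vec x) (base_vec h) \<longlongrightarrow> A (base_vec h)) (at 0)"
    by (rule w.approximates_tendsto_dq[OF open_domain_base[OF assms(1)] assms(2,3)]) (use assms in auto)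
  have dq: "w.dq (emb f) (base_vec x) (base_vec h) s = base_vec (scl (1 / s) (f (x + scl s h) - f x))" for s
    unfolding w.dq_def by (simp flip: base_vec_scale[OF normed_space] base_vec_add base_vec_diff)
  have "closed base_sp" using closed_subspace_base by (simp add: w.closed_subspace_def)
  then show "A (base_vec h) \<in> base_sp"
    by (rule Lim_in_closed_set[OF _ _ _ lim]) (simp_all add: dq)
  show "((\<lambda>s. scl (1 / s) (f (x + scl s h) - f x)) \<longlongrightarrow> base_part (A (base_vec h))) (at 0)"
    using tendsto_base_part[OF lim] by (simp add: dq coord_base)
qed

lemma lin_on_emb:
  assumes "\<And>u v. B (u + v) = B u + B v" "\<And>t v. B (scl t v) = scl t (B v)" "\<And>v. gnorm (B v) \<le> c * gnorm v"
  shows "w.lin_on base_sp (emb B)"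
  unfolding w.lin_on_def using assms
  by (auto simp: gnorm_base_vec simp flip: base_vec_add base_vec_scale[OF normed_space])

text \<open>Near \<open>x\<close> the map is uniformly close to its derivative at \<open>x\<close>.  Hence it is injective with
  open image there, and its derivatives at the neighbouring points are invertible, being close to
  the derivative at \<open>x\<close> as well.\<close>

lemma local_inverse:
  assumes U: "open U" "x \<in> U" and f: "w.Strict base_sp (base_vec ` U) (emb f)"
    and iso: "linear_iso A B c" and A: "\<And>h. base_vec (A h) = w.qm (emb f) (triple (base_vec x) (base_vec h) 0)"
  obtains V where "open V" "x \<in> V" "V \<subseteq> U" "open (f ` V)" "inj_on f V"
    "w.c1_pair base_sp (base_vec ` V) (base_vec ` f ` V) (emb f) (emb (inv_into V f))"
proof -
  note I = linear_isoD[OF iso]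
  obtain A0 where A0: "w.lin_on base_sp A0" "w.approximates (base_vec ` U) A0 (base_vec x) (emb f)"
    using f U(2) unfolding w.Strict_def by blast
  have A0_eq: "A0 (base_vec h) = base_vec (A h)" for h
    using w.qm_zeroI[OF w.approximates_tendsto_dq[OF open_domain_base[OF U(1)] A0 _ rangeI]] U(2) A by simp
  have half: "1 / (2 * c) > 0" using I(6) by simp
  obtain \<delta> where d: "\<delta> > 0" "\<And>v u. v \<in> base_vec ` U \<Longrightarrow> u \<in> base_vec ` U \<Longrightarrow> gnorm (u - base_vec x) < \<delta> \<Longrightarrow>
      gnorm (v - base_vec x) < \<delta> \<Longrightarrow> gnorm (emb f u - emb f v - A0 (u - v)) \<le> 1 / (2 * c) * gnorm (u - v)"
    by (rule w.approximatesE[OF A0(2) half]) (rule that)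
  obtain r where r: "r > 0" "ball x r \<subseteq> U" using U open_contains_ball by blast
  define V where "V = ball x (min r \<delta>)"
  have V: "open V" "x \<in> V" "V \<subseteq> U" using r d(1) by (auto simp: V_def)
  have cl: "close_to_linear A c V f"
    unfolding close_to_linear_def
  proof (intro ballI)
    fix y z assume yz: "y \<in> V" "z \<in> V"
    have n: "gnorm (z - x) < \<delta>" "gnorm (y - x) < \<delta>"
      using yz by (auto simp: V_def dist_gnorm gnorm_diff_commute)
    have "gnorm (emb f (base_vec z) - emb f (base_vec y) - A0 (base_vec z - base_vec y))
        \<le> 1 / (2 * c) * gnorm (base_vec z - base_vec y :: ('e, 'k) coords)"
      using yz V(3) n by (intro d(2)) (auto simp: gnorm_base_vec simp flip: base_vec_diff)
    then show "gnorm (f z - f y - A (z - y)) \<le> 1 / (2 * c) * gnorm (z - y)"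
      by (simp add: gnorm_base_vec A0_eq flip: base_vec_diff)
  qed
  have open_fV: "open (f ` V)" by (rule close_to_linear_open[OF iso cl V(1)])
  have expand: "gnorm (z - y) \<le> 2 * c * gnorm (f z - f y)" if "y \<in> V" "z \<in> V" for y z
    by (rule close_to_linear_expands[OF iso cl that])
  have inj: "inj_on f V"
  proof (rule inj_onI)
    fix y z assume yz: "y \<in> V" "z \<in> V" "f y = f z"
    then have "gnorm (y - z) \<le> 0" using expand[of z y] by simp
    then show "y = z" using gnorm_ge_0[of "y - z"] gnorm_eq_0_iff[of "y - z"] by simp
  qed
  define g where "g = inv_into V f"
  have g: "\<And>y. y \<in> V \<Longrightarrow> g (f y) = y" using inj by (simp add: g_def)
  have Lip_g: "gnorm (g v - g u) \<le> 2 * c * gnorm (v - u)" if "u \<in> f ` V" "v \<in> f ` V" for u v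
    using that expand g by auto
  have cont: "continuous_on (base_vec ` f ` V) (emb g)"
  proof (rule w.Lip_imp_continuous[where M = base_sp])
    show "w.Lip base_sp (base_vec ` f ` V) (emb g)"
      unfolding w.Lip_def
      by (intro ballI exI[of _ "2 * c"] exI[of _ 1])
        (use Lip_g in \<open>auto simp: gnorm_base_vec simp flip: base_vec_diff\<close>)
  qed
  have Strict_V: "w.Strict base_sp (base_vec ` V) (emb f)"
    using w.Strict_subdomain[OF f] V(3) by blast
  have pair: "w.c1_pair base_sp (base_vec ` V) (base_vec ` f ` V) (emb f) (emb g)"
  proof (rule w.c1_pairI_Strict[OF open_domain_base[OF V(1)] open_domain_base[OF open_fV] Strict_V _ _ cont])
    show "emb f v \<in> base_vec ` f ` V \<and> emb g (emb f v) = v" if "v \<in> base_vec ` V" for v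
      using that g by auto
    show "emb g v \<in> base_vec ` V \<and> emb f (emb g v) = v" if "v \<in> base_vec ` f ` V" for v
      using that g by auto
    fix v A1 assume v: "v \<in> base_vec ` V" and A1: "w.lin_on base_sp A1" "w.approximates (base_vec ` V) A1 v (emb f)"
    obtain y where y: "v = base_vec y" "y \<in> V" using v by blast
    note der = Strict_derivative_in[OF V(1) A1[unfolded y(1)] y(2)]
    define A' where "A' = (\<lambda>h. base_part (A1 (base_vec h)))"
    have A1_eq: "A1 (base_vec h) = base_vec (A' h)" for h
    proof -
      obtain u where "A1 (base_vec h) = base_vec u" using der(1)[of h] by blast
      then show ?thesis by (simp add: A'_def coord_base)
    qed
    have add: "A' (u + w) = A' u + A' w" for u w
    proof -
      have "A1 (base_vec u + base_vec w) = A1 (base_vec u) + A1 (base_vec w)"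
        using A1(1) by (simp add: w.lin_on_def)
      then show ?thesis by (simp add: A1_eq base_vec_eq_iff flip: base_vec_add)
    qed
    have scale: "A' (scl t u) = scl t (A' u)" for t u
    proof -
      have "A1 (coords_scale scl t (base_vec u)) = coords_scale scl t (A1 (base_vec u))"
        using A1(1) by (simp add: w.lin_on_def)
      then show ?thesis by (simp add: A1_eq base_vec_eq_iff flip: base_vec_scale[OF normed_space])
    qed
    have close: "gnorm (A' h - A h) \<le> 1 / (2 * c) * gnorm h" for h
    proof -
      have "((\<lambda>s. gnorm (scl (1 / s) (f (y + scl s h) - f y) - A h)) \<longlongrightarrow> gnorm (A' h - A h)) (at 0)"
        using der(2)[of h] unfolding A'_def by (intro tendsto_intros)
      moreover have "\<forall>\<^sub>F s in at 0. gnorm (scl (1 / s) (f (y + scl s h) - f y) - A h) \<le> 1 / (2 * c) * gnorm h"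
      proof -
        have "((\<lambda>s. y + scl s h) \<longlongrightarrow> y + scl 0 h) (at 0)" by (intro E.tendsto_scale tendsto_intros tendsto_ident_at)
        then have "\<forall>\<^sub>F s in at 0. y + scl s h \<in> V" using V(1) y(2) by (auto dest: topological_tendstoD)
        then show ?thesis using eventually_neq_at_within[of 0 0 UNIV]
        proof eventually_elim
          case (elim s)
          have "gnorm (f (y + scl s h) - f y - A (y + scl s h - y)) \<le> 1 / (2 * c) * gnorm (y + scl s h - y)"
            using cl elim(1) y(2) unfolding close_to_linear_def by blast
          then have "gnorm (f (y + scl s h) - f y - scl s (A h)) \<le> 1 / (2 * c) * (gnorm s * gnorm h)"
            by (simp add: I(3) gnorm_scale)
          moreover have "scl s (scl (1 / s) (f (y + scl s h) - f y) - A h) = f (y + scl s h) - f y - scl s (A h)"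
            using elim(2) by (simp add: scale_right_diff_distrib)
          ultimately have "gnorm s * gnorm (scl (1 / s) (f (y + scl s h) - f y) - A h) \<le>
              gnorm s * (1 / (2 * c) * gnorm h)"
            by (metis gnorm_scale mult.left_commute)
          moreover have "gnorm s > 0" using elim(2) by simp
          ultimately show ?case by (simp only: mult_le_cancel_left_pos)
        qed
      qed
      ultimately show ?thesis by (intro tendsto_upperbound) auto
    qed
    note I' = linear_isoD[OF close_to_linear_iso[OF iso add scale close]]
    have "w.lin_on base_sp (emb (inv A'))" by (rule lin_on_emb[OF I'(8,10,7)])
    moreover have "\<forall>h\<in>base_sp. emb (inv A') (A1 h) = h" using I'(4) by (auto simp: A1_eq)
    ultimately show "(\<forall>h\<in>base_sp. A1 h \<in> base_sp) \<and> (\<exists>B. w.lin_on base_sp B \<and> (\<forall>h\<in>base_sp. B (A1 h) = h))"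
      using der(1) by blast
  qed
  show thesis using that[OF V open_fV inj] pair by (simp add: g_def)
qed

lemma GL_imp_linear_iso:
  assumes "A \<in> GL E"
  obtains B c where "linear_iso A B c"
proof -
  obtain B where A: "continuous_linear E E A" and B: "continuous_linear E E B"
    and inv: "\<And>x. B (A x) = x \<and> A (B x) = x" using assms unfolding GL_def by auto
  obtain c where c: "c > 0" "\<And>v. v \<in> base_sp \<Longrightarrow> gnorm (base_vec (B (base_part v)) :: ('e, 'k) coords) \<le> c * gnorm v"
    by (rule w.lin_on_bound[OF w.rep_continuous_linear_imp(1)[OF rep_E rep_E B]]) (rule that)
  have "gnorm (B h) \<le> c * gnorm h" for h
    using c(2)[OF rangeI, of h] by (simp add: coord_base gnorm_base_vec)
  then have "linear_iso A B c"
    using A inv c(1) unfolding linear_iso_def continuous_linear_def by (simp add: normed_tvs_def)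
  then show thesis by (rule that)
qed

section \<open>Finite dimension over a locally compact field\<close>

lemma compact_unit_ball_field:
  assumes "locally_compact_space (euclidean :: 'k topology)"
  shows "compact {t::'k. gnorm t \<le> 1}"
proof -
  have "\<exists>O'. open O' \<and> (\<exists>K. compact K \<and> (0::'k) \<in> O' \<and> O' \<subseteq> K)"
    using assms unfolding locally_compact_space_def by simp
  then obtain O' K where K: "open O'" "compact K" "(0::'k) \<in> O'" "O' \<subseteq> K" by blast
  then obtain r where r: "r > 0" "ball 0 r \<subseteq> O'" using open_contains_ball by blast
  obtain s :: 'k where s: "s \<noteq> 0" "gnorm s < r" using scalar_of_size[OF r(1), where 'k='k] by blast
  have gs: "gnorm s > 0" using s by simp
  have cl: "closed {u::'k. gnorm u \<le> gnorm s}"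
    by (rule closed_Collect_le) (auto simp: continuous_on_def intro!: tendsto_intros tendsto_ident_at)
  have "compact (K \<inter> {u. gnorm u \<le> gnorm s})" by (rule compact_Int_closed[OF K(2) cl])
  then have "compact ((\<lambda>u. u * (1 / s)) ` (K \<inter> {u. gnorm u \<le> gnorm s}))"
    by (rule compact_continuous_image[rotated, unfolded continuous_on_def])
      (intro ballI tendsto_mult_valued tendsto_const tendsto_ident_at)
  moreover have "(\<lambda>u. u * (1 / s)) ` (K \<inter> {u. gnorm u \<le> gnorm s}) = {t. gnorm t \<le> 1}"
  proof (intro equalityI subsetI)
    fix t assume "t \<in> (\<lambda>u. u * (1 / s)) ` (K \<inter> {u. gnorm u \<le> gnorm s})"
    then obtain u where u: "t = u * (1 / s)" "gnorm u \<le> gnorm s" by blast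
    have "gnorm t = gnorm u / gnorm s" by (simp only: u(1) abs_value_mult gnorm_inverse) simp
    then show "t \<in> {t. gnorm t \<le> 1}" using u(2) gs by (simp del: gnorm_pos_iff)
  next
    fix t :: 'k assume "t \<in> {t. gnorm t \<le> 1}"
    then have "gnorm (t * s) \<le> gnorm s" using gs by (simp add: abs_value_mult mult_left_le_one_le gnorm_ge_0)
    moreover from this have "t * s \<in> K" using s(2) r(2) K(4) by (auto simp: dist_gnorm subset_iff)
    ultimately show "t \<in> (\<lambda>u. u * (1 / s)) ` (K \<inter> {u. gnorm u \<le> gnorm s})"
      using s(1) by (intro image_eqI[of _ _ "t * s"]) auto
  qed
  ultimately show ?thesis by simp
qed

text \<open>Linear combinations with coefficients in compact sets form a compact set, as a continuous
  image of a product.\<close>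

lemma compact_combinations:
  assumes "finite S" "\<And>b. b \<in> S \<Longrightarrow> compact (T b)"
  shows "compact {\<Sum>b\<in>S. scl (u b) b | u. \<forall>b\<in>S. u b \<in> T b}"
  using assms
proof (induction S)
  case empty
  then show ?case by simp
next
  case (insert b S)
  let ?C = "\<lambda>S. {\<Sum>b\<in>S. scl (u b) b | u. \<forall>b\<in>S. u b \<in> T b}"
  have "?C (insert b S) = (\<lambda>p. scl (fst p) b + snd p) ` (T b \<times> ?C S)"
  proof (intro equalityI subsetI)
    fix v assume "v \<in> ?C (insert b S)"
    then obtain u where "v = scl (u b) b + (\<Sum>b\<in>S. scl (u b) b)" "\<forall>b\<in>insert b S. u b \<in> T b"
      using insert by auto
    then show "v \<in> (\<lambda>p. scl (fst p) b + snd p) ` (T b \<times> ?C S)"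
      by (intro image_eqI[of _ _ "(u b, \<Sum>b\<in>S. scl (u b) b)"]) auto
  next
    fix v assume "v \<in> (\<lambda>p. scl (fst p) b + snd p) ` (T b \<times> ?C S)"
    then obtain t u where u: "v = scl t b + (\<Sum>b\<in>S. scl (u b) b)" "t \<in> T b" "\<forall>b\<in>S. u b \<in> T b" by auto
    have "(\<Sum>c\<in>S. scl ((u(b := t)) c) c) = (\<Sum>c\<in>S. scl (u c) c)"
      using insert(2) by (intro sum.cong) auto
    then have "v = (\<Sum>c\<in>insert b S. scl ((u(b := t)) c) c)" using u(1) insert(1,2) by simp
    then show "v \<in> ?C (insert b S)" using u(2,3) insert(2) by (intro CollectI exI[of _ "u(b := t)"]) auto
  qed
  moreover have "compact (T b \<times> ?C S)" using insert by (intro compact_Times) auto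
  then have "compact ((\<lambda>p. scl (fst p) b + snd p) ` (T b \<times> ?C S))"
    by (rule compact_continuous_image[rotated, unfolded continuous_on_def])
      (intro ballI tendsto_add E.tendsto_scale tendsto_fst tendsto_snd tendsto_const tendsto_ident_at)
  ultimately show ?case by simp
qed

text \<open>The vectors whose largest coordinate has absolute value about one form a compact set
  without zero, so their norms are bounded below.  Rescaling, every vector is a multiple of one
  of them by a scalar that its norm controls.\<close>

lemma compact_absorbing_exists:
  assumes K: "locally_compact_space (euclidean :: 'k topology)" and B: "finite_dimensional_vector_space scl B"
  obtains S \<kappa> where "compact S" "w.absorbs base_sp S \<kappa>"
proof -
  interpret fd: finite_dimensional_vector_space scl B by fact
  define D where "D = {t::'k. gnorm t \<le> 1}"
  \<comment> \<open>a largest coordinate can be scaled into this compact set\<close>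
  define R where "R = {t::'k. gnorm t \<le> 1 \<and> gnorm (pivot::'k) \<le> gnorm t}"
  have cD: "compact D" unfolding D_def by (rule compact_unit_ball_field[OF K])
  have "closed {t::'k. gnorm (pivot::'k) \<le> gnorm t}"
    by (rule closed_Collect_le) (auto simp: continuous_on_def intro!: tendsto_intros tendsto_ident_at)
  from compact_Int_closed[OF cD this] have cR: "compact R" by (simp add: D_def R_def Collect_conj_eq)
  define C where "C = (\<lambda>b0. {\<Sum>b\<in>B. scl (u b) b | u. \<forall>b\<in>B. u b \<in> (if b = b0 then R else D)})"
  define S where "S = (\<Union>b0\<in>B. C b0)"
  have cS: "compact S"
    unfolding S_def C_def using fd.finite_Basis cD cR by (intro compact_UN compact_combinations) auto
  have "0 \<notin> S"
  proof
    assume "0 \<in> S"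
    then obtain b0 u where u: "b0 \<in> B" "(\<Sum>b\<in>B. scl (u b) b) = 0" "u b0 \<in> R"
      unfolding S_def C_def by force
    have "gnorm (u b0) > 0"
      using u(3) gnorm_pivot(2)[where 'k='k] by (simp add: R_def del: gnorm_pos_iff)
    then have "u b0 \<noteq> 0" by simp
    then show False
      using u(1,2) fd.independent_Basis dependent_finite[OF fd.finite_Basis] by blast
  qed
  moreover have "open (- S)" using compact_imp_closed[OF cS] by (simp add: open_Compl)
  ultimately obtain m where m: "m > 0" "ball 0 m \<subseteq> - S" using open_contains_ball[of "- S"] by auto
  have norm_S: "m \<le> gnorm h" if "h \<in> S" for h
  proof (rule ccontr)
    assume "\<not> m \<le> gnorm h"
    then have "h \<in> ball 0 m" by (simp add: dist_gnorm)
    then show False using m(2) that by blast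
  qed
  have main: "\<exists>t h. h \<in> S \<and> v = scl t h \<and> t \<noteq> 0 \<and> gnorm t * m \<le> gnorm v" if v: "v \<noteq> 0" for v
  proof -
    have "v \<in> span B" using fd.span_Basis by simp
    then obtain u where u: "v = (\<Sum>b\<in>B. scl (u b) b)"
      unfolding span_finite[OF fd.finite_Basis] by blast
    have B_ne: "B \<noteq> {}" using v u by auto
    define \<mu> where "\<mu> = Max ((\<lambda>b. gnorm (u b)) ` B)"
    have le: "gnorm (u b) \<le> \<mu>" if "b \<in> B" for b
      unfolding \<mu>_def using that fd.finite_Basis by (intro Max_ge) auto
    have "\<mu> \<in> (\<lambda>b. gnorm (u b)) ` B" unfolding \<mu>_def using B_ne fd.finite_Basis by (intro Max_in) auto
    then obtain b0 where b0: "b0 \<in> B" "\<mu> = gnorm (u b0)" by blast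
    have "\<mu> > 0"
    proof (rule ccontr)
      assume "\<not> \<mu> > 0"
      then have "u b = 0" if "b \<in> B" for b
        using le[OF that] gnorm_ge_0[of "u b"] gnorm_eq_0_iff[of "u b"] by auto
      then have "v = 0" by (simp add: u)
      then show False using v by simp
    qed
    have p: "gnorm (pivot::'k) > 0" by (rule gnorm_pivot(2))
    obtain t :: 'k where t: "t \<noteq> 0" "gnorm t < \<mu> / gnorm (pivot::'k)"
      "gnorm (pivot::'k) * (\<mu> / gnorm (pivot::'k)) \<le> gnorm t"
      using scalar_of_size[OF divide_pos_pos[OF \<open>\<mu> > 0\<close> p], where 'k='k] by blast
    have "gnorm (pivot::'k) * (\<mu> / gnorm (pivot::'k)) = \<mu>"
      using p by (simp add: gnorm_eq_0_iff del: gnorm_pos_iff)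
    then have \<mu>t: "\<mu> \<le> gnorm t" using t(3) by simp
    have gt: "gnorm t > 0" using t(1) by simp
    define h where "h = (\<Sum>b\<in>B. scl (u b * (1 / t)) b)"
    have vh: "v = scl t h"
      unfolding u h_def scale_sum_right using t(1) by (intro sum.cong) auto
    have "u b * (1 / t) \<in> D" if "b \<in> B" for b
    proof -
      have "gnorm (u b) \<le> gnorm t" using le[OF that] \<mu>t by linarith
      then show ?thesis using gt by (simp add: D_def gnorm_divide del: gnorm_pos_iff)
    qed
    moreover from this[OF b0(1)] have "u b0 * (1 / t) \<in> R"
    proof -
      assume 1: "u b0 * (1 / t) \<in> D"
      have "gnorm (pivot::'k) * gnorm t \<le> gnorm (u b0)"
        using t(2) p b0(2) by (simp add: field_simps del: gnorm_pos_iff)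
      then have "gnorm (pivot::'k) \<le> gnorm (u b0 * (1 / t))"
        using gt by (simp add: gnorm_divide pos_le_divide_eq del: gnorm_pos_iff)
      then show ?thesis using 1 by (simp add: D_def R_def)
    qed
    ultimately have "h \<in> C b0"
      unfolding C_def h_def by (intro CollectI exI[of _ "\<lambda>b. u b * (1 / t)"]) auto
    then have "h \<in> S" using b0(1) by (auto simp: S_def)
    moreover have "gnorm t * m \<le> gnorm v"
      using norm_S[OF \<open>h \<in> S\<close>] gnorm_ge_0[of t] by (simp add: vh gnorm_scale mult_left_mono)
    ultimately show ?thesis using vh t(1) by blast
  qed
  have "compact (base_vec ` S :: ('e, 'k) coords set)"
    by (rule compact_continuous_image[OF continuous_on_base(1) cS])
  moreover have "w.absorbs base_sp (base_vec ` S) m"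
    unfolding w.absorbs_def
  proof (intro conjI ballI impI)
    fix v :: "('e, 'k) coords" assume "v \<in> base_sp" "v \<noteq> 0"
    then obtain y where y: "v = base_vec y" "y \<noteq> 0" using base_vec_zero by auto
    obtain t h where th: "h \<in> S" "y = scl t h" "t \<noteq> 0" "gnorm t * m \<le> gnorm y" using main[OF y(2)] by blast
    then show "\<exists>t h. h \<in> base_vec ` S \<and> v = coords_scale scl t h \<and> t \<noteq> 0 \<and> gnorm t * m \<le> gnorm v"
      by (intro exI[of _ t] exI[of _ "base_vec h"]) (simp add: y(1) gnorm_base_vec base_vec_scale[OF normed_space] gnorm_scale w.gnorm_scale)
  qed (use m in auto)
  ultimately show thesis by (rule that)
qed

section \<open>The inverse function theorem\<close>

text \<open>The neighbourhood \<open>V\<close> depends on the strict differentiability of \<open>f\<close> only, so it serves all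
  orders at once, which settles \<open>k = \<infinity>\<close>.\<close>

lemma diffeo_from_Strict:
  assumes U: "open U" "x \<in> U" and f: "w.Strict base_sp (base_vec ` U) (emb f)"
    and der: "derivative E E U f x \<in> GL E"
  obtains V where "open V" "x \<in> V" "V \<subseteq> U" "open (f ` V)" "bij_betw f V (f ` V)"
    "dense_interior E V" "dense_interior E (f ` V)"
    "w.c1_pair base_sp (base_vec ` V) (base_vec ` f ` V) (emb f) (emb (inv_into V f))"
proof -
  obtain B c where iso: "linear_iso (derivative E E U f x) B c" by (rule GL_imp_linear_iso[OF der]) (rule that)
  have C1: "C1_map E E U f"
    using w.rep_C1_map[OF rep_E rep_E _ open_domain_base[OF U(1)], of f] w.Strict_imp_C1[OF open_domain_base[OF U(1)] f]
    by (simp add: emb_def[abs_def])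
  have A: "base_vec (derivative E E U f x h) = w.qm (emb f) (triple (base_vec x) (base_vec h) 0)" for h
  proof -
    have "(x, h, 0) \<in> quot_dom E U" using U(2) by (simp add: quot_dom_def normed_tvs_def)
    then show ?thesis
      using w.rep_quot_map[OF rep_E rep_E _ open_domain_base[OF U(1)] _ C1]
      by (simp add: derivative_def emb_def[abs_def])
  qed
  obtain V where V: "open V" "x \<in> V" "V \<subseteq> U" "open (f ` V)" "inj_on f V"
    "w.c1_pair base_sp (base_vec ` V) (base_vec ` f ` V) (emb f) (emb (inv_into V f))"
    by (rule local_inverse[OF U f iso A]) (rule that)
  have dense: "dense_interior E W" if "open W" for W
  proof -
    have "top_of E interior_of W = W"
      using that by (simp add: normed_tvs_def interior_open)
    then show ?thesis
      using closure_of_subset[of W "top_of E"] by (simp add: dense_interior_def)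
  qed
  show thesis
    using that[OF V(1-4) inj_on_imp_bij_betw[OF V(5)] dense[OF V(1)] dense[OF V(4)] V(6)] .
qed

text \<open>The extra hypothesis of the \<open>C\<^sup>k\<close> case is there to make the map strictly differentiable: if
  \<open>k \<ge> 2\<close>, then \<open>f\<^sup>[\<^sup>1\<^sup>]\<close> is \<open>C\<^sup>1\<close>, hence Lipschitz, and otherwise compactness is used.\<close>

lemma Strict_of_Ck:
  assumes U: "open U" and f: "Ck_map k E E U f"
    and k: "k \<ge> 2 \<or> k \<ge> 1 \<and> locally_compact_space (euclidean :: 'k topology) \<and>
      (\<exists>B. finite_dimensional_vector_space scl B)"
  shows "w.Strict base_sp (base_vec ` U) (emb f)"
  using k
proof
  note dom = open_domain_base[OF U]
  assume "k \<ge> 2"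
  obtain n where n: "order_of k (Suc (Suc n))"
  proof (cases k)
    case (enat m)
    then have "2 \<le> m" using \<open>k \<ge> 2\<close> by (simp add: numeral_eq_enat)
    then obtain n where "m = 2 + n" using le_Suc_ex by blast
    then show thesis using that[of n] enat by (simp add: order_of_def)
  next
    case infinity
    then show thesis using that[of 0] by (simp add: order_of_def)
  qed
  have "w.iter_prop w.C1 (\<lambda>M. continuous_on) (Suc (Suc n)) base_sp (base_vec ` U) (emb f)"
    using f n unfolding Ck_map_iff[OF U] by blast
  then have "w.C1 base_sp (base_vec ` U) (emb f)"
    "w.C1 (w.next_sp base_sp) (w.qdom base_sp (base_vec ` U)) (w.qm (emb f))" by simp_all
  then show ?thesis
    using w.Lip_quotient_imp_Strict[OF dom] w.C1_imp_Lip[OF w.open_domain_next[OF dom]] by blast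
next
  note dom = open_domain_base[OF U]
  assume *: "k \<ge> 1 \<and> locally_compact_space (euclidean :: 'k topology) \<and>
      (\<exists>B. finite_dimensional_vector_space scl B)"
  then obtain n where n: "order_of k (Suc n)"
    unfolding order_of_def by (cases k) (auto simp: one_enat_def dest!: Suc_le_D)
  have "w.iter_prop w.C1 (\<lambda>M. continuous_on) (Suc n) base_sp (base_vec ` U) (emb f)"
    using f n unfolding Ck_map_iff[OF U] by blast
  then have C1: "w.C1 base_sp (base_vec ` U) (emb f)" by simp
  obtain B where B: "finite_dimensional_vector_space scl B" using * by blast
  obtain S \<kappa> where S: "compact S" "w.absorbs base_sp S \<kappa>"
    by (rule compact_absorbing_exists[OF _ B]) (use * that in blast)+
  show ?thesis by (rule w.compact_absorbing_imp_Strict[OF dom C1 S(2,1)])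
qed

lemma Strict_of_SCk:
  assumes U: "open U" and k: "k \<ge> 1" and f: "SCk_map k E E U f"
  shows "w.Strict base_sp (base_vec ` U) (emb f)"
proof -
  obtain n where n: "order_of k (Suc n)"
    using k unfolding order_of_def by (cases k) (auto simp: one_enat_def dest!: Suc_le_D)
  then have "w.iter_prop w.Strict (\<lambda>M U f. True) (Suc n) base_sp (base_vec ` U) (emb f)"
    using f unfolding SCk_map_iff[OF U k] by blast
  then show ?thesis by simp
qed

lemma Strict_of_LCk:
  assumes U: "open U" and k: "k \<ge> 1" and f: "LCk_map k E E U f"
  shows "w.Strict base_sp (base_vec ` U) (emb f)"
proof -
  obtain n where n: "order_of k (Suc n)"
    using k unfolding order_of_def by (cases k) (auto simp: one_enat_def dest!: Suc_le_D)
  have 1: "w.iter_prop (\<lambda>M U f. w.C1 M U f \<and> w.Lip M U f) w.Lip (Suc n) base_sp (base_vec ` U) (emb f)"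
    using f n unfolding LCk_map_iff[OF U] by blast
  then have "w.Lip (w.next_sp base_sp) (w.qdom base_sp (base_vec ` U)) (w.qm (emb f))"
    by (cases n) simp_all
  then show ?thesis using w.Lip_quotient_imp_Strict[OF open_domain_base[OF U]] 1 by simp
qed

lemma iter_prop_emb_subdomain:
  assumes P: "w.stable P" and R: "w.stable R" and PC: "\<And>M U f. w.open_domain M U \<Longrightarrow> P M U f \<Longrightarrow> w.C1 M U f"
    and U: "open U" and V: "open V" "V \<subseteq> U" and f: "w.iter_prop P R n base_sp (base_vec ` U) (emb f)"
  shows "w.iter_prop P R n base_sp (base_vec ` V) (emb f)"
proof -
  have st: "w.stable (w.iter_prop P R n)" by (rule w.stable_iter_prop[OF P R PC])
  have op: "openin (top_of_set base_sp) (base_vec ` V :: ('e, 'k) coords set)"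
    using open_domain_base[OF V(1)] by (simp add: w.open_domain_def)
  have sub: "base_vec ` V \<subseteq> (base_vec ` U :: ('e, 'k) coords set)" using V(2) by (rule image_mono)
  show ?thesis
    by (rule w.stable_subdomain[of "w.iter_prop P R n" base_sp "base_vec ` U" "emb f" "base_vec ` V",
          OF st open_domain_base[OF U] f op sub])
qed

end

theorem theorem5p1:
  fixes scl :: "'k::valued_field \<Rightarrow> 'e::{normed_group,complete_space} \<Rightarrow> 'e"
    and U :: "'e set" and f :: "'e \<Rightarrow> 'e" and k :: enat and x :: 'e
  defines "E \<equiv> normed_tvs scl"
  assumes "banach_over scl"
    and "open U" and "x \<in> U" and "k \<ge> 1"
    and "derivative E E U f x \<in> GL E"
  shows
    "(Ck_map k E E U f \<and>
        (k \<ge> 2 \<or> locally_compact_space (euclidean :: 'k topology) \<and>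
          (\<exists>B. finite_dimensional_vector_space scl B)) \<longrightarrow>
        (\<exists>V. open V \<and> x \<in> V \<and> V \<subseteq> U \<and> open (f ` V) \<and> Ck_diffeo k E E V (f ` V) f)) \<and>
     (SCk_map k E E U f \<longrightarrow>
        (\<exists>V. open V \<and> x \<in> V \<and> V \<subseteq> U \<and> open (f ` V) \<and> SCk_diffeo k E E V (f ` V) f)) \<and>
     (LCk_map k E E U f \<longrightarrow>
        (\<exists>V. open V \<and> x \<in> V \<and> V \<subseteq> U \<and> open (f ` V) \<and> LCk_diffeo k E E V (f ` V) f))"
proof -
  interpret banach_over scl by fact
  note U = \<open>open U\<close> \<open>x \<in> U\<close> and k = \<open>k \<ge> 1\<close>
  have der: "derivative (normed_tvs scl) (normed_tvs scl) U f x \<in> GL (normed_tvs scl)"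
    using assms(6) by (simp add: E_def)
  show ?thesis
    unfolding E_def
  proof (intro conjI impI)
    assume *: "Ck_map k (normed_tvs scl) (normed_tvs scl) U f \<and>
        (k \<ge> 2 \<or> locally_compact_space (euclidean :: 'k topology) \<and>
          (\<exists>B. finite_dimensional_vector_space scl B))"
    note f = conjunct1[OF *]
    have "w.Strict base_sp (base_vec ` U) (emb f)"
      by (rule Strict_of_Ck[OF U(1) f]) (use conjunct2[OF *] k in simp)
    from diffeo_from_Strict[OF U this der]
    obtain V where V: "open V" "x \<in> V" "V \<subseteq> U" "open (f ` V)" "bij_betw f V (f ` V)"
      "dense_interior (normed_tvs scl) V" "dense_interior (normed_tvs scl) (f ` V)"
      "w.c1_pair base_sp (base_vec ` V) (base_vec ` f ` V) (emb f) (emb (inv_into V f))" .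
    have f_V: "w.iter_prop w.C1 (\<lambda>M. continuous_on) n base_sp (base_vec ` V) (emb f)" if "order_of k n" for n
    proof (rule iter_prop_emb_subdomain[where P = "w.C1" and R = "\<lambda>M. continuous_on", OF w.stable_C1 w.stable_continuous])
      show "w.C1 M U f" if "w.open_domain M U" "w.C1 M U f" for M U f using that by (simp add: w.Strict_imp_C1)
    qed (use U(1) V(1,3) f[unfolded Ck_map_iff[OF U(1)], rule_format, OF that] in simp_all)
    then have "Ck_map k (normed_tvs scl) (normed_tvs scl) V f" unfolding Ck_map_iff[OF V(1)] by simp
    moreover have "Ck_map k (normed_tvs scl) (normed_tvs scl) (f ` V) (inv_into V f)"
      unfolding Ck_map_iff[OF V(4)] using w.inverse_Ck[OF V(8) f_V] by simp
    ultimately have "Ck_diffeo k (normed_tvs scl) (normed_tvs scl) V (f ` V) f"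
      using V(5-7) by (simp add: Ck_diffeo_def)
    then show "\<exists>V. open V \<and> x \<in> V \<and> V \<subseteq> U \<and> open (f ` V) \<and>
        Ck_diffeo k (normed_tvs scl) (normed_tvs scl) V (f ` V) f"
      using V(1-4) by (intro exI[of _ V]) simp
  next
    assume f: "SCk_map k (normed_tvs scl) (normed_tvs scl) U f"
    from diffeo_from_Strict[OF U Strict_of_SCk[OF U(1) k f] der]
    obtain V where V: "open V" "x \<in> V" "V \<subseteq> U" "open (f ` V)" "bij_betw f V (f ` V)"
      "dense_interior (normed_tvs scl) V" "dense_interior (normed_tvs scl) (f ` V)"
      "w.c1_pair base_sp (base_vec ` V) (base_vec ` f ` V) (emb f) (emb (inv_into V f))" .
    have cont: "continuous_on (base_vec ` V) (emb f)" "continuous_on (base_vec ` f ` V) (emb (inv_into V f))"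
      using w.c1_pairD(3,4)[OF V(8)] by (simp_all add: w.C1_def)
    have f_V: "w.iter_prop w.Strict (\<lambda>M U f. True) (Suc n) base_sp (base_vec ` V) (emb f)"
      if "order_of k (Suc n)" for n
    proof (rule iter_prop_emb_subdomain[where P = "w.Strict" and R = "\<lambda>M U f. True", OF w.stable_Strict w.stable_True])
      show "w.C1 M U f" if "w.open_domain M U" "w.Strict M U f" for M U f using that by (simp add: w.Strict_imp_C1)
    qed (use U(1) V(1,3) f[unfolded SCk_map_iff[OF U(1) k], THEN conjunct2, rule_format, OF that] in simp_all)
    then have "SCk_map k (normed_tvs scl) (normed_tvs scl) V f"
      unfolding SCk_map_iff[OF V(1) k] using cont by simp
    moreover have "SCk_map k (normed_tvs scl) (normed_tvs scl) (f ` V) (inv_into V f)"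
      unfolding SCk_map_iff[OF V(4) k] using w.inverse_SCk[OF V(8) f_V] cont by simp
    ultimately have "SCk_diffeo k (normed_tvs scl) (normed_tvs scl) V (f ` V) f"
      using V(5-7) by (simp add: SCk_diffeo_def)
    then show "\<exists>V. open V \<and> x \<in> V \<and> V \<subseteq> U \<and> open (f ` V) \<and>
        SCk_diffeo k (normed_tvs scl) (normed_tvs scl) V (f ` V) f"
      using V(1-4) by (intro exI[of _ V]) simp
  next
    assume f: "LCk_map k (normed_tvs scl) (normed_tvs scl) U f"
    from diffeo_from_Strict[OF U Strict_of_LCk[OF U(1) k f] der]
    obtain V where V: "open V" "x \<in> V" "V \<subseteq> U" "open (f ` V)" "bij_betw f V (f ` V)"
      "dense_interior (normed_tvs scl) V" "dense_interior (normed_tvs scl) (f ` V)"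
      "w.c1_pair base_sp (base_vec ` V) (base_vec ` f ` V) (emb f) (emb (inv_into V f))" .
    have f_V: "w.iter_prop (\<lambda>M U f. w.C1 M U f \<and> w.Lip M U f) w.Lip n base_sp (base_vec ` V) (emb f)"
      if "order_of k n" for n
    proof (rule iter_prop_emb_subdomain[where P = "\<lambda>M U f. w.C1 M U f \<and> w.Lip M U f" and R = "w.Lip", OF w.stable_conj[OF w.stable_C1 w.stable_Lip] w.stable_Lip])
      show "w.C1 M U f" if "w.open_domain M U" "w.C1 M U f \<and> w.Lip M U f" for M U f using that by (simp add: w.Strict_imp_C1)
    qed (use U(1) V(1,3) f[unfolded LCk_map_iff[OF U(1)], rule_format, OF that] in simp_all)
    then have "LCk_map k (normed_tvs scl) (normed_tvs scl) V f" unfolding LCk_map_iff[OF V(1)] by simp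
    moreover have "LCk_map k (normed_tvs scl) (normed_tvs scl) (f ` V) (inv_into V f)"
      unfolding LCk_map_iff[OF V(4)] using w.inverse_LCk[OF V(8) f_V] by simp
    ultimately have "LCk_diffeo k (normed_tvs scl) (normed_tvs scl) V (f ` V) f"
      using V(5-7) by (simp add: LCk_diffeo_def)
    then show "\<exists>V. open V \<and> x \<in> V \<and> V \<subseteq> U \<and> open (f ` V) \<and>
        LCk_diffeo k (normed_tvs scl) (normed_tvs scl) V (f ` V) f"
      using V(1-4) by (intro exI[of _ V]) simp
  qed
qed

end
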